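(* Let $u_h^{cr}\in K_h^{cr}$ be the discrete primal solution (the unique minimizer of $I_h^{cr}$). The following statements apply. (i) The (Fenchel) dual problem to the minimization of $I_h^{cr}$ is given via the maximization of $D_h^{rt}$ over $\mathcal{R}T^0(\mathcal{T}_h)$; that is, for every $\overline y_h\in(\mathcal{L}^0(\mathcal{T}_h))^d$, $$-G_h^*(\overline y_h)-F_h^*(-\nabla_h^*\overline y_h)=\sup\{D_h^{rt}(y_h): y_h\in\mathcal{R}T^0(\mathcal{T}_h),\ \Pi_hy_h=\overline y_h\}\qquad(\sup\emptyset=-\infty).$$ (ii) There exists a maximizer $z_h^{rt}\in\mathcal{R}T^0(\mathcal{T}_h)$ of $D_h^{rt}$ satisfying $$\operatorname{div}z_h^{rt}=-f_h\ \text{ a.e. in }\Omega,\qquad z_h^{rt}\cdot n=g_h\ \text{ a.e. on }\Gamma_N.$$ In addition, discrete strong duality holds: $I_h^{cr}(u_h^{cr})=D_h^{rt}(z_h^{rt})$. (iii) If the discrete strong duality relation $I_h^{cr}(u_h^{cr})=D_h^{rt}(z_h^{rt})$ holds, then $$\nabla_hu_h^{cr}=D_t\phi_h^*(\cdot,\Pi_hz_h^{rt})=\begin{cases}\Pi_hz_h^{rt}&\text{if }|\Pi_hz_h^{rt}|\le\zeta_h,\\ \zeta_h\frac{\Pi_hz_h^{rt}}{|\Pi_hz_h^{rt}|}&\text{if }|\Pi_hz_h^{rt}|>\zeta_h\end{cases}\quad\text{a.e. in }\Omega.$$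
   Context: Let $\Omega\subseteq\mathbb{R}^d$, $d\in\mathbb{N}$, be a bounded simplicial Lipschitz domain with $\partial\Omega=\overline\Gamma_D\cup\overline\Gamma_N$, $\Gamma_D,\Gamma_N$ disjoint and relatively open, $|\Gamma_D|>0$. $\mathcal{T}_h$ is a (shape-regular, conforming) simplicial triangulation of $\Omega$; $\mathcal{S}_h$ is the set of its sides (($d-1$)-dimensional faces), $\mathcal{S}_h^i$ the interior sides, $\mathcal{S}_h^{\Gamma_D},\mathcal{S}_h^{\Gamma_N}$ the boundary sides whose relative interior lies in $\Gamma_D$, resp. $\Gamma_N$; every boundary side belongs to exactly one of these two sets. $(v,w)_\omega=\int_\omega v\cdot w$; $\|\cdot\|_{p,\omega}$ is the $L^p(\omega)$-norm. $\mathcal{L}^k(\mathcal{T}_h)$ are the element-wise polynomials of degree $\le k$; $\mathcal{L}^0(\mathcal{S}_h^{\gamma})$ the side-wise constant functions on $\mathcal{S}_h^\gamma$. $\Pi_h$ is the $L^2$-projection onto element-wise constants (element averages, component-wise for vector fields), $\pi_h$ the projection onto side-wise constants (side averages). $\nabla_h$ is the element-wise gradient. $\mathcal{S}^{1,cr}(\mathcal{T}_h)=\{v_h\in\mathcal{L}^1(\mathcal{T}_h):$ the side average of the jump of $v_h$ vanishes on every interior side$\}$ (Crouzeix–Raviart). $\mathcal{R}T^0(\mathcal{T}_h)=\{y_h\in(\mathcal{L}^1(\mathcal{T}_h))^d: y_h|_T\cdot n_T$ is constant on each side of each $T\in\mathcal{T}_h$ and the normal jump of $y_h$ vanishes on every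 interior side$\}$ (lowest-order Raviart–Thomas; on each $T$, $y_h(x)=a_T+b_Tx$ with $a_T\in\mathbb{R}^d,b_T\in\mathbb{R}$). $n$ is the outward unit normal on $\partial\Omega$. Data: $f_h\in\mathcal{L}^0(\mathcal{T}_h)$, $g_h\in\mathcal{L}^0(\mathcal{S}_h^{\Gamma_N})$, $\zeta_h\in\mathcal{L}^0(\mathcal{T}_h)$ with $\operatorname{ess\,inf}_\Omega\zeta_h>0$, $u_D^h\in\mathcal{L}^0(\mathcal{S}_h^{\Gamma_D})$ such that there exists $\widehat u_D^h\in\mathcal{S}^{1,cr}(\mathcal{T}_h)$ with $\pi_h\widehat u_D^h=u_D^h$ on $\Gamma_D$ and $\|\nabla_h\widehat u_D^h/\zeta_h\|_{\infty,\Omega}<1$. For a.e. $x$ and $s,t\in\mathbb{R}^d$: $\phi_h(x,t)=\frac12|t|^2$ if $|t|\le\zeta_h(x)$, $+\infty$ otherwise; $\phi_h^*(x,s)=\frac12|s|^2$ if $|s|\le\zeta_h(x)$, $\phi_h^*(x,s)=\zeta_h(x)|s|-\frac12\zeta_h(x)^2$ if $|s|>\zeta_h(x)$ (Fenchel conjugate). $D_t\phi_h^*$ is the gradient in the second argument. Discrete primal problem: $K_h^{cr}=\{v_h\in\mathcal{S}^{1,cr}(\mathcal{T}_h):|\nabla_hv_h|\le\zeta_h\text{ a.e. in }\Omega,\ \pi_hv_h=u_D^h\text{ a.e. on }\Gamma_D\}$; $I_h^{cr}(v_h)=\frac12\|\nabla_hv_h\|_{2,\Omega}^2-(f_h,\Pi_hv_h)_\Omega-(g_h,\pi_hv_h)_{\Gamma_N}$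 if $v_h\in K_h^{cr}$ and $+\infty$ for other $v_h\in\mathcal{S}^{1,cr}(\mathcal{T}_h)$. It has a unique minimizer $u_h^{cr}$. Discrete dual functional: $K_h^{rt,*}=\{y_h\in\mathcal{R}T^0(\mathcal{T}_h):\operatorname{div}y_h=-f_h\text{ a.e. in }\Omega,\ y_h\cdot n=g_h\text{ a.e. on }\Gamma_N\}$; $D_h^{rt}(y_h)=-\int_\Omega\phi_h^*(\cdot,\Pi_hy_h)\,\mathrm{d}x+(y_h\cdot n,u_D^h)_{\Gamma_D}$ if $y_h\in K_h^{rt,*}$ and $-\infty$ for other $y_h\in\mathcal{R}T^0(\mathcal{T}_h)$. Fenchel dual: with $G_h(\overline y_h)=\int_\Omega\phi_h(\cdot,\overline y_h)\,\mathrm{d}x$ on $(\mathcal{L}^0(\mathcal{T}_h))^d$ and $F_h(v_h)=-(f_h,\Pi_hv_h)_\Omega-(g_h,\pi_hv_h)_{\Gamma_N}$ if $\pi_hv_h=u_D^h$ on $\Gamma_D$, $+\infty$ otherwise, on $\mathcal{S}^{1,cr}(\mathcal{T}_h)$, one has $I_h^{cr}(v_h)=G_h(\nabla_hv_h)+F_h(v_h)$, and the Fenchel dual problem is the maximization of $\overline y_h\mapsto-G_h^*(\overline y_h)-F_h^*(-\nabla_h^*\overline y_h)$ over $(\mathcal{L}^0(\mathcal{T}_h))^d$; $(\mathcal{L}^0(\mathcal{T}_h))^d$ is identified with its dual via $(\cdot,\cdot)_\Omega$ and $\nabla_h^*$ is the adjoint of $\nabla_h:\mathcal{S}^{1,cr}(\mathcal{T}_h)\to(\mathcal{L}^0(\mathcal{T}_h))^d$.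 *)

theory Defs
  imports "HOL-Analysis.Analysis" "HOL-Probability.Essential_Supremum"
begin

section \<open>Domain and triangulation\<close>

text \<open>Near each of its boundary points a Lipschitz domain is the strict subgraph, in some direction
  \<open>e\<close>, of a Lipschitz function on the hyperplane orthogonal to \<open>e\<close>.\<close>

definition lipschitz_domain :: "'a::euclidean_space set \<Rightarrow> bool" where
  "lipschitz_domain \<Omega> \<longleftrightarrow> open \<Omega> \<and> connected \<Omega> \<and> \<Omega> \<noteq> {} \<and>
    (\<forall>x\<in>frontier \<Omega>. \<exists>r>0. \<exists>e L \<gamma>. norm e = 1 \<and> L-lipschitz_on {y. y \<bullet> e = 0} \<gamma> \<and>
       \<Omega> \<inter> ball x r = {y \<in> ball x r. y \<bullet> e < \<gamma> (y - (y \<bullet> e) *\<^sub>R e)})"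

text \<open>Conformity (two elements meet in a common face) is part of the library's
  \<^const>\<open>triangulation\<close>; elements are closed simplices.\<close>

definition simplicial_mesh :: "'a::euclidean_space set \<Rightarrow> 'a set set \<Rightarrow> bool" where
  "simplicial_mesh \<Omega> \<T> \<longleftrightarrow>
     triangulation \<T> \<and> (\<forall>T\<in>\<T>. int DIM('a) simplex T) \<and> \<Union>\<T> = closure \<Omega>"

definition shape_regular :: "real \<Rightarrow> 'a::euclidean_space set set \<Rightarrow> bool" where
  "shape_regular \<omega>\<^sub>0 \<T> \<longleftrightarrow>
     (\<forall>T\<in>\<T>. diameter T \<le> \<omega>\<^sub>0 * Sup {r. 0 < r \<and> (\<exists>x\<in>T. ball x r \<subseteq> T)})"

definition sides :: "'a::euclidean_space set set \<Rightarrow> 'a set set" where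
  "sides \<T> = {S. \<exists>T\<in>\<T>. S facet_of T}"

definition boundary_sides :: "'a::euclidean_space set \<Rightarrow> 'a set set \<Rightarrow> 'a set set" where
  "boundary_sides \<Omega> \<T> = {S \<in> sides \<T>. S \<subseteq> frontier \<Omega>}"

definition interior_sides :: "'a::euclidean_space set \<Rightarrow> 'a set set \<Rightarrow> 'a set set" where
  "interior_sides \<Omega> \<T> = sides \<T> - boundary_sides \<Omega> \<T>"

definition sides_in :: "'a::euclidean_space set \<Rightarrow> 'a set set \<Rightarrow> 'a set \<Rightarrow> 'a set set" where
  "sides_in \<Omega> \<T> \<Gamma> = {S \<in> boundary_sides \<Omega> \<T>. rel_interior S \<subseteq> \<Gamma>}"

definition outer_normal :: "'a::euclidean_space set \<Rightarrow> 'a set \<Rightarrow> 'a" where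
  "outer_normal T S = (THE n. norm n = 1 \<and> (\<forall>x\<in>S. \<forall>y\<in>T. n \<bullet> y \<le> n \<bullet> x))"


section \<open>Surface measure\<close>

text \<open>The \<open>(d - 1)\<close>-dimensional Lebesgue measure on the hyperplane spanned by a side \<open>S\<close>, restricted
  to \<open>S\<close>: by Fubini, the \<open>(d - 1)\<close>-dimensional measure of \<open>A \<subseteq> S\<close> is the \<open>d\<close>-dimensional measure of
  the right cylinder of height 1 over \<open>A\<close>. It is realized as the image of Lebesgue measure on the
  cylinder over \<open>S\<close> under the orthogonal projection onto the hyperplane. For \<open>d = 1\<close> it is the
  point mass at the single point of \<open>S\<close>. The choice of the sign of the normal is immaterial.\<close>

definition side_cylinder :: "'a::euclidean_space set \<Rightarrow> 'a set" where
  "side_cylinder S =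
     (let n = (SOME n. norm n = 1 \<and> (\<forall>x\<in>S. \<forall>y\<in>S. n \<bullet> (x - y) = 0))
      in {x + t *\<^sub>R n | x t. x \<in> S \<and> 0 \<le> t \<and> t \<le> 1})"

definition side_measure :: "'a::euclidean_space set \<Rightarrow> 'a measure" where
  "side_measure S = completion
     (distr (restrict_space lborel (side_cylinder S)) borel (closest_point (affine hull S)))"

definition bd_measure :: "'a::euclidean_space set \<Rightarrow> 'a set set \<Rightarrow> 'a measure" where
  "bd_measure \<Omega> \<T> = completion
     (measure_of UNIV (sets borel) (\<lambda>A. \<Sum>S\<in>boundary_sides \<Omega> \<T>. emeasure (side_measure S) A))"

definition side_avg :: "'a::euclidean_space set \<Rightarrow> ('a \<Rightarrow> real) \<Rightarrow> real" where
  "side_avg S v = (LINT x:S|side_measure S. v x) / measure (side_measure S) S"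

definition ip :: "'a measure \<Rightarrow> 'a set \<Rightarrow> ('a \<Rightarrow> 'b::euclidean_space) \<Rightarrow> ('a \<Rightarrow> 'b) \<Rightarrow> real" where
  "ip M A v w = (LINT x:A|M. v x \<bullet> w x)"


section \<open>Discrete function spaces\<close>

text \<open>Discrete functions are functions on \<open>\<Omega>\<close> that are determined almost everywhere: they are
  prescribed on the interiors of the elements and are arbitrary on the skeleton (similarly,
  side-wise functions are prescribed on the relative interiors of the sides).\<close>

definition broken_P0 :: "'a::euclidean_space set set \<Rightarrow> ('a \<Rightarrow> 'b::euclidean_space) set" where
  "broken_P0 \<T> = {v. \<forall>T\<in>\<T>. \<exists>c. \<forall>x\<in>interior T. v x = c}"

definition broken_P1 :: "'a::euclidean_space set set \<Rightarrow> ('a \<Rightarrow> 'b::euclidean_space) set" where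
  "broken_P1 \<T> = {v. \<forall>T\<in>\<T>. \<exists>A c. linear A \<and> (\<forall>x\<in>interior T. v x = A x + c)}"

definition side_P0 :: "'a::euclidean_space set \<Rightarrow> 'a set set \<Rightarrow> 'a set \<Rightarrow> ('a \<Rightarrow> real) set" where
  "side_P0 \<Omega> \<T> \<Gamma> = {g. \<forall>S\<in>sides_in \<Omega> \<T> \<Gamma>. \<exists>c. \<forall>x\<in>rel_interior S. g x = c}"

text \<open>The trace at \<open>x \<in> T\<close> of \<open>v\<close> restricted to \<open>T\<close>; for element-wise polynomials this is the value at
  \<open>x\<close> of the polynomial representing \<open>v\<close> on \<open>T\<close>.\<close>

definition elem_trace :: "'a::euclidean_space set \<Rightarrow> ('a \<Rightarrow> 'b::euclidean_space) \<Rightarrow> 'a \<Rightarrow> 'b" where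
  "elem_trace T v x = Lim (at x within interior T) v"

definition grad_h :: "'a::euclidean_space set set \<Rightarrow> ('a \<Rightarrow> real) \<Rightarrow> 'a \<Rightarrow> 'a" where
  "grad_h \<T> v x = (if x \<in> (\<Union>T\<in>\<T>. interior T) then (THE D. GDERIV v x :> D) else 0)"

definition div_h :: "'a::euclidean_space set set \<Rightarrow> ('a \<Rightarrow> 'a) \<Rightarrow> 'a \<Rightarrow> real" where
  "div_h \<T> y x = (if x \<in> (\<Union>T\<in>\<T>. interior T)
                 then (\<Sum>b\<in>Basis. frechet_derivative y (at x) b \<bullet> b) else 0)"

definition Pi_h :: "'a::euclidean_space set set \<Rightarrow> ('a \<Rightarrow> 'b::euclidean_space) \<Rightarrow> 'a \<Rightarrow> 'b" where
  "Pi_h \<T> w x = (\<Sum>T\<in>\<T>. indicator (interior T) x *\<^sub>R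
       ((1 / measure lebesgue T) *\<^sub>R (LINT z:T|lebesgue. w z)))"

definition CR :: "'a::euclidean_space set \<Rightarrow> 'a set set \<Rightarrow> ('a \<Rightarrow> real) set" where
  "CR \<Omega> \<T> = {v \<in> broken_P1 \<T>.
     \<forall>S\<in>interior_sides \<Omega> \<T>. \<forall>T\<in>\<T>. \<forall>T'\<in>\<T>. T \<noteq> T' \<and> S facet_of T \<and> S facet_of T' \<longrightarrow>
       side_avg S (\<lambda>x. elem_trace T v x - elem_trace T' v x) = 0}"

definition RT :: "'a::euclidean_space set \<Rightarrow> 'a set set \<Rightarrow> ('a \<Rightarrow> 'a) set" where
  "RT \<Omega> \<T> = {y \<in> broken_P1 \<T>.
     (\<forall>T\<in>\<T>. \<forall>S. S facet_of T \<longrightarrow> (\<exists>c. \<forall>x\<in>S. elem_trace T y x \<bullet> outer_normal T S = c)) \<and>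
     (\<forall>S\<in>interior_sides \<Omega> \<T>. \<forall>T\<in>\<T>. \<forall>T'\<in>\<T>. T \<noteq> T' \<and> S facet_of T \<and> S facet_of T' \<longrightarrow>
       (\<forall>x\<in>S. elem_trace T y x \<bullet> outer_normal T S + elem_trace T' y x \<bullet> outer_normal T' S = 0))}"


section \<open>Boundary traces\<close>

text \<open>Almost every boundary point lies in the relative interior of exactly one boundary side, and
  each boundary side is a side of exactly one element.\<close>

definition bd_side :: "'a::euclidean_space set \<Rightarrow> 'a set set \<Rightarrow> 'a \<Rightarrow> 'a set" where
  "bd_side \<Omega> \<T> x = (THE S. S \<in> boundary_sides \<Omega> \<T> \<and> x \<in> rel_interior S)"

definition bd_elem :: "'a::euclidean_space set \<Rightarrow> 'a set set \<Rightarrow> 'a \<Rightarrow> 'a set" where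
  "bd_elem \<Omega> \<T> x = (THE T. T \<in> \<T> \<and> bd_side \<Omega> \<T> x facet_of T)"

definition bd_normal :: "'a::euclidean_space set \<Rightarrow> 'a set set \<Rightarrow> 'a \<Rightarrow> 'a" where
  "bd_normal \<Omega> \<T> x = outer_normal (bd_elem \<Omega> \<T> x) (bd_side \<Omega> \<T> x)"

definition normal_trace :: "'a::euclidean_space set \<Rightarrow> 'a set set \<Rightarrow> ('a \<Rightarrow> 'a) \<Rightarrow> 'a \<Rightarrow> real" where
  "normal_trace \<Omega> \<T> y x = elem_trace (bd_elem \<Omega> \<T> x) y x \<bullet> bd_normal \<Omega> \<T> x"

text \<open>Only the values of the side-wise averages on boundary sides are needed.\<close>

definition pi_h :: "'a::euclidean_space set \<Rightarrow> 'a set set \<Rightarrow> ('a \<Rightarrow> real) \<Rightarrow> 'a \<Rightarrow> real" where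
  "pi_h \<Omega> \<T> v x = side_avg (bd_side \<Omega> \<T> x) (elem_trace (bd_elem \<Omega> \<T> x) v)"

definition mixed_boundary :: "'a::euclidean_space set \<Rightarrow> 'a set set \<Rightarrow> 'a set \<Rightarrow> 'a set \<Rightarrow> bool" where
  "mixed_boundary \<Omega> \<T> \<Gamma>\<^sub>D \<Gamma>\<^sub>N \<longleftrightarrow>
     openin (top_of_set (frontier \<Omega>)) \<Gamma>\<^sub>D \<and> openin (top_of_set (frontier \<Omega>)) \<Gamma>\<^sub>N \<and>
     \<Gamma>\<^sub>D \<inter> \<Gamma>\<^sub>N = {} \<and> frontier \<Omega> = closure \<Gamma>\<^sub>D \<union> closure \<Gamma>\<^sub>N \<and>
     0 < emeasure (bd_measure \<Omega> \<T>) \<Gamma>\<^sub>D \<and>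
     (\<forall>S\<in>boundary_sides \<Omega> \<T>. (S \<in> sides_in \<Omega> \<T> \<Gamma>\<^sub>D) \<noteq> (S \<in> sides_in \<Omega> \<T> \<Gamma>\<^sub>N))"


section \<open>Primal and dual problems\<close>

definition essinf :: "'a measure \<Rightarrow> ('a \<Rightarrow> ereal) \<Rightarrow> ereal" where
  "essinf M w = - esssup M (\<lambda>x. - w x)"

definition dirichlet_data ::
  "'a::euclidean_space set \<Rightarrow> 'a set set \<Rightarrow> 'a set \<Rightarrow> ('a \<Rightarrow> real) \<Rightarrow> ('a \<Rightarrow> real) \<Rightarrow> bool" where
  "dirichlet_data \<Omega> \<T> \<Gamma>\<^sub>D u\<^sub>D v \<longleftrightarrow>
     (AE x in bd_measure \<Omega> \<T>. x \<in> \<Gamma>\<^sub>D \<longrightarrow> pi_h \<Omega> \<T> v x = u\<^sub>D x)"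

definition phi :: "('a::euclidean_space \<Rightarrow> real) \<Rightarrow> 'a \<Rightarrow> 'a \<Rightarrow> ereal" where
  "phi \<zeta> x t = (if norm t \<le> \<zeta> x then ereal ((norm t)\<^sup>2 / 2) else \<infinity>)"

definition phi_star :: "('a::euclidean_space \<Rightarrow> real) \<Rightarrow> 'a \<Rightarrow> 'a \<Rightarrow> real" where
  "phi_star \<zeta> x s =
     (if norm s \<le> \<zeta> x then (norm s)\<^sup>2 / 2 else \<zeta> x * norm s - (\<zeta> x)\<^sup>2 / 2)"

definition K_cr :: "'a::euclidean_space set \<Rightarrow> 'a set set \<Rightarrow> 'a set \<Rightarrow> ('a \<Rightarrow> real) \<Rightarrow> ('a \<Rightarrow> real) \<Rightarrow>
    ('a \<Rightarrow> real) set" where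
  "K_cr \<Omega> \<T> \<Gamma>\<^sub>D \<zeta> u\<^sub>D = {v \<in> CR \<Omega> \<T>.
     (AE x in lebesgue_on \<Omega>. norm (grad_h \<T> v x) \<le> \<zeta> x) \<and> dirichlet_data \<Omega> \<T> \<Gamma>\<^sub>D u\<^sub>D v}"

definition I_cr :: "'a::euclidean_space set \<Rightarrow> 'a set set \<Rightarrow> 'a set \<Rightarrow> 'a set \<Rightarrow> ('a \<Rightarrow> real) \<Rightarrow>
    ('a \<Rightarrow> real) \<Rightarrow> ('a \<Rightarrow> real) \<Rightarrow> ('a \<Rightarrow> real) \<Rightarrow> ('a \<Rightarrow> real) \<Rightarrow> ereal" where
  "I_cr \<Omega> \<T> \<Gamma>\<^sub>D \<Gamma>\<^sub>N f g \<zeta> u\<^sub>D v =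
     (if v \<in> K_cr \<Omega> \<T> \<Gamma>\<^sub>D \<zeta> u\<^sub>D
      then ereal ((LINT x:\<Omega>|lebesgue. (norm (grad_h \<T> v x))\<^sup>2) / 2
                  - ip lebesgue \<Omega> f (Pi_h \<T> v) - ip (bd_measure \<Omega> \<T>) \<Gamma>\<^sub>N g (pi_h \<Omega> \<T> v))
      else \<infinity>)"

definition K_rt :: "'a::euclidean_space set \<Rightarrow> 'a set set \<Rightarrow> 'a set \<Rightarrow> ('a \<Rightarrow> real) \<Rightarrow> ('a \<Rightarrow> real) \<Rightarrow>
    ('a \<Rightarrow> 'a) set" where
  "K_rt \<Omega> \<T> \<Gamma>\<^sub>N f g = {y \<in> RT \<Omega> \<T>.
     (AE x in lebesgue_on \<Omega>. div_h \<T> y x = - f x) \<and>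
     (AE x in bd_measure \<Omega> \<T>. x \<in> \<Gamma>\<^sub>N \<longrightarrow> normal_trace \<Omega> \<T> y x = g x)}"

definition D_rt :: "'a::euclidean_space set \<Rightarrow> 'a set set \<Rightarrow> 'a set \<Rightarrow> 'a set \<Rightarrow> ('a \<Rightarrow> real) \<Rightarrow>
    ('a \<Rightarrow> real) \<Rightarrow> ('a \<Rightarrow> real) \<Rightarrow> ('a \<Rightarrow> real) \<Rightarrow> ('a \<Rightarrow> 'a) \<Rightarrow> ereal" where
  "D_rt \<Omega> \<T> \<Gamma>\<^sub>D \<Gamma>\<^sub>N f g \<zeta> u\<^sub>D y =
     (if y \<in> K_rt \<Omega> \<T> \<Gamma>\<^sub>N f g
      then ereal (- (LINT x:\<Omega>|lebesgue. phi_star \<zeta> x (Pi_h \<T> y x))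
                  + ip (bd_measure \<Omega> \<T>) \<Gamma>\<^sub>D (normal_trace \<Omega> \<T> y) u\<^sub>D)
      else - \<infinity>)"


section \<open>Fenchel duality\<close>

text \<open>Fenchel conjugate of \<open>J\<close> on the space \<open>X\<close>, evaluated at the linear functional \<open>l\<close> on \<open>X\<close>.\<close>

definition fenchel_conj :: "'v set \<Rightarrow> ('v \<Rightarrow> ereal) \<Rightarrow> ('v \<Rightarrow> real) \<Rightarrow> ereal" where
  "fenchel_conj X J l = (SUP v\<in>X. ereal (l v) - J v)"

lemma phi_star_conj:
  assumes "0 \<le> \<zeta> x"
  shows "ereal (phi_star \<zeta> x s) = fenchel_conj UNIV (phi \<zeta> x) (\<lambda>t. s \<bullet> t)"
  unfolding fenchel_conj_def
proof (rule antisym)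
  show "(SUP t\<in>UNIV. ereal (s \<bullet> t) - phi \<zeta> x t) \<le> ereal (phi_star \<zeta> x s)"
  proof (rule SUP_least)
    fix t
    show "ereal (s \<bullet> t) - phi \<zeta> x t \<le> ereal (phi_star \<zeta> x s)"
    proof (cases "norm t \<le> \<zeta> x")
      case True
      have cs: "s \<bullet> t \<le> norm s * norm t" by (rule norm_cauchy_schwarz)
      have "s \<bullet> t - (norm t)\<^sup>2 / 2 \<le> phi_star \<zeta> x s"
      proof (cases "norm s \<le> \<zeta> x")
        case True
        have "0 \<le> (norm s - norm t)\<^sup>2" by simp
        with cs show ?thesis using True by (simp add: phi_star_def power2_diff)
      next
        case False
        have "0 \<le> (\<zeta> x - norm t) * (2 * norm s - (\<zeta> x + norm t))"
          using False \<open>norm t \<le> \<zeta> x\<close> by (intro mult_nonneg_nonneg) auto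
        then have "norm s * norm t - (norm t)\<^sup>2 / 2 \<le> \<zeta> x * norm s - (\<zeta> x)\<^sup>2 / 2"
          by (simp add: power2_eq_square algebra_simps)
        with cs show ?thesis using False by (simp add: phi_star_def)
      qed
      then show ?thesis using True by (simp add: phi_def)
    qed (simp add: phi_def)
  qed
  define t where "t = (if norm s \<le> \<zeta> x then s else (\<zeta> x / norm s) *\<^sub>R s)"
  have "ereal (phi_star \<zeta> x s) = ereal (s \<bullet> t) - phi \<zeta> x t"
  proof (cases "norm s \<le> \<zeta> x")
    case True
    then show ?thesis by (simp add: t_def phi_def phi_star_def dot_square_norm)
  next
    case False
    then have "norm s \<noteq> 0" using assms by auto
    then have nt: "norm t = \<zeta> x"
      using False assms by (simp add: t_def)
    have "s \<bullet> t = (\<zeta> x / norm s) * (norm s * norm s)"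
      using False by (simp add: t_def dot_square_norm power2_eq_square)
    also have "\<dots> = \<zeta> x * norm s" using \<open>norm s \<noteq> 0\<close> by simp
    finally show ?thesis using False nt by (simp add: phi_def phi_star_def)
  qed
  also have "\<dots> \<le> (SUP t\<in>UNIV. ereal (s \<bullet> t) - phi \<zeta> x t)"
    by (rule SUP_upper) simp
  finally show "ereal (phi_star \<zeta> x s) \<le> (SUP t\<in>UNIV. ereal (s \<bullet> t) - phi \<zeta> x t)" .
qed

definition G_h :: "'a::euclidean_space set \<Rightarrow> ('a \<Rightarrow> real) \<Rightarrow> ('a \<Rightarrow> 'a) \<Rightarrow> ereal" where
  "G_h \<Omega> \<zeta> y = enn2ereal (\<integral>\<^sup>+x\<in>\<Omega>. e2ennreal (phi \<zeta> x (y x)) \<partial>lebesgue)"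

definition F_h :: "'a::euclidean_space set \<Rightarrow> 'a set set \<Rightarrow> 'a set \<Rightarrow> 'a set \<Rightarrow> ('a \<Rightarrow> real) \<Rightarrow>
    ('a \<Rightarrow> real) \<Rightarrow> ('a \<Rightarrow> real) \<Rightarrow> ('a \<Rightarrow> real) \<Rightarrow> ereal" where
  "F_h \<Omega> \<T> \<Gamma>\<^sub>D \<Gamma>\<^sub>N f g u\<^sub>D v =
     (if dirichlet_data \<Omega> \<T> \<Gamma>\<^sub>D u\<^sub>D v
      then ereal (- ip lebesgue \<Omega> f (Pi_h \<T> v) - ip (bd_measure \<Omega> \<T>) \<Gamma>\<^sub>N g (pi_h \<Omega> \<T> v))
      else \<infinity>)"

text \<open>The identification of \<open>(\<L>\<^sup>0)\<^sup>d\<close> with its dual, and the adjoint of the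
  element-wise gradient as a map from \<open>(\<L>\<^sup>0)\<^sup>d\<close> to functionals on the
  Crouzeix-Raviart space.\<close>

definition riesz_h :: "'a::euclidean_space set \<Rightarrow> ('a \<Rightarrow> 'a) \<Rightarrow> ('a \<Rightarrow> 'a) \<Rightarrow> real" where
  "riesz_h \<Omega> y = (\<lambda>w. ip lebesgue \<Omega> y w)"

definition grad_adj :: "'a::euclidean_space set \<Rightarrow> 'a set set \<Rightarrow> ('a \<Rightarrow> 'a) \<Rightarrow> ('a \<Rightarrow> real) \<Rightarrow> real" where
  "grad_adj \<Omega> \<T> y = (\<lambda>v. riesz_h \<Omega> y (grad_h \<T> v))"

definition fenchel_dual :: "'a::euclidean_space set \<Rightarrow> 'a set set \<Rightarrow> 'a set \<Rightarrow> 'a set \<Rightarrow>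
    ('a \<Rightarrow> real) \<Rightarrow> ('a \<Rightarrow> real) \<Rightarrow> ('a \<Rightarrow> real) \<Rightarrow> ('a \<Rightarrow> real) \<Rightarrow> ('a \<Rightarrow> 'a) \<Rightarrow> ereal" where
  "fenchel_dual \<Omega> \<T> \<Gamma>\<^sub>D \<Gamma>\<^sub>N f g \<zeta> u\<^sub>D y =
     - fenchel_conj (broken_P0 \<T>) (G_h \<Omega> \<zeta>) (riesz_h \<Omega> y)
     - fenchel_conj (CR \<Omega> \<T>) (F_h \<Omega> \<T> \<Gamma>\<^sub>D \<Gamma>\<^sub>N f g u\<^sub>D) (\<lambda>v. - grad_adj \<Omega> \<T> y v)"

end

theory Submission
  imports Defs
begin

text \<open>Up to null sets, every function in the problem is determined by finitely many numbers. On an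
  element, a Crouzeix-Raviart function is determined by its values at the centroids of the sides, and
  a Raviart-Thomas field by its value at the centroid of the element and its divergence. All integrals in the two
  problems are finite sums over elements and boundary sides in these numbers, and the two families
  are linked by the discrete integration by parts formula
    \<open>\<Sum>T. \<bar>T\<bar> (y\<^sub>T \<bullet> \<nabla>v\<^sub>T + div y\<^sub>T v\<^sub>T) = \<Sum>S\<subseteq>\<partial>\<Omega>. \<bar>S\<bar> (y \<bullet> n)\<^sub>S v\<^sub>S\<close>
  (\<open>integration_by_parts\<close>). The theorem then has three ingredients.

  The difference between primal and dual energy is a sum over elements of Fenchel-Young gaps of
  \<open>\<phi>\<close> and \<open>\<phi>\<^sup>*\<close>. These are nonnegative, which is weak duality, and each bounds the squared distance
  of \<open>\<nabla>v\<^sub>T\<close> to the gradient of \<open>\<phi>\<^sup>*\<close> at \<open>y\<^sub>T\<close> (\<open>young_gap\<close>); a vanishing gap therefore gives the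
  pointwise optimality relation of part (iii).

  Given element averages \<open>z\<^sub>T\<close>, there is an admissible Raviart-Thomas field with these averages as soon
  as \<open>z\<close> is in equilibrium with the load against all Crouzeix-Raviart functions that vanish on the
  Dirichlet sides (\<open>flux_reconstruction\<close>): divergence and average fix the field on each element, and
  testing with the hat function of a side yields continuity of the flux or its Neumann value. For \<open>z\<close> in
  equilibrium the conjugate of \<open>F\<close> is thus minus the Dirichlet term of the dual energy, and
  otherwise it is \<open>\<infinity>\<close>; this is part (i).

  For part (ii), the dual energy is maximized over the averages in equilibrium, a finite-dimensional
  affine set (\<open>strong_duality_finite\<close>). It is coercive because some Dirichlet lift has gradient
  strictly inside the constraint, and since \<open>\<phi>\<^sup>*\<close> is differentiable, the first order condition says
  that its gradient at the maximizer is a discrete gradient of an admissible primal function. That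
  function has the same energy as the maximizer. The affine set is nonempty because the given
  minimizer \<open>u\<close> makes the load vanish on all admissible directions with zero gradient.

  The geometric input behind the integration by parts is that the gradient \<open>g\<^sub>p\<close> of the barycentric
  coordinate of a vertex satisfies \<open>\<bar>S\<^sub>p\<bar> = d \<bar>T\<bar> \<bar>g\<^sub>p\<bar>\<close>, where \<open>S\<^sub>p\<close> is the opposite side, that means of
  affine functions over elements and sides are values at centroids, and that a side belongs to exactly
  one element if it lies in the boundary and to exactly two otherwise. The first two facts are derived
  from the uniqueness of translation invariant measures. The last one rests on conformity and on the
  Lipschitz boundary, which makes \<open>\<Omega>\<close> the interior of its closure.\<close>

section \<open>Linear images of Lebesgue measure\<close>

text \<open>Both products are values of \<open>\<integral>\<integral> 1\<^sub>A(x) 1\<^sub>B(x +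
  y)\<close>, integrated in the two orders: translating the inner variable separates the two factors,
  once by the invariance of Lebesgue measure and once by that of \<open>M\<close>.\<close>

lemma translation_invariant_proportional:
  fixes M :: "'a::euclidean_space measure"
  assumes sets: "sets M = sets borel" and "sigma_finite_measure M"
    and inv: "\<And>a. distr M borel (\<lambda>x. a + x) = M"
    and A: "A \<in> sets borel" and B: "B \<in> sets borel"
  shows "emeasure M A * emeasure lborel B = emeasure lborel A * emeasure M B"
proof -
  interpret M: sigma_finite_measure M by fact
  interpret P: pair_sigma_finite M "lborel :: 'a measure" ..
  have mM[measurable_cong]: "sets M = sets borel" by fact
  note [measurable] = A B
  have trans_M: "(\<integral>\<^sup>+x. h x \<partial>M) = (\<integral>\<^sup>+x. h (a + x) \<partial>M)"
    if [measurable]: "h \<in> borel_measurable borel" for h :: "'a \<Rightarrow> ennreal" and a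
  proof -
    have "(\<integral>\<^sup>+x. h x \<partial>M) = (\<integral>\<^sup>+x. h x \<partial>(distr M borel (\<lambda>x. a + x)))" by (simp add: inv)
    also have "\<dots> = (\<integral>\<^sup>+x. h (a + x) \<partial>M)" by (rule nn_integral_distr) measurable
    finally show ?thesis .
  qed
  have trans_L: "(\<integral>\<^sup>+x. h x \<partial>lborel) = (\<integral>\<^sup>+x. h (a + x) \<partial>lborel)"
    if [measurable]: "h \<in> borel_measurable borel" for h :: "'a \<Rightarrow> ennreal" and a
  proof -
    have "(\<integral>\<^sup>+x. h x \<partial>lborel) = (\<integral>\<^sup>+x. h x \<partial>(distr lborel borel (\<lambda>x. a + x)))"
      by (simp add: lborel_distr_plus)
    also have "\<dots> = (\<integral>\<^sup>+x. h (a + x) \<partial>lborel)" by (rule nn_integral_distr) measurable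
    finally show ?thesis .
  qed
  have refl_L: "(\<integral>\<^sup>+x. h x \<partial>lborel) = (\<integral>\<^sup>+x. h (a - x) \<partial>lborel)"
    if [measurable]: "h \<in> borel_measurable borel" for h :: "'a \<Rightarrow> ennreal" and a
  proof -
    have "(\<integral>\<^sup>+x. h x \<partial>lborel) =
        (\<integral>\<^sup>+x. h x \<partial>(density (distr lborel borel (\<lambda>x. a + (-1) *\<^sub>R x)) (\<lambda>_. \<bar>-1::real\<bar>^DIM('a))))"
      by (subst lborel_affine[of "-1" a]) simp_all
    also have "\<dots> = (\<integral>\<^sup>+x. h x \<partial>(distr lborel borel (\<lambda>x. a + (-1) *\<^sub>R x)))"
      by (subst nn_integral_density) auto
    also have "\<dots> = (\<integral>\<^sup>+x. h (a + (-1) *\<^sub>R x) \<partial>lborel)" by (rule nn_integral_distr) measurable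
    finally show ?thesis by simp
  qed
  have "emeasure M A * emeasure lborel B = (\<integral>\<^sup>+x. indicator A x * emeasure lborel B \<partial>M)"
    by (subst nn_integral_multc) auto
  also have "\<dots> = (\<integral>\<^sup>+x. (\<integral>\<^sup>+y. indicator A x * indicator B y \<partial>lborel) \<partial>M)"
    by (intro nn_integral_cong) (simp add: nn_integral_cmult)
  also have "\<dots> = (\<integral>\<^sup>+x. (\<integral>\<^sup>+y. indicator A x * indicator B (x + y) \<partial>lborel) \<partial>M)"
    by (intro nn_integral_cong trans_L) measurable
  also have "\<dots> = (\<integral>\<^sup>+y. (\<integral>\<^sup>+x. indicator A x * indicator B (x + y) \<partial>M) \<partial>lborel)"
    by (rule P.Fubini'[symmetric]) measurable
  also have "\<dots> = (\<integral>\<^sup>+y. (\<integral>\<^sup>+x. indicator A (- y + x) * indicator B (- y + x + y) \<partial>M) \<partial>lborel)"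
    by (intro nn_integral_cong trans_M) measurable
  also have "\<dots> = (\<integral>\<^sup>+y. (\<integral>\<^sup>+x. indicator A (x - y) * indicator B x \<partial>M) \<partial>lborel)"
    by simp
  also have "\<dots> = (\<integral>\<^sup>+x. (\<integral>\<^sup>+y. indicator A (x - y) * indicator B x \<partial>lborel) \<partial>M)"
    by (rule P.Fubini') measurable
  also have "\<dots> = (\<integral>\<^sup>+x. emeasure lborel A * indicator B x \<partial>M)"
  proof (intro nn_integral_cong)
    fix x
    have "(\<integral>\<^sup>+y. indicator A (x - y) * indicator B x \<partial>lborel)
        = (\<integral>\<^sup>+y. indicator A (x - y) \<partial>lborel) * indicator B x"
      by (rule nn_integral_multc) measurable
    also have "(\<integral>\<^sup>+y. indicator A (x - y) \<partial>lborel) = (\<integral>\<^sup>+y. indicator A y \<partial>lborel)"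
      by (rule refl_L[symmetric]) measurable
    also have "\<dots> = emeasure lborel A" by simp
    finally show "(\<integral>\<^sup>+y. indicator A (x - y) * indicator B x \<partial>lborel) = emeasure lborel A * indicator B x" .
  qed
  also have "\<dots> = emeasure lborel A * emeasure M B"
    by (subst nn_integral_cmult) auto
  finally show ?thesis .
qed

text \<open>The absolute value of the determinant of \<open>L\<close>. The volume of the image of the
  unit cube makes sense on an abstract Euclidean space, where no matrix of \<open>L\<close> is at
  hand.\<close>

definition jacobian :: "('a::euclidean_space \<Rightarrow> 'a) \<Rightarrow> real" where
  "jacobian L = measure lborel (L ` cbox 0 One)"

lemma linear_inj_inverse:
  fixes L :: "'a::euclidean_space \<Rightarrow> 'a"
  assumes "linear L" "inj L"
  obtains K where "linear K" "\<And>x. K (L x) = x" "\<And>x. L (K x) = x"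
  using linear_injective_isomorphism[OF assms] by metis

text \<open>The image measure is again translation invariant, hence a multiple of Lebesgue
  measure.\<close>

lemma emeasure_linear_inj_image:
  fixes L :: "'a::euclidean_space \<Rightarrow> 'a"
  assumes L: "linear L" "inj L"
  shows "0 < jacobian L"
    and "A \<in> sets borel \<Longrightarrow> L ` A \<in> sets borel"
    and "A \<in> sets borel \<Longrightarrow> emeasure lborel (L ` A) = ennreal (jacobian L) * emeasure lborel A"
proof -
  obtain K where K: "linear K" "\<And>x. K (L x) = x" "\<And>x. L (K x) = x"
    using linear_inj_inverse[OF L] by metis
  have im: "L ` A = K -` A" for A using K by (auto simp: image_iff) metis
  have [measurable]: "K \<in> borel_measurable borel" "L \<in> borel_measurable borel"
    using K(1) L(1) by (auto intro!: borel_measurable_continuous_onI linear_continuous_on simp: linear_conv_bounded_linear)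
  define M where "M = distr lborel borel K"
  have sM: "sets M = sets borel" "space M = UNIV" by (auto simp: M_def)
  have eM: "emeasure M A = emeasure lborel (L ` A)" if "A \<in> sets borel" for A
    using that by (simp add: M_def emeasure_distr im)
  show bor: "L ` A \<in> sets borel" if "A \<in> sets borel" for A
    using measurable_sets[OF \<open>K \<in> borel_measurable borel\<close> that] by (simp add: im)
  have comp: "compact (L ` C)" if "compact C" for C
    using that L(1) by (intro compact_continuous_image linear_continuous_on) (auto simp: linear_conv_bounded_linear)
  have fin: "emeasure lborel (L ` C) < \<infinity>" if "compact C" for C
    using comp[OF that] by (rule emeasure_compact_finite)
  have "sigma_finite_measure M"
  proof
    show "\<exists>A. countable A \<and> A \<subseteq> sets M \<and> \<Union>A = space M \<and> (\<forall>a\<in>A. emeasure M a \<noteq> \<infinity>)"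
    proof (intro exI[of _ "range (\<lambda>n::nat. cball 0 (real n))"] conjI ballI)
      show "\<Union>(range (\<lambda>n::nat. cball (0::'a) (real n))) = space M"
        unfolding sM(2) using real_arch_simple by (metis (no_types, lifting) UNIV_eq_I UN_I UNIV_I mem_cball_0)
      fix a assume "a \<in> range (\<lambda>n::nat. cball (0::'a) (real n))"
      then obtain n :: nat where "a = cball 0 (real n)" by auto
      then show "emeasure M a \<noteq> \<infinity>"
        using fin[OF compact_cball, of 0 "real n"] eM[of a] by auto 
    qed (auto simp: sM)
  qed
  moreover have "distr M borel (\<lambda>x. a + x) = M" for a
  proof -
    have "distr M borel (\<lambda>x. a + x) = distr lborel borel (\<lambda>x. a + K x)"
      unfolding M_def by (subst distr_distr) (auto simp: o_def)
    also have "(\<lambda>x. a + K x) = K \<circ> (\<lambda>x. L a + x)"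
      using K by (auto simp: fun_eq_iff linear_add)
    also have "distr lborel borel \<dots> = distr (distr lborel borel (\<lambda>x. L a + x)) borel K"
      by (subst distr_distr) auto
    also have "\<dots> = M" by (simp add: M_def lborel_distr_plus)
    finally show ?thesis .
  qed
  ultimately have propo: "emeasure M A * emeasure lborel B = emeasure lborel A * emeasure M B"
    if "A \<in> sets borel" "B \<in> sets borel" for A B
    using translation_invariant_proportional[OF sM(1)] that by blast
  have one: "emeasure lborel (cbox 0 One :: 'a set) = 1"
    by (subst emeasure_lborel_cbox) auto
  have jacobian: "emeasure lborel (L ` cbox 0 One) = ennreal (jacobian L)"
    unfolding jacobian_def using fin[of "cbox 0 One"] by (intro emeasure_eq_ennreal_measure) auto
  show main: "emeasure lborel (L ` A) = ennreal (jacobian L) * emeasure lborel A" if "A \<in> sets borel" for A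
    using propo[OF that, of "cbox 0 One"] that by (simp add: eM one jacobian mult.commute)
  show "0 < jacobian L"
  proof (rule ccontr)
    assume "\<not> 0 < jacobian L"
    then have "jacobian L = 0" by (simp add: jacobian_def zero_less_measure_iff measure_nonneg order.antisym)
    then have "emeasure lborel (L ` UNIV) = 0" by (subst main) auto
    moreover have "L ` UNIV = UNIV" using K(3) by (metis surjI)
    ultimately show False by simp
  qed
qed

lemma measure_affine_image:
  fixes L :: "'a::euclidean_space \<Rightarrow> 'a"
  assumes "linear L" "inj L" "A \<in> sets borel"
  shows "measure lborel ((\<lambda>x. a + L x) ` A) = jacobian L * measure lborel A"
proof -
  have B: "L ` A \<in> sets borel" using emeasure_linear_inj_image(2)[OF assms(1,2)] assms(3) .
  have "(\<lambda>x. a + L x) ` A = (\<lambda>x. a + x) ` (L ` A)" by (simp add: image_image)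
  also have "\<dots> = (\<lambda>x. - a + x) -` (L ` A)" by (auto simp: image_iff) (metis add.commute diff_add_cancel uminus_add_conv_diff)
  also have "emeasure lborel \<dots> = emeasure (distr lborel borel (\<lambda>x. - a + x)) (L ` A)"
    using B by (subst emeasure_distr) auto
  also have "\<dots> = ennreal (jacobian L) * emeasure lborel A"
    using emeasure_linear_inj_image(3)[OF assms] by (simp only: lborel_distr_plus)
  finally show ?thesis
    using emeasure_linear_inj_image(1)[OF assms(1,2)] by (simp add: measure_def enn2real_mult)
qed

lemma jacobian_compose:
  assumes "linear L" "inj L" "linear K" "inj K"
  shows "jacobian (L \<circ> K) = jacobian L * jacobian K"
  using measure_affine_image[OF assms(1,2) emeasure_linear_inj_image(2)[OF assms(3,4)], of "cbox 0 One" 0]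
  by (simp add: jacobian_def image_comp)

lemma jacobian_id: "jacobian (\<lambda>x. x) = 1"
  by (simp add: jacobian_def)

text \<open>A symmetry of a body of positive volume scales volumes by the factor 1, since it preserves
  the volume of that body; it can thus be substituted in integrals over the body.\<close>

lemma affine_symmetry_integral:
  fixes L :: "'a::euclidean_space \<Rightarrow> 'a" and h :: "'a \<Rightarrow> real"
  assumes L: "linear L" "inj L" and C: "compact C" "0 < measure lborel C"
    and sym: "(\<lambda>x. a + L x) ` C = C" and h: "h \<in> borel_measurable borel"
  shows "(LINT x:C|lborel. h (a + L x)) = (LINT x:C|lborel. h x)"
proof -
  have Cb[measurable]: "C \<in> sets borel" using C by (simp add: borel_compact)
  have [measurable]: "L \<in> borel_measurable borel"
    using L(1) by (auto intro!: borel_measurable_continuous_onI linear_continuous_on simp: linear_conv_bounded_linear)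
  obtain K where K: "linear K" "\<And>x. K (L x) = x" "\<And>x. L (K x) = x"
    using linear_inj_inverse[OF L] by metis
  have iK: "inj K" using K(3) by (metis injI)
  have jL: "jacobian L = 1" using measure_affine_image[OF L Cb, of a] C(2) by (simp add: sym)
  have "jacobian L * jacobian K = 1"
    using jacobian_compose[OF L K(1) iK] K(3) by (simp add: o_def jacobian_id)
  then have jK: "jacobian K = 1" using jL by simp
  have "distr lborel borel (\<lambda>x. a + L x) = lborel"
  proof (rule measure_eqI)
    fix A assume "A \<in> sets (distr lborel borel (\<lambda>x. a + L x))"
    then have A: "A \<in> sets borel" by simp
    have "emeasure (distr lborel borel (\<lambda>x. a + L x)) A = emeasure lborel (L -` ((\<lambda>x. a + x) -` A))"
      using A by (subst emeasure_distr) (auto simp: vimage_def)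
    also have "L -` ((\<lambda>x. a + x) -` A) = K ` ((\<lambda>x. a + x) -` A)"
    proof (intro set_eqI iffI)
      fix x assume "x \<in> L -` ((\<lambda>x. a + x) -` A)"
      then have "L x \<in> (\<lambda>x. a + x) -` A" by simp
      then show "x \<in> K ` ((\<lambda>x. a + x) -` A)" using K(2)[of x] by (metis image_eqI)
    qed (auto simp: K)
    also have "emeasure lborel \<dots> = emeasure lborel ((\<lambda>x. a + x) -` A)"
    proof -
      have "(\<lambda>x. a + x) -` A \<in> sets borel"
        using measurable_sets[of "\<lambda>x. a + x" borel borel A] A by simp
      from emeasure_linear_inj_image(3)[OF K(1) iK this] show ?thesis by (simp add: jK)
    qed
    also have "\<dots> = emeasure (distr lborel borel (\<lambda>x. a + x)) A"
      using A by (subst emeasure_distr) auto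
    finally show "emeasure (distr lborel borel (\<lambda>x. a + L x)) A = emeasure lborel A"
      by (simp only: lborel_distr_plus)
  qed simp
  then have "(LINT x:C|lborel. h x) = (LINT x:C|distr lborel borel (\<lambda>x. a + L x). h x)" by simp
  also have "\<dots> = (LINT x|lborel. indicator C (a + L x) *\<^sub>R h (a + L x))"
    unfolding set_lebesgue_integral_def using h by (subst integral_distr) auto
  also have "(\<lambda>x. indicator C (a + L x)) = (indicator C :: 'a \<Rightarrow> real)"
  proof
    fix x
    have "inj (\<lambda>x. a + L x)" using L(2) by (auto simp: inj_on_def)
    then have "a + L x \<in> (\<lambda>x. a + L x) ` C \<longleftrightarrow> x \<in> C" by (rule inj_image_mem_iff)
    then show "indicator C (a + L x) = (indicator C x :: real)" by (simp add: sym indicator_def)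
  qed
  finally show ?thesis by (simp add: set_lebesgue_integral_def fun_eq_iff)
qed

text \<open>The shears along \<open>\<alpha>\<close> and \<open>-\<alpha>\<close> are inverse to each
  other, and conjugate under the reflection that maps \<open>k\<close> to \<open>-k\<close>. Therefore
  their scaling factors are both reciprocal and equal.\<close>

lemma jacobian_shear:
  fixes k \<alpha> :: "'a::euclidean_space"
  assumes "norm k = 1" "\<alpha> \<bullet> k = 0"
  shows "jacobian (\<lambda>x. x + (x \<bullet> k) *\<^sub>R \<alpha>) = 1"
proof -
  define s where "s = (\<lambda>\<alpha>::'a. \<lambda>x. x + (x \<bullet> k) *\<^sub>R \<alpha>)"
  define R where "R = (\<lambda>x. x - (2 * (x \<bullet> k)) *\<^sub>R k)"
  have kk: "k \<bullet> k = 1" using assms by (simp add: dot_square_norm)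
  have lin: "linear (s \<beta>)" "linear R" for \<beta>
    unfolding s_def R_def by (auto intro!: linearI simp: algebra_simps)
  have inv: "s \<beta> (s (- \<beta>) x) = x" if "\<beta> \<bullet> k = 0" for \<beta> x
    using that by (simp add: s_def algebra_simps)
  have inv': "s (-\<beta>) (s \<beta> x) = x" if "\<beta> \<bullet> k = 0" for \<beta> x
    using inv[of "-\<beta>" x] that by simp
  have RR: "R (R x) = x" for x using kk by (simp add: R_def algebra_simps)
  have inj_s: "inj (s \<beta>)" if "\<beta> \<bullet> k = 0" for \<beta> using inv'[OF that] by (metis injI)
  have iR: "inj R" using RR by (metis injI)
  have conj: "R \<circ> s \<alpha> \<circ> R = s (- \<alpha>)"
    using assms kk by (auto simp: R_def s_def fun_eq_iff algebra_simps inner_commute)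
  have a: "(-\<alpha>) \<bullet> k = 0" using assms by simp
  have "jacobian (R \<circ> R) = 1" using RR by (simp add: o_def jacobian_id)
  then have jR: "jacobian R * jacobian R = 1" by (simp add: jacobian_compose lin iR)
  have "jacobian (s (-\<alpha>)) = jacobian (s \<alpha>)"
  proof -
    have "jacobian (s (-\<alpha>)) = jacobian (R \<circ> s \<alpha>) * jacobian R"
      unfolding conj[symmetric] by (rule jacobian_compose) (auto intro!: linear_compose inj_compose lin iR inj_s assms)
    also have "\<dots> = jacobian R * jacobian (s \<alpha>) * jacobian R"
      by (subst jacobian_compose) (auto intro!: lin iR inj_s assms)
    finally show ?thesis using jR by (simp add: algebra_simps)
  qed
  moreover have "jacobian (s \<alpha>) * jacobian (s (-\<alpha>)) = 1"
  proof -
    have "s \<alpha> \<circ> s (-\<alpha>) = (\<lambda>x. x)" using inv[OF assms(2)] by auto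
    then show ?thesis
      using jacobian_compose[OF lin(1) inj_s[OF assms(2)] lin(1) inj_s[OF a]] by (simp add: jacobian_id)
  qed
  ultimately have "jacobian (s \<alpha>) * jacobian (s \<alpha>) = 1" by simp
  moreover have "0 < jacobian (s \<alpha>)" by (rule emeasure_linear_inj_image(1)[OF lin(1) inj_s[OF assms(2)]])
  ultimately have "jacobian (s \<alpha>) = 1" by (metis abs_of_pos mult.commute power2_eq_square abs_square_eq_1)
  then show ?thesis by (simp add: s_def)
qed

lemma jacobian_stretch:
  fixes k :: "'a::euclidean_space"
  assumes k: "k \<in> Basis" and h: "h \<noteq> 0"
  shows "jacobian (\<lambda>x. x + ((h - 1) * (x \<bullet> k)) *\<^sub>R k) = \<bar>h\<bar>"
proof -
  define c where "c = (\<lambda>j. if j = k then h else (1::real))"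
  define L where "L = (\<lambda>x. x + ((h - 1) * (x \<bullet> k)) *\<^sub>R k)"
  have Leq: "L x = (\<Sum>j\<in>Basis. (c j * (x \<bullet> j)) *\<^sub>R j)" for x
  proof (rule euclidean_eqI)
    fix b :: 'a assume "b \<in> Basis"
    then show "L x \<bullet> b = (\<Sum>j\<in>Basis. (c j * (x \<bullet> j)) *\<^sub>R j) \<bullet> b"
      using k by (auto simp: L_def c_def inner_add_left inner_Basis algebra_simps)
  qed
  have lin: "linear L" unfolding L_def by (auto intro!: linearI simp: algebra_simps)
  have [measurable]: "L \<in> borel_measurable borel"
    using lin by (auto intro!: borel_measurable_continuous_onI linear_continuous_on simp: linear_conv_bounded_linear)
  have inj: "inj L"
  proof (rule linear_injective_0[THEN iffD2, OF lin], intro allI impI)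
    fix x assume "L x = 0"
    then have "c b * (x \<bullet> b) = 0" if "b \<in> Basis" for b
      using inner_sum_left_Basis[OF that, of "\<lambda>j. c j * (x \<bullet> j)"] by (simp flip: Leq)
    moreover have "c b \<noteq> 0" for b using h by (simp add: c_def)
    ultimately show "x = 0" by (metis euclidean_all_zero_iff mult_eq_0_iff)
  qed
  have pc: "(\<Prod>j\<in>Basis. \<bar>c j\<bar>) = \<bar>h\<bar>"
  proof -
    have "(\<Prod>j\<in>Basis. \<bar>c j\<bar>) = \<bar>c k\<bar> * (\<Prod>j\<in>Basis - {k}. \<bar>c j\<bar>)"
      using k by (simp add: prod.remove)
    then show ?thesis by (simp add: c_def)
  qed
  have "(lborel::'a measure) = density (distr lborel borel L) (\<lambda>_. ennreal \<bar>h\<bar>)"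
    using lborel_affine_euclidean[of c 0] h pc by (simp add: Leq[abs_def] c_def)
  then have "emeasure lborel (L ` cbox 0 One) = emeasure (density (distr lborel borel L) (\<lambda>_. ennreal \<bar>h\<bar>)) (L ` cbox 0 One)"
    by simp
  also have "\<dots> = ennreal \<bar>h\<bar> * emeasure lborel (L -` (L ` cbox 0 One))"
    using emeasure_linear_inj_image(2)[OF lin inj, of "cbox 0 One"]
    by (subst emeasure_density) (auto simp: nn_integral_cmult emeasure_distr)
  also have "L -` (L ` cbox 0 One) = cbox 0 One" using inj by (rule inj_vimage_image_eq)
  finally have "emeasure lborel (L ` cbox 0 One) = ennreal \<bar>h\<bar>" by simp
  then have "jacobian L = \<bar>h\<bar>" by (simp add: jacobian_def measure_def)
  then show ?thesis by (simp add: L_def)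
qed

section \<open>Barycentric coordinates of a simplex\<close>

text \<open>The vertices \<open>C\<close> of a nondegenerate simplex and the gradients \<open>g p\<close> of the barycentric coordinates,
  characterized by their values on edges.\<close>

locale frame =
  fixes C :: "'a::euclidean_space set" and g :: "'a \<Rightarrow> 'a"
  assumes indep: "\<not> affine_dependent C" and card: "card C = Suc DIM('a)"
    and dual: "\<And>p q r. p \<in> C \<Longrightarrow> q \<in> C \<Longrightarrow> r \<in> C \<Longrightarrow>
      g p \<bullet> (q - r) = of_bool (q = p) - of_bool (r = p)"
begin

abbreviation "T \<equiv> convex hull C"
abbreviation "F p \<equiv> convex hull (C - {p})"

definition barycentre :: 'a where "barycentre = (1 / real (Suc DIM('a))) *\<^sub>R (\<Sum>p\<in>C. p)"
definition face_barycentre :: "'a \<Rightarrow> 'a" where "face_barycentre p = (1 / real DIM('a)) *\<^sub>R (\<Sum>q\<in>C - {p}. q)"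

text \<open>The barycentric coordinate of the vertex \<open>p\<close>; it equals \<open>1 / (d +
  1)\<close> at the barycentre.\<close>

definition bary :: "'a \<Rightarrow> 'a \<Rightarrow> real" where
  "bary p x = g p \<bullet> (x - barycentre) + 1 / real (Suc DIM('a))"

lemma fin: "finite C" using card card.infinite by fastforce

lemma card_diff: "p \<in> C \<Longrightarrow> card (C - {p}) = DIM('a)"
  using fin card by (simp add: card_Diff_singleton)

lemma obtain_other:
  assumes "p \<in> C" obtains q where "q \<in> C" "q \<noteq> p"
proof -
  have "card (C - {p}) \<noteq> 0" using card_diff[OF assms] by simp
  then have "C - {p} \<noteq> {}" by (metis card.empty)
  then show ?thesis using that by blast
qed

lemma C_nonempty: "C \<noteq> {}" using card by auto

text \<open>The edges of a nondegenerate simplex span the space.\<close>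

lemma linear_determined:
  fixes f h :: "'a \<Rightarrow> 'b::real_vector"
  assumes "linear f" "linear h" "\<And>p q. p \<in> C \<Longrightarrow> q \<in> C \<Longrightarrow> f (p - q) = h (p - q)"
  shows "f w = h w"
proof -
  obtain q where q: "q \<in> C" using C_nonempty by auto
  define E where "E = (\<lambda>p. p - q) ` (C - {q})"
  have cE: "card E = DIM('a)" unfolding E_def using card_diff[OF q]
    by (subst card_image) (auto simp: inj_on_def)
  have "independent E"
  proof -
    have "C = insert q (C - {q})" using q by auto
    then have "\<not> affine_dependent (insert q (C - {q}))" using indep by simp
    then have "\<not> dependent ((\<lambda>x. - q + x) ` (C - {q}))"
      by (metis affine_dependent_iff_dependent Diff_iff singletonI)
    then show ?thesis by (simp add: E_def)
  qed
  then have "UNIV \<subseteq> span E"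
    using card_ge_dim_independent[of E UNIV] cE by simp
  then have "w \<in> span E" by auto
  then show ?thesis
    using assms q by (intro linear_eq_on_span[of f h E w]) (auto simp: E_def)
qed

lemma orthogonal_to_edges_zero:
  assumes "\<And>p q. p \<in> C \<Longrightarrow> q \<in> C \<Longrightarrow> w \<bullet> (p - q) = 0"
  shows "w = 0"
proof -
  have "w \<bullet> w = (\<lambda>_. 0) w"
    by (rule linear_determined) (use assms in \<open>auto intro!: linearI simp: inner_add_right\<close>)
  then show ?thesis by simp
qed

lemma sum_grad: "(\<Sum>p\<in>C. g p) = 0"
proof (rule orthogonal_to_edges_zero)
  fix q r assume "q \<in> C" "r \<in> C"
  then show "(\<Sum>p\<in>C. g p) \<bullet> (q - r) = 0"
    using fin by (simp add: inner_sum_left dual sum_subtractf)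
qed

lemma grad_expand: "(\<Sum>p\<in>C. (g p \<bullet> w) *\<^sub>R p) = w"
proof (rule linear_determined)
  fix q r assume qr: "q \<in> C" "r \<in> C"
  then have "(\<Sum>p\<in>C. (g p \<bullet> (q - r)) *\<^sub>R p) = (\<Sum>p\<in>C. of_bool (q = p) *\<^sub>R p - of_bool (r = p) *\<^sub>R p)"
    by (intro sum.cong) (simp_all add: dual scaleR_diff_left)
  also have "\<dots> = q - r"
    using qr fin by (simp add: sum_subtractf of_bool_def if_distrib[of "\<lambda>t. t *\<^sub>R _"] cong: if_cong)
  finally show "(\<Sum>p\<in>C. (g p \<bullet> (q - r)) *\<^sub>R p) = q - r" .
qed (auto intro!: linearI simp: inner_add_right scaleR_add_left sum.distrib scaleR_sum_right)

lemma sum_bary: "(\<Sum>p\<in>C. bary p x) = 1"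
proof -
  have "(\<Sum>p\<in>C. bary p x) = (\<Sum>p\<in>C. g p) \<bullet> (x - barycentre) + 1"
    by (simp add: bary_def sum.distrib inner_sum_left card)
  then show ?thesis by (simp add: sum_grad)
qed

lemma bary_expand: "(\<Sum>p\<in>C. bary p x *\<^sub>R p) = x"
proof -
  have "(\<Sum>p\<in>C. bary p x *\<^sub>R p) = (\<Sum>p\<in>C. (g p \<bullet> (x - barycentre)) *\<^sub>R p) + barycentre"
    by (simp add: bary_def scaleR_add_left sum.distrib barycentre_def scaleR_sum_right)
  then show ?thesis by (simp add: grad_expand)
qed

lemma bary_diff: "bary p x - bary p y = g p \<bullet> (x - y)"
  by (simp add: bary_def inner_diff_right)

lemma bary_vertex:
  assumes "p \<in> C" "q \<in> C" shows "bary p q = of_bool (q = p)"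
proof -
  have "g p \<bullet> (q - barycentre) = (\<Sum>r\<in>C. g p \<bullet> (q - r)) / real (Suc DIM('a))"
  proof -
    have "q - barycentre = (1 / real (Suc DIM('a))) *\<^sub>R (\<Sum>r\<in>C. q - r)"
      by (simp add: barycentre_def sum_subtractf card scaleR_diff_right sum_constant_scaleR del: of_nat_Suc)
    then show ?thesis by (simp add: inner_sum_right)
  qed
  also have "(\<Sum>r\<in>C. g p \<bullet> (q - r)) = real (Suc DIM('a)) * of_bool (q = p) - 1"
    using assms fin by (simp add: dual sum_subtractf card)
  finally show ?thesis by (simp add: bary_def diff_divide_distrib)
qed

lemma bary_affine_comb:
  assumes "finite I" "sum u I = 1"
  shows "bary p (\<Sum>i\<in>I. u i *\<^sub>R x i) = (\<Sum>i\<in>I. u i * bary p (x i))"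
proof -
  have "(\<Sum>i\<in>I. u i * bary p (x i)) = g p \<bullet> (\<Sum>i\<in>I. u i *\<^sub>R x i) - sum u I * (g p \<bullet> barycentre)
      + sum u I * (1 / real (Suc DIM('a)))"
    by (simp only: bary_def inner_sum_right sum_distrib_right sum.distrib[symmetric] sum_subtractf[symmetric])
       (simp add: algebra_simps)
  then show ?thesis using assms by (simp add: bary_def inner_diff_right)
qed

text \<open>Barycentric coordinates are affine and take the values 0 and 1 at the vertices.\<close>

lemma bary_unique:
  assumes "sum u C = 1" "(\<Sum>q\<in>C. u q *\<^sub>R q) = x" "p \<in> C"
  shows "bary p x = u p"
proof -
  have "bary p x = (\<Sum>q\<in>C. u q * bary p q)"
    using bary_affine_comb[OF fin assms(1), of p "\<lambda>q. q"] assms(2) by simp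
  also have "\<dots> = (\<Sum>q\<in>C. u q * of_bool (q = p))" using assms by (intro sum.cong) (auto simp: bary_vertex)
  also have "\<dots> = u p" using assms fin by simp
  finally show ?thesis .
qed

lemma T_iff: "x \<in> T \<longleftrightarrow> (\<forall>p\<in>C. 0 \<le> bary p x)"
proof
  assume "x \<in> T"
  then obtain u where "\<forall>p\<in>C. 0 \<le> u p" "sum u C = 1" "(\<Sum>q\<in>C. u q *\<^sub>R q) = x"
    using fin by (auto simp: convex_hull_finite)
  then show "\<forall>p\<in>C. 0 \<le> bary p x" using bary_unique by metis
next
  assume "\<forall>p\<in>C. 0 \<le> bary p x"
  then show "x \<in> T" using fin sum_bary[of x] bary_expand[of x] by (auto simp: convex_hull_finite)
qed

lemma interior_iff: "x \<in> interior T \<longleftrightarrow> (\<forall>p\<in>C. 0 < bary p x)"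
proof -
  have "interior T = {y. \<exists>u. (\<forall>x\<in>C. 0 < u x) \<and> sum u C = 1 \<and> (\<Sum>x\<in>C. u x *\<^sub>R x) = y}"
    using interior_convex_hull_explicit_minimal[OF indep] card by simp
  moreover have "(\<exists>u. (\<forall>x\<in>C. 0 < u x) \<and> sum u C = 1 \<and> (\<Sum>x\<in>C. u x *\<^sub>R x) = x) \<longleftrightarrow> (\<forall>p\<in>C. 0 < bary p x)"
  proof
    assume "\<exists>u. (\<forall>x\<in>C. 0 < u x) \<and> sum u C = 1 \<and> (\<Sum>x\<in>C. u x *\<^sub>R x) = x"
    then obtain u where "\<forall>x\<in>C. 0 < u x" "sum u C = 1" "(\<Sum>x\<in>C. u x *\<^sub>R x) = x" by blast
    then show "\<forall>p\<in>C. 0 < bary p x" using bary_unique by metis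
  qed (use sum_bary[of x] bary_expand[of x] in \<open>auto intro!: exI[of _ "\<lambda>p. bary p x"]\<close>)
  ultimately show ?thesis by auto
qed

lemma sum_remove:
  fixes f :: "'a \<Rightarrow> 'b::comm_monoid_add"
  shows "p \<in> C \<Longrightarrow> sum f C = f p + sum f (C - {p})"
  using fin by (simp add: sum.remove)

lemma F_iff:
  assumes p: "p \<in> C" shows "x \<in> F p \<longleftrightarrow> bary p x = 0 \<and> (\<forall>q\<in>C. 0 \<le> bary q x)"
proof
  assume "x \<in> F p"
  then obtain u where u: "\<forall>q\<in>C - {p}. 0 \<le> u q" "sum u (C - {p}) = 1" "(\<Sum>q\<in>C - {p}. u q *\<^sub>R q) = x"
    using fin by (auto simp: convex_hull_finite)
  define w where "w = u(p := 0)"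
  have "sum w C = 1" "(\<Sum>q\<in>C. w q *\<^sub>R q) = x"
    using u(2,3) by (auto simp: sum_remove[OF p] w_def)
  then have "bary q x = w q" if "q \<in> C" for q using bary_unique that by blast
  then show "bary p x = 0 \<and> (\<forall>q\<in>C. 0 \<le> bary q x)" using p u(1) by (auto simp: w_def)
next
  assume h: "bary p x = 0 \<and> (\<forall>q\<in>C. 0 \<le> bary q x)"
  have "sum (\<lambda>q. bary q x) (C - {p}) = 1" "(\<Sum>q\<in>C - {p}. bary q x *\<^sub>R q) = x"
    using sum_bary[of x] bary_expand[of x] h by (simp_all add: sum_remove[OF p])
  then show "x \<in> F p" using h fin by (auto simp: convex_hull_finite)
qed

lemma rel_interior_F_iff:
  assumes p: "p \<in> C"
  shows "x \<in> rel_interior (F p) \<longleftrightarrow> bary p x = 0 \<and> (\<forall>q\<in>C - {p}. 0 < bary q x)"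
proof -
  have ind: "\<not> affine_dependent (C - {p})" using indep affine_independent_subset by blast
  show ?thesis unfolding rel_interior_convex_hull_explicit[OF ind] mem_Collect_eq
  proof
    assume "\<exists>u. (\<forall>x\<in>C - {p}. 0 < u x) \<and> sum u (C - {p}) = 1 \<and> (\<Sum>q\<in>C - {p}. u q *\<^sub>R q) = x"
    then obtain u where u: "\<forall>q\<in>C - {p}. 0 < u q" "sum u (C - {p}) = 1" "(\<Sum>q\<in>C - {p}. u q *\<^sub>R q) = x"
      by auto
    define w where "w = u(p := 0)"
    have "sum w C = 1" "(\<Sum>q\<in>C. w q *\<^sub>R q) = x"
      using u(2,3) by (auto simp: sum_remove[OF p] w_def)
    then have "bary q x = w q" if "q \<in> C" for q using bary_unique that by blast
    then show "bary p x = 0 \<and> (\<forall>q\<in>C - {p}. 0 < bary q x)" using p u(1) by (auto simp: w_def)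
  next
    assume h: "bary p x = 0 \<and> (\<forall>q\<in>C - {p}. 0 < bary q x)"
    have "sum (\<lambda>q. bary q x) (C - {p}) = 1" "(\<Sum>q\<in>C - {p}. bary q x *\<^sub>R q) = x"
      using sum_bary[of x] bary_expand[of x] h by (simp_all add: sum_remove[OF p])
    then show "\<exists>u. (\<forall>x\<in>C - {p}. 0 < u x) \<and> sum u (C - {p}) = 1 \<and> (\<Sum>q\<in>C - {p}. u q *\<^sub>R q) = x"
      using h by (intro exI[of _ "\<lambda>q. bary q x"]) auto
  qed
qed

lemma barycentre_interior: "barycentre \<in> interior T"
  by (simp add: interior_iff bary_def)

lemma vertex_notin_F: "p \<in> C \<Longrightarrow> p \<notin> F p"
  by (simp add: F_iff bary_vertex)

lemma vertex_in_F: "p \<in> C \<Longrightarrow> q \<noteq> p \<Longrightarrow> p \<in> F q"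
  by (simp add: hull_inc)

lemma F_inj: "p \<in> C \<Longrightarrow> q \<in> C \<Longrightarrow> F p = F q \<longleftrightarrow> p = q"
  using vertex_notin_F vertex_in_F by metis

lemma facet_iff: "S facet_of T \<longleftrightarrow> (\<exists>p\<in>C. S = F p)"
  using card DIM_positive[where 'a='a]
  by (subst facet_of_convex_hull_affine_independent_alt[OF indep]) (auto simp: Suc_le_eq)

lemma F_subset_T: "F p \<subseteq> T" by (rule hull_mono) auto

text \<open>The barycentre divides the median from \<open>p\<close> in the ratio \<open>d :
  1\<close>.\<close>

lemma face_barycentre_eq:
  assumes "p \<in> C"
  shows "face_barycentre p = barycentre - (1 / real DIM('a)) *\<^sub>R (p - barycentre)"
proof -
  have "(\<Sum>q\<in>C - {p}. q) = real (Suc DIM('a)) *\<^sub>R barycentre - p"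
    using sum_remove[OF assms, of "\<lambda>q. q"] by (simp add: barycentre_def del: of_nat_Suc)
  then show ?thesis
    by (simp add: face_barycentre_def scaleR_diff_right scaleR_add_left add_divide_distrib)
       (simp add: algebra_simps)
qed

lemma bary_face_barycentre:
  assumes "p \<in> C" "q \<in> C"
  shows "bary q (face_barycentre p) = (if q = p then 0 else 1 / real DIM('a))"
proof -
  have "bary q (face_barycentre p) = (\<Sum>r\<in>C - {p}. (1 / real DIM('a)) * bary q r)"
    unfolding face_barycentre_def scaleR_sum_right
    by (rule bary_affine_comb) (use fin card_diff[OF assms(1)] in auto)
  also have "\<dots> = (\<Sum>r\<in>C - {p}. (1 / real DIM('a)) * of_bool (r = q))"
    using assms by (intro sum.cong) (auto simp: bary_vertex)
  also have "\<dots> = (1 / real DIM('a)) * (\<Sum>r\<in>C - {p}. of_bool (r = q))"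
    by (simp only: sum_distrib_left)
  also have "\<dots> = (if q = p then 0 else 1 / real DIM('a))"
    using assms fin by auto
  finally show ?thesis .
qed

lemma face_barycentre_rel_interior: "p \<in> C \<Longrightarrow> face_barycentre p \<in> rel_interior (F p)"
  by (simp add: rel_interior_F_iff bary_face_barycentre)

lemma rel_interior_F_subset: "rel_interior (F p) \<subseteq> F p" by (rule rel_interior_subset)

lemma grad_nonzero: "p \<in> C \<Longrightarrow> g p \<noteq> 0"
proof -
  assume p: "p \<in> C"
  then obtain q where q: "q \<in> C" "q \<noteq> p" using obtain_other by blast
  have "g p \<bullet> (p - q) = 1" using dual[OF p p q(1)] q(2) by simp
  then show "g p \<noteq> 0" by auto
qed

text \<open>Both vectors are orthogonal to the side opposite to \<open>p\<close> and agree on one edge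
  that leaves it.\<close>

lemma normal_parallel:
  assumes p: "p \<in> C" and n: "\<And>x y. x \<in> F p \<Longrightarrow> y \<in> F p \<Longrightarrow> n \<bullet> (x - y) = 0"
    and q: "q \<in> C" "q \<noteq> p"
  shows "n = (n \<bullet> (p - q)) *\<^sub>R g p"
proof -
  have *: "n \<bullet> (p - r) = n \<bullet> (p - q)" if "r \<in> C" "r \<noteq> p" for r
    using n[of r q] vertex_in_F that q by (simp add: inner_diff_right)
  have "n - (n \<bullet> (p - q)) *\<^sub>R g p = 0"
  proof (rule orthogonal_to_edges_zero)
    fix r s assume rs: "r \<in> C" "s \<in> C"
    consider "r = p" "s = p" | "r = p" "s \<noteq> p" | "r \<noteq> p" "s = p" | "r \<noteq> p" "s \<noteq> p" by auto
    then show "(n - (n \<bullet> (p - q)) *\<^sub>R g p) \<bullet> (r - s) = 0"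
    proof cases
      case 2 then show ?thesis using rs p *[of s] by (simp add: inner_diff_left dual)
    next
      case 3
      have "n \<bullet> (r - p) = - (n \<bullet> (p - r))" by (simp add: inner_diff_right)
      then show ?thesis using 3 rs p *[of r] by (simp add: inner_diff_left dual)
    next
      case 4 then show ?thesis using rs p n[of r s] vertex_in_F by (simp add: inner_diff_left dual)
    qed simp
  qed
  then show ?thesis by simp
qed

lemma grad_orthogonal_F:
  assumes "p \<in> C" "x \<in> F p" "y \<in> F p" shows "g p \<bullet> (x - y) = 0"
  using assms bary_diff[of p x y] by (simp add: F_iff)

lemma unit_normal_cases:
  assumes p: "p \<in> C" and n: "norm n = 1" "\<And>x y. x \<in> F p \<Longrightarrow> y \<in> F p \<Longrightarrow> n \<bullet> (x - y) = 0"
  shows "n = g p /\<^sub>R norm (g p) \<or> n = - (g p /\<^sub>R norm (g p))"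
proof -
  obtain q where q: "q \<in> C" "q \<noteq> p" using obtain_other[OF p] .
  define t where "t = n \<bullet> (p - q)"
  have nt: "n = t *\<^sub>R g p" unfolding t_def by (rule normal_parallel[OF p n(2) q])
  then have "\<bar>t\<bar> * norm (g p) = 1" using n(1) by simp
  then have "\<bar>t\<bar> = inverse (norm (g p))" using grad_nonzero[OF p] by (simp add: field_simps)
  then have "t = inverse (norm (g p)) \<or> t = - inverse (norm (g p))" by linarith
  then show ?thesis using nt by auto
qed

text \<open>The coordinate of \<open>p\<close> vanishes on the side and grows towards
  \<open>p\<close>.\<close>

lemma outer_normal_F:
  assumes p: "p \<in> C" shows "outer_normal T (F p) = - (g p /\<^sub>R norm (g p))"
  unfolding outer_normal_def
proof (rule the_equality, intro conjI ballI)
  show "norm (- (g p /\<^sub>R norm (g p))) = 1" using grad_nonzero[OF p] by simp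
  fix x y assume "x \<in> F p" "y \<in> T"
  then have "bary p x = 0" "0 \<le> bary p y" using p by (auto simp: F_iff T_iff)
  then have "g p \<bullet> x \<le> g p \<bullet> y" using bary_diff[of p x y] by (simp add: inner_diff_right)
  then show "- (g p /\<^sub>R norm (g p)) \<bullet> y \<le> - (g p /\<^sub>R norm (g p)) \<bullet> x"
    by (simp add: mult_left_mono)
next
  fix n assume n: "norm n = 1 \<and> (\<forall>x\<in>F p. \<forall>y\<in>T. n \<bullet> y \<le> n \<bullet> x)"
  obtain q where q: "q \<in> C" "q \<noteq> p" using obtain_other[OF p] .
  have "n \<bullet> (x - y) = 0" if "x \<in> F p" "y \<in> F p" for x y
  proof -
    have "x \<in> T" "y \<in> T" using that F_subset_T by auto
    then have "n \<bullet> x \<le> n \<bullet> y" "n \<bullet> y \<le> n \<bullet> x" using n that by blast+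
    then show ?thesis by (simp add: inner_diff_right)
  qed
  then have "n = g p /\<^sub>R norm (g p) \<or> n = - (g p /\<^sub>R norm (g p))"
    using unit_normal_cases[OF p] n by blast
  moreover have "n \<noteq> g p /\<^sub>R norm (g p)"
  proof
    assume "n = g p /\<^sub>R norm (g p)"
    moreover have "n \<bullet> p \<le> n \<bullet> q" using n q p vertex_in_F by (auto simp: hull_inc)
    ultimately have "inverse (norm (g p)) * (g p \<bullet> (p - q)) \<le> 0" by (simp add: inner_diff_right algebra_simps)
    then show False using dual[of p p q] p q grad_nonzero[OF p] by simp
  qed
  ultimately show "n = - (g p /\<^sub>R norm (g p))" by blast
qed

end

text \<open>For each vertex take the component of an edge at \<open>p\<close> that is orthogonal to the
  affine hull of the other vertices, scaled to slope 1 along that edge.\<close>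

lemma frame_exists:
  fixes C :: "'a::euclidean_space set"
  assumes "\<not> affine_dependent C" "card C = Suc DIM('a)"
  shows "\<exists>g. frame C g"
proof -
  have fin: "finite C" using assms(1) by (rule aff_independent_finite)
  have "\<exists>w. \<forall>q\<in>C. \<forall>r\<in>C. w \<bullet> (q - r) = of_bool (q = p) - of_bool (r = p)" if p: "p \<in> C" for p
  proof -
    have "card (C - {p}) \<noteq> 0" using assms(2) fin p by (simp add: card_Diff_singleton)
    then have "C - {p} \<noteq> {}" by (metis card.empty)
    then obtain q where q: "q \<in> C" "q \<noteq> p" by blast
    define S where "S = (\<lambda>x. x - q) ` (C - {p, q})"
    have "p \<notin> affine hull (C - {p})" using assms(1) p by (auto simp: affine_dependent_def)
    moreover have "affine hull (C - {p}) = (\<lambda>x. q + x) ` span ((\<lambda>x. x - q) ` (C - {p} - {q}))"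
      using affine_hull_span2[of q "C - {p}"] q by simp
    moreover have "C - {p} - {q} = C - {p, q}" by auto
    ultimately have "p \<notin> (\<lambda>x. q + x) ` span S" unfolding S_def by simp
    then have "p - q \<notin> span S" by (metis add.commute diff_add_cancel image_eqI)
    moreover obtain y z where yz: "y \<in> span S" "\<And>w. w \<in> span S \<Longrightarrow> orthogonal z w" "p - q = y + z"
      using orthogonal_subspace_decomp_exists by blast
    ultimately have z0: "z \<noteq> 0" by auto
    define w where "w = z /\<^sub>R (norm z)\<^sup>2"
    have "w \<bullet> (r - q) = 0" if "r \<in> C" "r \<noteq> p" for r
    proof (cases "r = q")
      case False
      then have "r - q \<in> span S" using that by (auto simp: S_def intro!: span_base)
      then show ?thesis using yz(2) by (simp add: w_def orthogonal_def)
    qed simp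
    moreover have "w \<bullet> (p - q) = 1"
      using yz z0 by (simp add: w_def orthogonal_def inner_add_right power2_norm_eq_inner)
    ultimately have wq: "w \<bullet> (r - q) = of_bool (r = p)" if "r \<in> C" for r using that by auto
    have "w \<bullet> (r - s) = of_bool (r = p) - of_bool (s = p)" if "r \<in> C" "s \<in> C" for r s
    proof -
      have "w \<bullet> (r - s) = w \<bullet> (r - q) - w \<bullet> (s - q)" by (simp add: inner_diff_right)
      then show ?thesis by (simp only: wq[OF that(1)] wq[OF that(2)])
    qed
    then show ?thesis by blast
  qed
  then have "\<forall>p\<in>C. \<exists>w. \<forall>q\<in>C. \<forall>r\<in>C. w \<bullet> (q - r) = of_bool (q = p) - of_bool (r = p)" by blast
  then have "\<exists>g. \<forall>p\<in>C. \<forall>q\<in>C. \<forall>r\<in>C. g p \<bullet> (q - r) = of_bool (q = p) - of_bool (r = p)"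
    by (rule bchoice)
  then obtain g where "\<forall>p\<in>C. \<forall>q\<in>C. \<forall>r\<in>C. g p \<bullet> (q - r) = of_bool (q = p) - of_bool (r = p)" ..
  then have "frame C g" using assms by unfold_locales blast+
  show ?thesis by (rule exI[of _ g]) fact
qed

section \<open>Volumes and means on simplices and their sides\<close>

text \<open>The set is the product of the standard simplex in the coordinates other than
  \<open>k\<close> and of a unit interval; the coordinate \<open>k\<close> is integrated out.\<close>

lemma measure_std_prism:
  fixes k :: "'a::euclidean_space"
  assumes k: "k \<in> Basis"
  shows "measure lborel {x::'a. (\<forall>i\<in>Basis. 0 \<le> x \<bullet> i) \<and> (\<Sum>i\<in>Basis - {k}. x \<bullet> i) \<le> 1 \<and> x \<bullet> k \<le> 1}
    = 1 / fact (DIM('a) - 1)"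
proof -
  interpret product_sigma_finite "\<lambda>_::'a. lborel :: real measure" by standard
  define A where "A = Basis - {k}"
  have A: "finite A" "k \<notin> A" "Basis = insert k A" "card A = DIM('a) - 1"
    using k by (auto simp: A_def)
  let ?M = "\<lambda>B. Pi\<^sub>M B (\<lambda>_::'a. lborel :: real measure)"
  let ?S = "{y::'a \<Rightarrow> real. (\<forall>i\<in>A. 0 \<le> y i) \<and> sum y A \<le> 1} \<inter> space (?M A)"
  let ?P = "{y::'a \<Rightarrow> real. (\<forall>i\<in>Basis. 0 \<le> y i) \<and> sum y A \<le> 1 \<and> y k \<le> 1} \<inter> space (?M Basis)"
  have mS[measurable]: "?S \<in> sets (?M A)"
  proof -
    have "?S = Pi\<^sub>E A (\<lambda>_. {0..}) \<inter> (\<lambda>x. sum x A) -` {..1} \<inter> space (?M A)"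
      by (auto simp: space_PiM)
    also have "\<dots> \<in> sets (?M A)" using A(1) by measurable
    finally show ?thesis .
  qed
  have mP[measurable]: "?P \<in> sets (?M Basis)"
  proof -
    have [measurable]: "(\<lambda>x. x i) \<in> borel_measurable (?M Basis)" if "i \<in> Basis" for i
      using measurable_component_singleton[OF that, of "\<lambda>_. lborel"] by simp
    have "?P = Pi\<^sub>E Basis (\<lambda>_. {0..}) \<inter> (\<lambda>x. sum x A) -` {..1} \<inter> (\<lambda>x. x k) -` {..1} \<inter> space (?M Basis)"
      by (auto simp: space_PiM)
    also have "\<dots> = Pi\<^sub>E Basis (\<lambda>_. {0..}) \<inter> ((\<lambda>x. sum x A) -` {..1} \<inter> space (?M Basis)) \<inter>
        ((\<lambda>x. x k) -` {..1} \<inter> space (?M Basis))" by auto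
    also have "\<dots> \<in> sets (?M Basis)"
    proof (rule sets.Int[OF sets.Int])
      show "Pi\<^sub>E Basis (\<lambda>_. {0..}) \<in> sets (?M Basis)" by (intro sets_PiM_I_finite) auto
      show "(\<lambda>x. x k) -` {..1} \<inter> space (?M Basis) \<in> sets (?M Basis)"
        using k by (intro measurable_sets[where A=borel]) auto
      show "(\<lambda>x. sum x A) -` {..1} \<inter> space (?M Basis) \<in> sets (?M Basis)"
        by (intro measurable_sets[where A=borel] borel_measurable_sum) (auto simp: A_def)
    qed
    finally show ?thesis .
  qed
  have "emeasure lborel {x::'a. (\<forall>i\<in>Basis. 0 \<le> x \<bullet> i) \<and> (\<Sum>i\<in>A. x \<bullet> i) \<le> 1 \<and> x \<bullet> k \<le> 1} =
      emeasure (distr (?M Basis) borel (\<lambda>f. \<Sum>b\<in>Basis. f b *\<^sub>R b))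
        {x::'a. (\<forall>i\<in>Basis. 0 \<le> x \<bullet> i) \<and> (\<Sum>i\<in>A. x \<bullet> i) \<le> 1 \<and> x \<bullet> k \<le> 1}"
    by (subst lborel_eq) simp
  also have "\<dots> = emeasure (?M Basis) ?P"
    by (subst emeasure_distr) (use k in \<open>auto simp: A_def intro!: arg_cong2[where f=emeasure]\<close>)
  also have "\<dots> = (\<integral>\<^sup>+ y. indicator ?P y \<partial>?M (insert k A))"
    unfolding A(3)[symmetric] by (rule nn_integral_indicator[symmetric]) (rule mP)
  also have "\<dots> = (\<integral>\<^sup>+ y. \<integral>\<^sup>+ x. indicator ?P (x(k := y)) \<partial>?M A \<partial>lborel)"
    using A mP by (intro product_nn_integral_insert_rev) auto
  also have "\<dots> = (\<integral>\<^sup>+ y. \<integral>\<^sup>+ x. indicator {0..1::real} y * indicator ?S x \<partial>?M A \<partial>lborel)"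
  proof (intro nn_integral_cong)
    fix y :: real and x assume x: "x \<in> space (?M A)"
    have "sum (x(k := y)) A = sum x A" using A(2) by (intro sum.cong) auto
    moreover have "(\<forall>i\<in>Basis. 0 \<le> (x(k := y)) i) \<longleftrightarrow> 0 \<le> y \<and> (\<forall>i\<in>A. 0 \<le> x i)"
      unfolding A(3) using A(2) by auto
    moreover have "x(k := y) \<in> space (?M Basis)"
      using x unfolding A(3) by (auto simp: space_PiM PiE_def extensional_def)
    ultimately show "indicator ?P (x(k := y)) = (indicator {0..1} y * indicator ?S x :: ennreal)"
      using x by (auto simp: indicator_def)
  qed
  also have "\<dots> = (\<integral>\<^sup>+ y. indicator {0..1::real} y * emeasure (?M A) ?S \<partial>lborel)"
    by (intro nn_integral_cong) (simp add: nn_integral_cmult mS)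
  also have "emeasure (?M A) ?S = ennreal (1 / fact (card A))"
    using emeasure_std_simplex_aux[OF A(1), of 1] by (simp add: divide_ennreal[symmetric] ennreal_fact)
  also have "(\<integral>\<^sup>+ y. indicator {0..1::real} y * ennreal (1 / fact (card A)) \<partial>lborel) = ennreal (1 / fact (card A))"
    by (subst nn_integral_multc) auto
  finally show ?thesis by (simp add: A_def[symmetric] A(4) measure_def)
qed

text \<open>The body \<open>B\<close> is cut out by coordinates \<open>h p \<bullet> y + c p\<close>
  with \<open>p \<in> D\<close> and a slab, which covers both the simplex (\<open>n = 0\<close>) and the
  right cylinder over one of its sides. The affine reflection that exchanges the points \<open>p\<close>
  and \<open>q\<close> maps \<open>B\<close> to itself and exchanges the coordinates of \<open>p\<close>
  and \<open>q\<close>. So all coordinates have the same mean, and these means add up to 1.\<close>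

lemma mean_barycentric:
  fixes h :: "'a::euclidean_space \<Rightarrow> 'a" and c :: "'a \<Rightarrow> real"
  assumes fin: "finite D"
    and dual: "\<And>p q r. p \<in> D \<Longrightarrow> q \<in> D \<Longrightarrow> r \<in> D \<Longrightarrow> h p \<bullet> (q - r) = of_bool (q = p) - of_bool (r = p)"
    and n: "\<And>q r. q \<in> D \<Longrightarrow> r \<in> D \<Longrightarrow> n \<bullet> (q - r) = 0"
    and B: "compact B" "0 < measure lborel B"
    and Beq: "\<And>y. y \<in> B \<longleftrightarrow> (\<forall>p\<in>D. 0 \<le> h p \<bullet> y + c p) \<and> 0 \<le> n \<bullet> y + t0 \<and> n \<bullet> y + t0 \<le> 1"
    and one: "\<And>y. y \<in> B \<Longrightarrow> (\<Sum>p\<in>D. h p \<bullet> y + c p) = 1"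
  shows "(LINT y:B|lborel. \<Sum>p\<in>D. a p * (h p \<bullet> y + c p)) = measure lborel B * (sum a D / real (card D))"
proof -
  define \<mu> where "\<mu> = (\<lambda>p y. h p \<bullet> y + c p)"
  have int: "set_integrable lborel B (\<mu> q)" for q
    unfolding set_integrable_def \<mu>_def using B(1)
    by (intro borel_integrable_compact) (auto intro!: continuous_intros)
  have eq: "(LINT y:B|lborel. \<mu> q y) = (LINT y:B|lborel. \<mu> p y)" if p: "p \<in> D" and q: "q \<in> D" for p q
  proof (cases "q = p")
    case False
    define v where "v = q - p"
    \<comment> \<open>The reflection that exchanges \<open>p\<close> and \<open>q\<close> and fixes the other points of \<open>D\<close>.\<close>
    define L where "L = (\<lambda>w. w + ((h p - h q) \<bullet> w) *\<^sub>R v)"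
    define a where "a = (c p - c q) *\<^sub>R v"
    have s: "a + L y = y + (\<mu> p y - \<mu> q y) *\<^sub>R v" for y
      by (simp add: a_def L_def \<mu>_def inner_diff_left algebra_simps)
    have hv: "h r \<bullet> v = of_bool (q = r) - of_bool (p = r)" if "r \<in> D" for r
      unfolding v_def by (rule dual[OF that q p])
    have nv: "n \<bullet> v = 0" unfolding v_def by (rule n[OF q p])
    have h2: "(h p - h q) \<bullet> v = -2" using False by (simp add: inner_diff_left hv p q)
    have linL: "linear L" unfolding L_def
      by (intro linearI) (simp_all add: inner_add_right scaleR_add_left scaleR_add_right)
    have LL: "L (L w) = w" for w
      by (simp add: L_def inner_add_right h2 flip: scaleR_add_left)
    then have injL: "inj L" by (metis injI)
    have \<mu>s: "\<mu> r (a + L y) = \<mu> r y + (\<mu> p y - \<mu> q y) * (of_bool (q = r) - of_bool (p = r))" if "r \<in> D" for r y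
      unfolding s by (simp add: \<mu>_def inner_add_right hv[OF that])
    have swap: "\<mu> p (a + L y) = \<mu> q y" "\<mu> q (a + L y) = \<mu> p y"
        "r \<noteq> p \<Longrightarrow> r \<noteq> q \<Longrightarrow> r \<in> D \<Longrightarrow> \<mu> r (a + L y) = \<mu> r y" for r y
      using False p q by (simp_all add: \<mu>s)
    have nn: "n \<bullet> (a + L y) = n \<bullet> y" for y unfolding s by (simp add: inner_add_right nv)
    have into: "a + L y \<in> B" if "y \<in> B" for y
    proof -
      have "0 \<le> \<mu> r y" if "r \<in> D" for r using \<open>y \<in> B\<close> that by (simp add: Beq \<mu>_def)
      then have "0 \<le> \<mu> r (a + L y)" if "r \<in> D" for r
        using that p q swap(1)[of y] swap(2)[of y] swap(3)[of r y] by metis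
      then show ?thesis using that nn[of y] by (simp add: Beq \<mu>_def)
    qed
    have invol: "a + L (a + L y) = y" for y
    proof -
      have "a + L (a + L y) = a + L y + (\<mu> q y - \<mu> p y) *\<^sub>R v"
        by (subst s) (simp only: swap)
      then show ?thesis unfolding s[of y] by (simp flip: scaleR_add_left)
    qed
    have sym: "(\<lambda>y. a + L y) ` B = B"
    proof (intro set_eqI iffI)
      fix y assume "y \<in> B"
      then have "a + L y \<in> B" by (rule into)
      then show "y \<in> (\<lambda>y. a + L y) ` B" using invol[of y] by (metis imageI)
    qed (use into in auto)
    have "(LINT y:B|lborel. \<mu> p (a + L y)) = (LINT y:B|lborel. \<mu> p y)"
      by (rule affine_symmetry_integral[OF linL injL B sym]) (simp add: \<mu>_def)
    then show ?thesis by (simp only: swap)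
  qed simp
  have sum: "(LINT y:B|lborel. \<Sum>q\<in>D. b q * \<mu> q y) = (\<Sum>q\<in>D. b q * (LINT y:B|lborel. \<mu> q y))" for b
  proof -
    have "set_integrable lborel B (\<lambda>y. b q * \<mu> q y)" for q using int by (rule set_integrable_mult_right)
    then have "(LINT y:B|lborel. \<Sum>q\<in>D. b q * \<mu> q y) = (\<Sum>q\<in>D. LINT y:B|lborel. b q * \<mu> q y)"
      unfolding set_lebesgue_integral_def scaleR_sum_right
      by (intro Bochner_Integration.integral_sum) (simp add: set_integrable_def)
    then show ?thesis by simp
  qed
  have mean: "(LINT y:B|lborel. \<mu> p y) = measure lborel B / real (card D)" if p: "p \<in> D" for p
  proof -
    have "measure lborel B = (LINT y:B|lborel. 1)"
      by (simp add: set_lebesgue_integral_def)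
    also have "\<dots> = (LINT y:B|lborel. (\<Sum>q\<in>D. 1 * \<mu> q y))"
      using one by (intro set_lebesgue_integral_cong) (auto simp: \<mu>_def B borel_compact)
    also have "\<dots> = real (card D) * (LINT y:B|lborel. \<mu> p y)" unfolding sum by (simp add: eq[OF p])
    finally have "measure lborel B = real (card D) * (LINT y:B|lborel. \<mu> p y)" .
    moreover have "real (card D) \<noteq> 0" using fin p by auto
    ultimately show ?thesis by simp
  qed
  have "(LINT y:B|lborel. \<Sum>q\<in>D. a q * \<mu> q y) = (\<Sum>q\<in>D. a q * (measure lborel B / real (card D)))"
    unfolding sum by (intro sum.cong refl) (simp only: mean)
  also have "\<dots> = measure lborel B * (sum a D / real (card D))"
    unfolding sum_distrib_right[symmetric] by simp
  finally show ?thesis by (simp only: \<mu>_def)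
qed

context frame
begin

lemma compact_T: "compact T" using fin by (simp add: finite_imp_compact_convex_hull)
lemma compact_F: "compact (F p)" using fin by (simp add: finite_imp_compact_convex_hull)

lemma measure_T_pos: "0 < measure lborel T"
proof -
  have "\<not> negligible (interior T)" using barycentre_interior by (intro open_not_negligible) auto
  then have "\<not> negligible T" using interior_subset negligible_subset by blast
  moreover have "T \<in> lmeasurable" using compact_T by (rule lmeasurable_compact)
  moreover have "measure lebesgue T = measure lborel T"
    using compact_T by (simp add: borel_compact)
  ultimately show ?thesis by (metis negligible_iff_measure zero_less_measure_iff)
qed

text \<open>An affine function is the combination of barycentric coordinates with its vertex values as
  weights.\<close>

lemma integral_T:
  "(LINT x:T|lborel. G \<bullet> x + c) = measure lborel T * (G \<bullet> barycentre + c)"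
proof -
  have bary: "bary p x = g p \<bullet> x + (1 / real (Suc DIM('a)) - g p \<bullet> barycentre)" for p x
    by (simp add: bary_def inner_diff_right)
  have G: "G \<bullet> x + c = (\<Sum>p\<in>C. (G \<bullet> p + c) * bary p x)" for x
  proof -
    have "G \<bullet> x = (\<Sum>p\<in>C. (G \<bullet> p) * bary p x)"
      by (subst (1) bary_expand[of x, symmetric]) (simp add: inner_sum_right mult.commute)
    moreover have "(\<Sum>p\<in>C. (G \<bullet> p + c) * bary p x) = (\<Sum>p\<in>C. (G \<bullet> p) * bary p x) + c * (\<Sum>p\<in>C. bary p x)"
      by (simp add: distrib_right sum.distrib sum_distrib_left)
    ultimately show ?thesis by (simp only: sum_bary mult_1_right)
  qed
  have "(\<lambda>x. G \<bullet> x + c) = (\<lambda>x. \<Sum>p\<in>C. (G \<bullet> p + c) * bary p x)" using G by (rule ext)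
  then have "(LINT x:T|lborel. G \<bullet> x + c) = (LINT x:T|lborel. \<Sum>p\<in>C. (G \<bullet> p + c) * bary p x)"
    by (rule arg_cong)
  also have "\<dots> = measure lborel T * ((\<Sum>p\<in>C. G \<bullet> p + c) / real (card C))"
    unfolding bary
    by (rule mean_barycentric[where n=0 and ?t0.0=0, OF fin dual _ compact_T measure_T_pos])
       (use sum_bary T_iff in \<open>auto simp: bary\<close>)
  also have "(\<Sum>p\<in>C. G \<bullet> p + c) / real (card C) = G \<bullet> barycentre + c"
    by (simp add: sum.distrib barycentre_def inner_sum_right card add_divide_distrib del: of_nat_Suc)
  finally show ?thesis by simp
qed

end

text \<open>A side of the simplex, opposite to the vertex \<open>p\<close>, with one of its two unit normals.\<close>

locale face_frame = frame C g for C :: "'a::euclidean_space set" and g +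
  fixes p n :: 'a
  assumes p: "p \<in> C" and n1: "norm n = 1" and n: "\<And>x y. x \<in> F p \<Longrightarrow> y \<in> F p \<Longrightarrow> n \<bullet> (x - y) = 0"
begin

text \<open>The cylinder over the side that defines its surface measure, for either choice of the unit
  normal.\<close>

definition cyl :: "'a set" where "cyl = {x + t *\<^sub>R n | x t. x \<in> F p \<and> 0 \<le> t \<and> t \<le> 1}"

lemma nn: "n \<bullet> n = 1" using n1 by (simp add: dot_square_norm)

lemma n_vertices: "q \<in> C - {p} \<Longrightarrow> r \<in> C - {p} \<Longrightarrow> n \<bullet> (q - r) = 0"
  by (intro n) (auto simp: hull_inc)

text \<open>The number \<open>h\<close> is the signed height of \<open>p\<close> over the opposite
  side.\<close>

lemma n_parallel: obtains h where "h \<noteq> 0" "n = h *\<^sub>R g p" "\<bar>h\<bar> * norm (g p) = 1"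
    "\<And>q. q \<in> C \<Longrightarrow> q \<noteq> p \<Longrightarrow> n \<bullet> (p - q) = h"
proof -
  obtain q where q: "q \<in> C" "q \<noteq> p" using obtain_other[OF p] .
  define h where "h = n \<bullet> (p - q)"
  have *: "n = h *\<^sub>R g p" unfolding h_def by (rule normal_parallel[OF p n q])
  have "norm (h *\<^sub>R g p) = 1" using n1 by (simp flip: *)
  then have 1: "\<bar>h\<bar> * norm (g p) = 1" by simp
  then have "h \<noteq> 0" by auto
  moreover have "n \<bullet> (p - r) = h" if "r \<in> C" "r \<noteq> p" for r
    using n_vertices[of r q] q that by (simp add: h_def inner_diff_right)
  ultimately show ?thesis using that * 1 by blast
qed

text \<open>The pyramid formula \<open>\<bar>S\<bar> h = d \<bar>T\<bar>\<close>, with the height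
  \<open>h = 1 / \<bar>g p\<bar>\<close>. The linear map \<open>M\<close> sends the standard prism to
  the cylinder; composed with a stretch and a shear along the direction \<open>k\<close>, it sends the
  standard simplex to \<open>T\<close>. The factor of \<open>M\<close> cancels in the ratio of the two
  volumes, leaving the volumes \<open>1 / (d - 1)!\<close> and \<open>1 / d!\<close> of the standard
  bodies and the stretch by \<open>h\<close>.\<close>

lemma measure_cyl: "measure lborel cyl = real DIM('a) * measure lborel T * norm (g p)"
proof -
  obtain h where h: "h \<noteq> 0" "n = h *\<^sub>R g p" "\<bar>h\<bar> * norm (g p) = 1"
      "\<And>q. q \<in> C \<Longrightarrow> q \<noteq> p \<Longrightarrow> n \<bullet> (p - q) = h"
    using n_parallel by blast
  obtain q where q: "q \<in> C" "q \<noteq> p" using obtain_other[OF p] .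
  obtain k :: 'a where k: "k \<in> Basis" using nonempty_Basis by blast
  have kk: "k \<bullet> k = 1" using k by simp
  have "card (Basis - {k}) = card (C - {p} - {q})"
    using k fin q p card_diff[OF p] by (simp add: card_Diff_singleton)
  then obtain b where b: "bij_betw b (Basis - {k}) (C - {p} - {q})"
    using finite_same_card_bij[of "Basis - {k}" "C - {p} - {q}"] fin by auto
  have bC: "b i \<in> C" "b i \<noteq> p" "b i \<noteq> q" if "i \<in> Basis - {k}" for i
    using bij_betwE[OF b] that by auto
  have bim: "b ` (Basis - {k}) = C - {p} - {q}" using b by (simp add: bij_betw_def)
  have binj: "b i = b j \<longleftrightarrow> i = j" if "i \<in> Basis - {k}" "j \<in> Basis - {k}" for i j
    using b that by (auto simp: bij_betw_def inj_on_def)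
  \<comment> \<open>The basis vectors other than \<open>k\<close> go to the edges of the side at \<open>q\<close>, and \<open>k\<close> goes to the normal.\<close>
  define M where "M = (\<lambda>x. (\<Sum>i\<in>Basis - {k}. (x \<bullet> i) *\<^sub>R (b i - q)) + (x \<bullet> k) *\<^sub>R n)"
  have linM: "linear M" unfolding M_def
    by (intro linearI) (simp_all add: inner_add_left scaleR_add_left sum.distrib scaleR_add_right scaleR_sum_right)
  have nM: "n \<bullet> M x = x \<bullet> k" for x
  proof -
    have "n \<bullet> (b i - q) = 0" if "i \<in> Basis - {k}" for i using bC[OF that] q by (intro n_vertices) auto
    then show ?thesis by (simp add: M_def inner_add_right inner_sum_right nn)
  qed
  have injM: "inj M"
  proof (rule linear_injective_0[THEN iffD2, OF linM], intro allI impI)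
    fix x assume x: "M x = 0"
    have xk: "x \<bullet> k = 0" using nM[of x] x by simp
    have "x \<bullet> i = 0" if i: "i \<in> Basis - {k}" for i
    proof -
      have "0 = g (b i) \<bullet> M x" using x by simp
      also have "\<dots> = (\<Sum>j\<in>Basis - {k}. (x \<bullet> j) * (g (b i) \<bullet> (b j - q)))"
        by (simp add: M_def xk inner_sum_right)
      also have "\<dots> = (\<Sum>j\<in>Basis - {k}. (x \<bullet> j) * of_bool (j = i))"
      proof (intro sum.cong refl)
        fix j assume j: "j \<in> Basis - {k}"
        have "g (b i) \<bullet> (b j - q) = of_bool (b j = b i) - of_bool (q = b i)"
          using bC[OF i] bC[OF j] q by (intro dual) auto
        then show "(x \<bullet> j) * (g (b i) \<bullet> (b j - q)) = (x \<bullet> j) * of_bool (j = i)"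
          using bC[OF i] binj[OF j i] by simp
      qed
      also have "\<dots> = x \<bullet> i" using i by (simp add: of_bool_def if_distrib cong: if_cong)
      finally show ?thesis by simp
    qed
    then show "x = 0" using xk by (metis Diff_iff euclidean_all_zero_iff singletonD)
  qed
  have Mi: "M i = b i - q" if i: "i \<in> Basis - {k}" for i
  proof -
    have "M i = (\<Sum>j\<in>Basis - {k}. (if j = i then b j - q else 0))"
    proof -
      have "i \<bullet> k = 0" using i k by (auto simp: inner_Basis)
      moreover have "(i \<bullet> j) *\<^sub>R (b j - q) = (if j = i then b j - q else 0)" if "j \<in> Basis - {k}" for j
        using i that by (auto simp: inner_Basis)
      then have "(\<Sum>j\<in>Basis - {k}. (i \<bullet> j) *\<^sub>R (b j - q)) = (\<Sum>j\<in>Basis - {k}. (if j = i then b j - q else 0))"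
        by (intro sum.cong refl) blast
      ultimately show ?thesis by (simp only: M_def scaleR_zero_left add_0_right)
    qed
    then show ?thesis using i by simp
  qed
  have Mk: "M k = n"
  proof -
    have "(\<Sum>i\<in>Basis - {k}. (k \<bullet> i) *\<^sub>R (b i - q)) = 0"
      using k by (intro sum.neutral) (auto simp: inner_Basis)
    then show ?thesis using kk by (simp add: M_def)
  qed
  \<comment> \<open>In the coordinates of \<open>M\<close> the apex \<open>p\<close> has height \<open>h\<close> but may not lie above \<open>q\<close>; hence the shear.\<close>
  obtain a where a: "M a = p - q" using linear_injective_imp_surjective[OF linM injM] by (metis surjD)
  have ak: "a \<bullet> k = h" using nM[of a] h(4)[OF q] by (simp add: a)
  define Sh where "Sh = (\<lambda>x. x + (x \<bullet> k) *\<^sub>R (a - k))"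
  define St where "St = (\<lambda>x. x + ((h - 1) * (x \<bullet> k)) *\<^sub>R k)"
  define \<alpha> where "\<alpha> = (1 / h) *\<^sub>R a - k"
  define S1 where "S1 = (\<lambda>x. x + (x \<bullet> k) *\<^sub>R \<alpha>)"
  have \<alpha>k: "\<alpha> \<bullet> k = 0" using ak kk h(1) by (simp add: \<alpha>_def inner_diff_left)
  have lin: "linear St" "linear S1" unfolding St_def S1_def
    by (auto intro!: linearI simp: inner_add_left scaleR_add_left algebra_simps)
  have Sk: "St x \<bullet> k = h * (x \<bullet> k)" for x by (simp add: St_def inner_add_left kk algebra_simps)
  have inj: "inj St" "inj S1"
  proof -
    show "inj St"
    proof (rule linear_injective_0[THEN iffD2, OF lin(1)], intro allI impI)
      fix x assume x: "St x = 0"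
      then have "x \<bullet> k = 0" using Sk[of x] h(1) by simp
      then show "x = 0" using x by (simp add: St_def)
    qed
    show "inj S1"
    proof (rule linear_injective_0[THEN iffD2, OF lin(2)], intro allI impI)
      fix x assume x: "S1 x = 0"
      have "S1 x \<bullet> k = x \<bullet> k" by (simp add: S1_def inner_add_left \<alpha>k)
      then show "x = 0" using x by (simp add: S1_def)
    qed
  qed
  have Sh: "Sh = S1 \<circ> St"
  proof
    fix x
    have "(S1 \<circ> St) x = St x + (h * (x \<bullet> k)) *\<^sub>R \<alpha>" by (simp add: S1_def Sk)
    also have "\<dots> = x + (x \<bullet> k) *\<^sub>R (a - k)"
      using h(1) by (simp add: St_def \<alpha>_def algebra_simps)
    finally show "Sh x = (S1 \<circ> St) x" by (simp add: Sh_def)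
  qed
  have linSh: "linear Sh" "inj Sh" unfolding Sh using lin inj by (auto intro: linear_compose inj_compose)
  have "jacobian Sh = \<bar>h\<bar>"
    unfolding Sh jacobian_compose[OF lin(2) inj(2) lin(1) inj(1)]
    using jacobian_shear[of k \<alpha>] jacobian_stretch[OF k h(1)] k \<alpha>k by (simp add: S1_def St_def)
  then have jMS: "jacobian (M \<circ> Sh) = jacobian M * \<bar>h\<bar>" using jacobian_compose[OF linM injM linSh] by simp
  have linMS: "linear (M \<circ> Sh)" "inj (M \<circ> Sh)"
    using linM injM linSh by (auto intro: linear_compose inj_compose)
  have M0: "M 0 = 0" using linM by (simp add: linear_0)
  have hull_im: "(\<lambda>x. q + f x) ` (convex hull V) = convex hull ((\<lambda>x. q + f x) ` V)" if "linear f" for f V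
  proof -
    have "(\<lambda>x. q + f x) ` (convex hull V) = (\<lambda>x. q + x) ` (f ` (convex hull V))" by (simp add: image_image)
    also have "\<dots> = convex hull ((\<lambda>x. q + x) ` (f ` V))"
      by (simp add: convex_hull_linear_image[OF that] convex_hull_translation)
    finally show ?thesis by (simp add: image_image)
  qed
  have T: "(\<lambda>x. q + (M \<circ> Sh) x) ` (convex hull (insert 0 Basis)) = T"
  proof -
    have "(\<lambda>x. q + (M \<circ> Sh) x) ` insert 0 Basis = C"
    proof -
      have 1: "q + (M \<circ> Sh) k = p" using kk by (simp add: Sh_def a)
      have 2: "q + (M \<circ> Sh) 0 = q" by (simp add: Sh_def M0)
      have 3: "q + (M \<circ> Sh) i = b i" if i: "i \<in> Basis - {k}" for i
      proof -
        have "i \<bullet> k = 0" using i k by (auto simp: inner_Basis)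
        then show ?thesis using Mi[OF i] by (simp add: Sh_def)
      qed
      have "insert 0 Basis = insert 0 (insert k (Basis - {k}))" using k by auto
      then have "(\<lambda>x. q + (M \<circ> Sh) x) ` insert 0 Basis
          = insert q (insert p ((\<lambda>x. q + (M \<circ> Sh) x) ` (Basis - {k})))"
        by (simp only: image_insert 1 2)
      also have "(\<lambda>x. q + (M \<circ> Sh) x) ` (Basis - {k}) = b ` (Basis - {k})"
        using 3 by (intro image_cong) auto
      finally show ?thesis using p q by (auto simp: bim)
    qed
    then show ?thesis using hull_im[OF linMS(1)] by simp
  qed
  have bstd: "convex hull (insert 0 Basis) \<in> sets (borel :: 'a measure)"
    by (intro borel_compact finite_imp_compact_convex_hull) auto
  have mT: "measure lborel T = jacobian M * \<bar>h\<bar> / fact DIM('a)"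
    using measure_affine_image[OF linMS bstd, of q] content_std_simplex[where 'a='a]
    unfolding T by (simp add: jMS)
  define Pr where "Pr = {x::'a. (\<forall>i\<in>Basis. 0 \<le> x \<bullet> i) \<and> (\<Sum>i\<in>Basis - {k}. x \<bullet> i) \<le> 1 \<and> x \<bullet> k \<le> 1}"
  have Pr: "Pr = {y + t *\<^sub>R k | y t. y \<in> convex hull (insert 0 (Basis - {k})) \<and> 0 \<le> t \<and> t \<le> 1}"
  proof -
    have hull: "y \<in> convex hull (insert 0 (Basis - {k})) \<longleftrightarrow>
        (\<forall>i\<in>Basis. 0 \<le> y \<bullet> i) \<and> (\<Sum>i\<in>Basis - {k}. y \<bullet> i) \<le> 1 \<and> y \<bullet> k = 0" for y :: 'a
      using substd_simplex[of "Basis - {k}"] k by auto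
    have sums: "(\<Sum>i\<in>Basis - {k}. (y + t *\<^sub>R k) \<bullet> i) = (\<Sum>i\<in>Basis - {k}. y \<bullet> i)" for y t
      using k by (intro sum.cong) (auto simp: inner_add_left inner_Basis)
    have comp: "(y + t *\<^sub>R k) \<bullet> i = y \<bullet> i + (if i = k then t else 0)" if "i \<in> Basis" for i y t
      using k that by (auto simp: inner_add_left inner_Basis)
    show ?thesis
    proof (intro set_eqI iffI)
      fix x assume x: "x \<in> Pr"
      define y where "y = x - (x \<bullet> k) *\<^sub>R k"
      have xy: "x = y + (x \<bullet> k) *\<^sub>R k" by (simp add: y_def)
      have yi: "y \<bullet> i = (if i = k then 0 else x \<bullet> i)" if "i \<in> Basis" for i
        using that k by (auto simp: y_def inner_diff_left inner_Basis)
      have "(\<Sum>i\<in>Basis - {k}. y \<bullet> i) = (\<Sum>i\<in>Basis - {k}. x \<bullet> i)" by (intro sum.cong) (auto simp: yi)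
      then have "y \<in> convex hull (insert 0 (Basis - {k}))"
        using x k by (auto simp: hull yi Pr_def)
      then show "x \<in> {y + t *\<^sub>R k | y t. y \<in> convex hull (insert 0 (Basis - {k})) \<and> 0 \<le> t \<and> t \<le> 1}"
        using x xy k by (auto simp: Pr_def intro!: exI[of _ y] exI[of _ "x \<bullet> k"])
    next
      fix x assume "x \<in> {y + t *\<^sub>R k | y t. y \<in> convex hull (insert 0 (Basis - {k})) \<and> 0 \<le> t \<and> t \<le> 1}"
      then obtain y t where "x = y + t *\<^sub>R k" "0 \<le> t" "t \<le> 1" "y \<in> convex hull (insert 0 (Basis - {k}))" by blast
      then show "x \<in> Pr" using k unfolding Pr_def by (simp add: sums comp hull)
    qed
  qed
  have cyl: "(\<lambda>x. q + M x) ` Pr = cyl"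
  proof -
    have *: "(\<lambda>x. q + M x) ` (convex hull (insert 0 (Basis - {k}))) = F p"
    proof -
      have "(\<lambda>x. q + M x) ` (insert 0 (Basis - {k})) = insert q ((\<lambda>x. q + M x) ` (Basis - {k}))"
        by (simp add: M0)
      also have "(\<lambda>x. q + M x) ` (Basis - {k}) = b ` (Basis - {k})"
        using Mi by (intro image_cong) auto
      also have "insert q (b ` (Basis - {k})) = C - {p}" unfolding bim using q by auto
      finally show ?thesis using hull_im[OF linM] by simp
    qed
    have M: "q + M (y + t *\<^sub>R k) = (q + M y) + t *\<^sub>R n" for y t
      using linM by (simp add: linear_add linear_scale Mk)
    show ?thesis
    proof (intro set_eqI iffI)
      fix z assume "z \<in> (\<lambda>x. q + M x) ` Pr"
      then obtain y t where "z = q + M (y + t *\<^sub>R k)" "y \<in> convex hull (insert 0 (Basis - {k}))" "0 \<le> t" "t \<le> 1"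
        unfolding Pr by blast
      then show "z \<in> cyl" using * unfolding M cyl_def by blast
    next
      fix z assume "z \<in> cyl"
      then obtain x t where z: "z = x + t *\<^sub>R n" "x \<in> F p" "0 \<le> t" "t \<le> 1" unfolding cyl_def by blast
      from z(2) obtain y where y: "y \<in> convex hull (insert 0 (Basis - {k}))" "x = q + M y"
        unfolding *[symmetric] by blast
      have "z = q + M (y + t *\<^sub>R k)" unfolding M using z y by simp
      moreover have "y + t *\<^sub>R k \<in> Pr" unfolding Pr using y z by blast
      ultimately show "z \<in> (\<lambda>x. q + M x) ` Pr" by blast
    qed
  qed
  have "closed Pr" unfolding Pr_def Ball_def
    by (intro closed_Collect_conj closed_Collect_all closed_Collect_imp open_Collect_const closed_Collect_le continuous_intros)
  then have bPr: "Pr \<in> sets borel" by (rule borel_closed)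
  have mc: "measure lborel cyl = jacobian M / fact (DIM('a) - 1)"
    using measure_affine_image[OF linM injM bPr, of q] measure_std_prism[OF k]
    unfolding cyl by (simp add: Pr_def)
  have "fact DIM('a) = real DIM('a) * fact (DIM('a) - 1)" by (simp add: fact_reduce)
  then show ?thesis unfolding mc mT using h(3) by (simp add: field_simps)
qed

end

section \<open>The surface measure of a side\<close>

context face_frame
begin

definition proj :: "'a \<Rightarrow> 'a" where "proj y = y - (n \<bullet> (y - face_barycentre p)) *\<^sub>R n"

lemma F_normal_zero: "x \<in> F p \<Longrightarrow> n \<bullet> (x - face_barycentre p) = 0"
  using n face_barycentre_rel_interior[OF p] rel_interior_F_subset by blast

lemma borel_rel_interior_F: "rel_interior (F p) \<in> sets borel"
proof -
  have "rel_interior (F p) = {x. bary p x = 0} \<inter> (\<Inter>q\<in>C - {p}. {x. 0 < bary q x})"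
    using rel_interior_F_iff[OF p] by auto
  moreover have "closed {x. bary p x = 0}" unfolding bary_def
    by (intro closed_Collect_eq continuous_intros)
  moreover have "open {x. 0 < bary q x}" for q unfolding bary_def
    by (intro open_Collect_less continuous_intros)
  then have "open (\<Inter>q\<in>C - {p}. {x. 0 < bary q x})" using fin by (intro open_INT) auto
  ultimately show ?thesis by (metis borel_closed borel_open sets.Int)
qed

lemma grad_n: "(g p \<bullet> n) *\<^sub>R n = g p"
proof -
  obtain h where h: "h \<noteq> 0" "n = h *\<^sub>R g p" using n_parallel by blast
  have "h * h * (g p \<bullet> g p) = 1" using nn h by simp
  moreover have "(g p \<bullet> n) *\<^sub>R n = (h * h * (g p \<bullet> g p)) *\<^sub>R g p" by (simp add: h(2))
  ultimately show ?thesis by simp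
qed

lemma bary_prj_p: "bary p (proj y) = 0"
proof -
  have "bary p (proj y) = bary p (proj y) - bary p (face_barycentre p)" using p by (simp add: bary_face_barycentre)
  also have "\<dots> = g p \<bullet> (y - face_barycentre p) - (n \<bullet> (y - face_barycentre p)) * (g p \<bullet> n)"
    unfolding bary_diff by (simp add: proj_def inner_diff_right algebra_simps)
  also have "g p \<bullet> (y - face_barycentre p) = (g p \<bullet> n) * (n \<bullet> (y - face_barycentre p))"
    by (subst grad_n[symmetric]) simp
  finally show ?thesis by simp
qed

lemma bary_prj:
  assumes "q \<in> C" "q \<noteq> p"
  shows "bary q (proj y) = (g q - (g q \<bullet> n) *\<^sub>R n) \<bullet> y
    + (1 / real DIM('a) - (g q - (g q \<bullet> n) *\<^sub>R n) \<bullet> face_barycentre p)"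
proof -
  have "bary q (proj y) = bary q (proj y) - bary q (face_barycentre p) + 1 / real DIM('a)" using assms p by (simp add: bary_face_barycentre)
  also have "bary q (proj y) - bary q (face_barycentre p) = g q \<bullet> (y - face_barycentre p) - (n \<bullet> (y - face_barycentre p)) * (g q \<bullet> n)"
    unfolding bary_diff by (simp add: proj_def inner_diff_right algebra_simps)
  finally show ?thesis by (simp add: inner_diff_left inner_diff_right algebra_simps)
qed

lemma cyl_iff: "y \<in> cyl \<longleftrightarrow> proj y \<in> F p \<and> 0 \<le> n \<bullet> (y - face_barycentre p) \<and> n \<bullet> (y - face_barycentre p) \<le> 1"
proof
  assume "y \<in> cyl"
  then obtain x t where y: "y = x + t *\<^sub>R n" "x \<in> F p" "0 \<le> t" "t \<le> 1" unfolding cyl_def by blast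
  have "n \<bullet> (y - face_barycentre p) = n \<bullet> (x - face_barycentre p) + t * (n \<bullet> n)" by (simp add: y inner_add_right inner_diff_right)
  then have t: "n \<bullet> (y - face_barycentre p) = t" using F_normal_zero[OF y(2)] nn by simp
  then have "proj y = x" by (simp add: proj_def y(1))
  then show "proj y \<in> F p \<and> 0 \<le> n \<bullet> (y - face_barycentre p) \<and> n \<bullet> (y - face_barycentre p) \<le> 1" using t y by simp
next
  assume h: "proj y \<in> F p \<and> 0 \<le> n \<bullet> (y - face_barycentre p) \<and> n \<bullet> (y - face_barycentre p) \<le> 1"
  have "y = proj y + (n \<bullet> (y - face_barycentre p)) *\<^sub>R n" by (simp add: proj_def)
  then show "y \<in> cyl" using h unfolding cyl_def by blast
qed

lemma compact_cyl: "compact cyl"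
proof -
  have "cyl = (\<lambda>(x, t). x + t *\<^sub>R n) ` (F p \<times> {0..1})" unfolding cyl_def by force
  moreover have "compact \<dots>"
    by (intro compact_continuous_image compact_Times compact_F compact_Icc)
       (auto intro!: continuous_intros simp: split_def)
  ultimately show ?thesis by simp
qed

lemma measure_cyl_pos: "0 < measure lborel cyl"
  unfolding measure_cyl using measure_T_pos grad_nonzero[OF p] by simp

text \<open>Same argument as for the simplex; the coordinates of the projection are the barycentric
  gradients with their normal components removed.\<close>

lemma integral_cyl:
  "(LINT y:cyl|lborel. G \<bullet> proj y + c) = measure lborel cyl * (G \<bullet> face_barycentre p + c)"
proof -
  let ?h = "\<lambda>q. g q - (g q \<bullet> n) *\<^sub>R n"
  let ?c = "\<lambda>q. 1 / real DIM('a) - ?h q \<bullet> face_barycentre p"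
  have sum1: "(\<Sum>q\<in>C - {p}. bary q (proj y)) = 1" for y
    using sum_bary[of "proj y"] bary_prj_p[of y] by (simp add: sum_remove[OF p])
  have G: "G \<bullet> proj x + c = (\<Sum>q\<in>C - {p}. (G \<bullet> q + c) * bary q (proj x))" for x
  proof -
    have e: "proj x = (\<Sum>q\<in>C - {p}. bary q (proj x) *\<^sub>R q)"
      using bary_expand[of "proj x"] bary_prj_p[of x] by (simp add: sum_remove[OF p])
    have "G \<bullet> proj x = (\<Sum>q\<in>C - {p}. (G \<bullet> q) * bary q (proj x))"
      by (subst (1) e) (simp add: inner_sum_right mult.commute)
    moreover have "(\<Sum>q\<in>C - {p}. (G \<bullet> q + c) * bary q (proj x))
        = (\<Sum>q\<in>C - {p}. (G \<bullet> q) * bary q (proj x)) + c * (\<Sum>q\<in>C - {p}. bary q (proj x))"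
      by (simp add: distrib_right sum.distrib sum_distrib_left)
    ultimately show ?thesis by (simp only: sum1 mult_1_right)
  qed
  have "(\<lambda>x. G \<bullet> proj x + c) = (\<lambda>x. \<Sum>q\<in>C - {p}. (G \<bullet> q + c) * (?h q \<bullet> x + ?c q))"
    unfolding G by (intro ext sum.cong refl) (simp add: bary_prj)
  then have "(LINT x:cyl|lborel. G \<bullet> proj x + c) = (LINT x:cyl|lborel. \<Sum>q\<in>C - {p}. (G \<bullet> q + c) * (?h q \<bullet> x + ?c q))"
    by (rule arg_cong)
  also have "\<dots> = measure lborel cyl * ((\<Sum>q\<in>C - {p}. G \<bullet> q + c) / real (card (C - {p})))"
  proof (rule mean_barycentric[where n=n and ?t0.0="- (n \<bullet> face_barycentre p)", OF _ _ n_vertices compact_cyl measure_cyl_pos])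
    show "finite (C - {p})" using fin by simp
    fix a b c assume abc: "a \<in> C - {p}" "b \<in> C - {p}" "c \<in> C - {p}"
    then show "?h a \<bullet> (b - c) = of_bool (b = a) - of_bool (c = a)"
      using dual[of a b c] n_vertices[of b c] by (simp add: inner_diff_left)
  next
    fix y
    have "y \<in> cyl \<longleftrightarrow> (\<forall>q\<in>C - {p}. 0 \<le> bary q (proj y)) \<and> 0 \<le> n \<bullet> (y - face_barycentre p) \<and> n \<bullet> (y - face_barycentre p) \<le> 1"
      unfolding cyl_iff F_iff[OF p] using bary_prj_p[of y] by auto
    then show "y \<in> cyl \<longleftrightarrow> (\<forall>q\<in>C - {p}. 0 \<le> ?h q \<bullet> y + ?c q) \<and> 0 \<le> n \<bullet> y + - (n \<bullet> face_barycentre p) \<and> n \<bullet> y + - (n \<bullet> face_barycentre p) \<le> 1"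
      by (simp add: bary_prj inner_diff_right)
    have "(\<Sum>q\<in>C - {p}. ?h q \<bullet> y + ?c q) = (\<Sum>q\<in>C - {p}. bary q (proj y))"
      by (intro sum.cong) (simp_all add: bary_prj)
    then show "(\<Sum>q\<in>C - {p}. ?h q \<bullet> y + ?c q) = 1" using sum1 by simp
  qed
  also have "real (card (C - {p})) = real DIM('a)" using card_diff[OF p] by simp
  also have "(\<Sum>q\<in>C - {p}. G \<bullet> q + c) / real DIM('a) = G \<bullet> face_barycentre p + c"
    using card_diff[OF p] by (simp add: sum.distrib face_barycentre_def inner_sum_right add_divide_distrib)
  finally show ?thesis by simp
qed

lemma proj_closest_point: "closest_point (affine hull (F p)) y = proj y"
proof (rule closest_point_unique[symmetric])
  show "convex (affine hull (F p))" by (simp add: affine_imp_convex)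
  show "closed (affine hull (F p))" by (rule closed_affine_hull)
  have "sum (\<lambda>q. bary q (proj y)) (C - {p}) = 1" "proj y = (\<Sum>q\<in>C - {p}. bary q (proj y) *\<^sub>R q)"
    using sum_bary[of "proj y"] bary_expand[of "proj y"] bary_prj_p[of y] by (simp_all add: sum_remove[OF p])
  then have "proj y \<in> affine hull (C - {p})" using fin by (auto simp: affine_hull_finite intro: exI[of _ "\<lambda>q. bary q (proj y)"])
  then show "proj y \<in> affine hull (F p)" by (simp add: affine_hull_convex_hull)
  have hyp: "affine hull (F p) \<subseteq> {x. n \<bullet> x = n \<bullet> face_barycentre p}"
  proof (rule hull_minimal)
    show "F p \<subseteq> {x. n \<bullet> x = n \<bullet> face_barycentre p}" using F_normal_zero by (auto simp: inner_diff_right)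
    show "affine {x. n \<bullet> x = n \<bullet> face_barycentre p}" by (rule affine_hyperplane)
  qed
  show "\<forall>z\<in>affine hull (F p). dist y (proj y) \<le> dist y z"
  proof
    fix z assume "z \<in> affine hull (F p)"
    then have z: "n \<bullet> z = n \<bullet> face_barycentre p" using hyp by auto
    define s where "s = n \<bullet> (y - face_barycentre p)"
    have "dist y (proj y) = \<bar>s\<bar>" by (simp add: dist_norm proj_def s_def n1)
    also have "\<bar>s\<bar> = \<bar>n \<bullet> (y - z)\<bar>" by (simp add: s_def inner_diff_right z)
    also have "\<dots> \<le> norm n * norm (y - z)" by (rule Cauchy_Schwarz_ineq2)
    finally show "dist y (proj y) \<le> dist y z" by (simp add: n1 dist_norm)
  qed
qed

lemma continuous_proj: "continuous_on A proj"
  unfolding proj_def by (intro continuous_intros)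

text \<open>An interior point of the cylinder projects to a point of the relative interior of the side,
  so the set lies in the boundary of a convex body.\<close>

lemma negligible_over_relative_boundary:
  "emeasure lborel {y \<in> cyl. proj y \<notin> rel_interior (F p)} = 0"
proof -
  have conv: "convex cyl"
  proof -
    have "cyl = (\<lambda>z. fst z + snd z *\<^sub>R n) ` (F p \<times> {0..1})" unfolding cyl_def by force
    moreover have "convex \<dots>"
      by (intro convex_linear_image convex_Times) (auto intro!: linearI simp: algebra_simps)
    ultimately show ?thesis by simp
  qed
  have sub: "{y \<in> cyl. proj y \<notin> rel_interior (F p)} \<subseteq> frontier cyl"
  proof
    fix y assume y: "y \<in> {y \<in> cyl. proj y \<notin> rel_interior (F p)}"
    have "y \<notin> interior cyl"
    proof
      assume "y \<in> interior cyl"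
      then obtain e where e: "e > 0" "ball y e \<subseteq> cyl" by (auto simp: mem_interior)
      have "proj y \<in> rel_interior (F p)"
        unfolding mem_rel_interior_ball
      proof (intro conjI exI[of _ e])
        show "proj y \<in> F p" using y by (simp add: cyl_iff)
        show "0 < e" by fact
        show "ball (proj y) e \<inter> affine hull (F p) \<subseteq> F p"
        proof
          fix z assume z: "z \<in> ball (proj y) e \<inter> affine hull (F p)"
          define w where "w = z + (y - proj y)"
          have "w \<in> ball y e" using z by (simp add: w_def dist_norm algebra_simps)
          then have "w \<in> cyl" using e by blast
          then have "proj w \<in> F p" by (simp add: cyl_iff)
          moreover have "proj z = z"
            using proj_closest_point[of z] z by (simp add: closest_point_self)
          moreover have "proj w = proj z"
            by (simp add: w_def proj_def inner_add_right inner_diff_right nn algebra_simps)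
               (simp only: mult_2 scaleR_add_left)
          ultimately show "z \<in> F p" by simp
        qed
      qed
      then show False using y by simp
    qed
    then show "y \<in> frontier cyl" using y closure_subset[of cyl] by (auto simp: frontier_def)
  qed
  have "negligible {y \<in> cyl. proj y \<notin> rel_interior (F p)}"
    using negligible_convex_frontier[OF conv] sub by (rule negligible_subset)
  moreover have "{y \<in> cyl. proj y \<notin> rel_interior (F p)} \<in> sets borel"
  proof -
    have b: "rel_interior (F p) \<in> sets borel"
      by (rule borel_rel_interior_F)
    have "proj -` (- rel_interior (F p)) \<inter> space borel \<in> sets borel"
      by (rule measurable_sets[of proj borel borel]) (use b continuous_proj in \<open>auto intro: borel_measurable_continuous_onI\<close>)
    moreover have "{y \<in> cyl. proj y \<notin> rel_interior (F p)} = cyl \<inter> (proj -` (- rel_interior (F p)) \<inter> space borel)" by auto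
    ultimately show ?thesis using borel_compact[OF compact_cyl] by (metis sets.Int)
  qed
  ultimately show ?thesis
    by (simp add: negligible_iff_null_sets null_sets_completion_iff null_setsD1)
qed

end

context frame
begin

text \<open>By the pyramid formula this is the surface measure of the side opposite to
  \<open>p\<close>.\<close>

definition face_area :: "'a \<Rightarrow> real" where "face_area p = real DIM('a) * measure lborel T * norm (g p)"

lemma face_area_pos: "p \<in> C \<Longrightarrow> 0 < face_area p"
  using measure_T_pos grad_nonzero by (simp add: face_area_def)

text \<open>The normal in the definition of the cylinder is a choice; all that is used is that it is one
  of the two unit normals.\<close>

lemma side_cylinder_normal:
  assumes "p \<in> C"
  obtains n where "face_frame C g p n" "side_cylinder (F p) = {x + t *\<^sub>R n | x t. x \<in> F p \<and> 0 \<le> t \<and> t \<le> 1}"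
proof -
  define n where "n = (SOME n. norm n = 1 \<and> (\<forall>x\<in>F p. \<forall>y\<in>F p. n \<bullet> (x - y) = 0))"
  have "norm n = 1 \<and> (\<forall>x\<in>F p. \<forall>y\<in>F p. n \<bullet> (x - y) = 0)" unfolding n_def
  proof (rule someI)
    show "norm (g p /\<^sub>R norm (g p)) = 1 \<and> (\<forall>x\<in>F p. \<forall>y\<in>F p. (g p /\<^sub>R norm (g p)) \<bullet> (x - y) = 0)"
      using grad_nonzero[OF assms] grad_orthogonal_F[OF assms] by simp
  qed
  then have "face_frame C g p n" using assms by unfold_locales auto
  moreover have "side_cylinder (F p) = {x + t *\<^sub>R n | x t. x \<in> F p \<and> 0 \<le> t \<and> t \<le> 1}"
    unfolding side_cylinder_def n_def[symmetric] Let_def ..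
  ultimately show ?thesis using that by blast
qed

end

lemma (in face_frame) side_measure_eq:
  assumes "side_cylinder (F p) = cyl"
  shows "side_measure (F p) = completion (distr (restrict_space lborel cyl) borel proj)"
proof -
  have "closest_point (affine hull (F p)) = proj" using proj_closest_point by (rule ext)
  then show ?thesis using assms by (simp only: side_measure_def)
qed

context frame
begin

lemma sets_side_measure: "A \<in> sets borel \<Longrightarrow> A \<in> sets (side_measure S)"
  by (simp add: side_measure_def)

lemma emeasure_side_measure:
  assumes p: "p \<in> C"
  shows "emeasure (side_measure (F p)) (rel_interior (F p)) = ennreal (face_area p)"
    and "emeasure (side_measure (F p)) (- rel_interior (F p)) = 0"
    and "emeasure (side_measure (F p)) UNIV = ennreal (face_area p)"
proof -
  obtain n where n: "face_frame C g p n" "side_cylinder (F p) = {x + t *\<^sub>R n | x t. x \<in> F p \<and> 0 \<le> t \<and> t \<le> 1}"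
    using side_cylinder_normal[OF p] .
  interpret ff: face_frame C g p n by (rule n(1))
  note S = ff.side_measure_eq[OF n(2)[folded ff.cyl_def]]
  have bc: "ff.cyl \<in> sets borel" using ff.compact_cyl by (rule borel_compact)
  have br: "rel_interior (F p) \<in> sets borel" by (rule ff.borel_rel_interior_F)
  have pm: "ff.proj \<in> measurable (restrict_space lborel ff.cyl) borel"
    by (rule measurable_restrict_space1) (use ff.continuous_proj in \<open>auto intro: borel_measurable_continuous_onI\<close>)
  have em: "emeasure (side_measure (F p)) A = emeasure lborel (ff.proj -` A \<inter> ff.cyl)" if A: "A \<in> sets borel" for A
  proof -
    have "emeasure (side_measure (F p)) A = emeasure (restrict_space lborel ff.cyl) (ff.proj -` A \<inter> space (restrict_space lborel ff.cyl))"
      unfolding S using A pm by (simp add: emeasure_distr)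
    also have "space (restrict_space lborel ff.cyl) = ff.cyl" by (simp add: space_restrict_space)
    also have "emeasure (restrict_space lborel ff.cyl) (ff.proj -` A \<inter> ff.cyl) = emeasure lborel (ff.proj -` A \<inter> ff.cyl)"
      by (rule emeasure_restrict_space) (use bc in auto)
    finally show ?thesis .
  qed
  show 2: "emeasure (side_measure (F p)) (- rel_interior (F p)) = 0"
  proof -
    have "emeasure (side_measure (F p)) (- rel_interior (F p)) = emeasure lborel (ff.proj -` (- rel_interior (F p)) \<inter> ff.cyl)"
      by (rule em) (use br in auto)
    also have "ff.proj -` (- rel_interior (F p)) \<inter> ff.cyl = {y \<in> ff.cyl. ff.proj y \<notin> rel_interior (F p)}" by auto
    finally show ?thesis by (simp only: ff.negligible_over_relative_boundary)
  qed
  show 3: "emeasure (side_measure (F p)) UNIV = ennreal (face_area p)"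
  proof -
    have "emeasure (side_measure (F p)) UNIV = emeasure lborel ff.cyl" using em[of UNIV] by simp
    also have "\<dots> = ennreal (measure lborel ff.cyl)"
      by (rule emeasure_eq_ennreal_measure) (use emeasure_compact_finite[OF ff.compact_cyl] in auto)
    finally show ?thesis by (simp only: ff.measure_cyl face_area_def)
  qed
  have "emeasure (side_measure (F p)) (rel_interior (F p) \<union> - rel_interior (F p))
      = emeasure (side_measure (F p)) (rel_interior (F p)) + emeasure (side_measure (F p)) (- rel_interior (F p))"
    by (rule plus_emeasure[symmetric]) (use br in \<open>auto intro!: sets_side_measure\<close>)
  then show "emeasure (side_measure (F p)) (rel_interior (F p)) = ennreal (face_area p)"
    using 2 3 by simp
qed

text \<open>The projection maps the cylinder to the side, and the mean over the cylinder is already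
  known.\<close>

lemma side_avg_affine:
  assumes p: "p \<in> C" and v: "\<And>x. x \<in> F p \<Longrightarrow> v x = G \<bullet> x + c"
  shows "side_avg (F p) v = G \<bullet> face_barycentre p + c"
proof -
  obtain n where n: "face_frame C g p n" "side_cylinder (F p) = {x + t *\<^sub>R n | x t. x \<in> F p \<and> 0 \<le> t \<and> t \<le> 1}"
    using side_cylinder_normal[OF p] .
  interpret ff: face_frame C g p n by (rule n(1))
  note S = ff.side_measure_eq[OF n(2)[folded ff.cyl_def]]
  have bc: "ff.cyl \<in> sets borel" using ff.compact_cyl by (rule borel_compact)
  have bF[measurable]: "F p \<in> sets borel" using compact_F by (rule borel_compact)
  have mp: "ff.proj \<in> borel_measurable borel" using ff.continuous_proj by (auto intro: borel_measurable_continuous_onI)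
  have pm: "ff.proj \<in> measurable (restrict_space lborel ff.cyl) borel"
    by (rule measurable_restrict_space1) (use mp in auto)
  have "(LINT x:F p|side_measure (F p). v x) = (LINT x|side_measure (F p). indicator (F p) x *\<^sub>R (G \<bullet> x + c))"
    unfolding set_lebesgue_integral_def
    by (intro Bochner_Integration.integral_cong refl) (auto simp: v indicator_def)
  also have "\<dots> = (LINT x|distr (restrict_space lborel ff.cyl) borel ff.proj. indicator (F p) x *\<^sub>R (G \<bullet> x + c))"
    unfolding S by (rule integral_completion) simp
  also have "\<dots> = (LINT y|restrict_space lborel ff.cyl. indicator (F p) (ff.proj y) *\<^sub>R (G \<bullet> ff.proj y + c))"
    by (rule integral_distr[OF pm]) simp
  also have "\<dots> = (LINT y:ff.cyl|lborel. indicator (F p) (ff.proj y) *\<^sub>R (G \<bullet> ff.proj y + c))"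
    unfolding set_lebesgue_integral_def by (rule integral_restrict_space) (use bc in simp)
  also have "\<dots> = (LINT y:ff.cyl|lborel. G \<bullet> ff.proj y + c)"
    by (rule set_lebesgue_integral_cong) (use bc ff.cyl_iff in auto)
  also have "\<dots> = face_area p * (G \<bullet> face_barycentre p + c)"
    unfolding ff.integral_cyl ff.measure_cyl face_area_def ..
  finally have 1: "(LINT x:F p|side_measure (F p). v x) = face_area p * (G \<bullet> face_barycentre p + c)" .
  have "emeasure (side_measure (F p)) (F p) = ennreal (face_area p)"
  proof (rule antisym)
    show "emeasure (side_measure (F p)) (F p) \<le> ennreal (face_area p)"
      unfolding emeasure_side_measure(3)[OF p, symmetric]
      by (intro emeasure_mono sets_side_measure) auto
    show "ennreal (face_area p) \<le> emeasure (side_measure (F p)) (F p)"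
      unfolding emeasure_side_measure(1)[OF p, symmetric]
      by (intro emeasure_mono sets_side_measure bF rel_interior_subset)
  qed
  then have "measure (side_measure (F p)) (F p) = face_area p"
    using face_area_pos[OF p] by (simp add: measure_def)
  then show ?thesis using 1 face_area_pos[OF p] by (simp add: side_avg_def)
qed

end

section \<open>Affine functions on a simplex\<close>

text \<open>Discrete functions are arbitrary on null sets, and so they are measurable only for complete
  measures.\<close>

lemma borel_measurable_completion_AE:
  fixes f g :: "'a \<Rightarrow> 'b::topological_space"
  assumes g: "g \<in> borel_measurable (completion M)" and ae: "AE x in completion M. f x = g x"
  shows "f \<in> borel_measurable (completion M)"
proof (rule measurableI)
  fix A :: "'b set" assume A: "A \<in> sets borel"
  have "g -` A \<inter> space (completion M) \<in> sets (completion M)" using g A by (rule measurable_sets)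
  moreover have "AE x in completion M. x \<in> g -` A \<inter> space (completion M) \<longleftrightarrow> x \<in> f -` A \<inter> space (completion M)"
    using ae by eventually_elim auto
  ultimately show "f -` A \<inter> space (completion M) \<in> sets (completion M)"
    using completion.in_sets_AE by blast
qed simp

lemma integral_completion_cong_AE:
  fixes f g :: "'a \<Rightarrow> 'b::{banach, second_countable_topology}"
  assumes "g \<in> borel_measurable (completion M)" "AE x in completion M. f x = g x"
  shows "integral\<^sup>L (completion M) f = integral\<^sup>L (completion M) g"
  using borel_measurable_completion_AE[OF assms] assms by (intro integral_cong_AE)

context frame
begin

lemma skeleton_null: "T - interior T \<in> null_sets lebesgue"
proof -
  have "negligible (T - interior T)"
    using negligible_convex_frontier[of T] compact_imp_closed[OF compact_T]
    by (simp add: frontier_def closure_closed)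
  then show ?thesis by (simp add: negligible_iff_null_sets)
qed

lemma measure_T_lebesgue: "measure lebesgue T = measure lborel T"
  using compact_T by (simp add: borel_compact)

text \<open>The function \<open>w\<close> is prescribed only in the interior; the remainder of the
  simplex is a null set.\<close>

lemma lebesgue_integral_T:
  fixes w :: "'a \<Rightarrow> 'b::euclidean_space"
  assumes A: "linear A" and w: "\<And>x. x \<in> interior T \<Longrightarrow> w x = A x + c"
  shows "(LINT z:T|lebesgue. w z) = measure lborel T *\<^sub>R (A barycentre + c)"
proof -
  have contA: "continuous_on S A" for S
    using A by (intro linear_continuous_on) (simp add: linear_conv_bounded_linear)
  have int: "integrable lborel (\<lambda>z. indicator T z *\<^sub>R (A z + c))"
    using compact_T by (intro borel_integrable_compact) (auto intro!: continuous_intros contA)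
  have "(LINT z:T|lebesgue. w z) = (LINT z|lebesgue. indicator T z *\<^sub>R (A z + c))"
    unfolding set_lebesgue_integral_def
  proof (rule integral_completion_cong_AE)
    show "(\<lambda>z. indicator T z *\<^sub>R (A z + c)) \<in> borel_measurable lebesgue"
      using int by (intro measurable_completion) auto
    have "AE z in lebesgue. z \<notin> T - interior T" using skeleton_null by (rule AE_not_in)
    then show "AE z in lebesgue. indicator T z *\<^sub>R w z = indicator T z *\<^sub>R (A z + c)"
      by eventually_elim (auto simp: indicator_def w)
  qed
  also have "\<dots> = (LINT z|lborel. indicator T z *\<^sub>R (A z + c))"
    using int by (intro integral_completion) auto
  also have "\<dots> = measure lborel T *\<^sub>R (A barycentre + c)"
  proof (rule euclidean_eqI)
    fix b :: 'b assume b: "b \<in> Basis"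
    have "(LINT z|lborel. indicator T z *\<^sub>R (A z + c)) \<bullet> b = (LINT z|lborel. (indicator T z *\<^sub>R (A z + c)) \<bullet> b)"
      using int by (rule integral_inner_left[symmetric])
    also have "\<dots> = (LINT z:T|lborel. adjoint A b \<bullet> z + c \<bullet> b)"
      unfolding set_lebesgue_integral_def
      by (intro Bochner_Integration.integral_cong refl)
         (simp add: inner_add_left inner_add_right adjoint_works[OF A] inner_commute[of _ b] inner_commute[of "adjoint A b"])
    also have "\<dots> = measure lborel T * (adjoint A b \<bullet> barycentre + c \<bullet> b)" by (rule integral_T)
    also have "\<dots> = (measure lborel T *\<^sub>R (A barycentre + c)) \<bullet> b"
      by (simp add: inner_add_left inner_commute[of "adjoint A b"] adjoint_works[OF A])
    finally show "(LINT z|lborel. indicator T z *\<^sub>R (A z + c)) \<bullet> b = (measure lborel T *\<^sub>R (A barycentre + c)) \<bullet> b" .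
  qed
  finally show ?thesis .
qed

lemma elem_trace_affine:
  fixes w :: "'a \<Rightarrow> 'b::euclidean_space"
  assumes A: "linear A" and w: "\<And>x. x \<in> interior T \<Longrightarrow> w x = A x + c" and x: "x \<in> T"
  shows "elem_trace T w x = A x + c"
proof -
  have contA: "continuous_on UNIV A"
    using A by (intro linear_continuous_on) (simp add: linear_conv_bounded_linear)
  have cl: "closure (interior T) = T"
  proof -
    have "convex T" "interior T \<noteq> {}" "closed T" using barycentre_interior compact_T by (auto intro: compact_imp_closed)
    then show ?thesis using convex_closure_interior[of T] by (simp add: closure_closed)
  qed
  have "x islimpt interior T"
  proof (cases "x \<in> interior T")
    case True then show ?thesis by (intro interior_limit_point) (simp add: interior_interior)
  next
    case False then show ?thesis using x cl by (metis closure_def Un_iff mem_Collect_eq)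
  qed
  then have nt: "at x within interior T \<noteq> bot" by (simp add: trivial_limit_within)
  have "((\<lambda>y. A y + c) \<longlongrightarrow> A x + c) (at x within interior T)"
    using contA by (intro tendsto_intros) (meson UNIV_I continuous_on_def subset_UNIV tendsto_within_subset)
  then have "(w \<longlongrightarrow> A x + c) (at x within interior T)"
    by (rule Lim_transform_within[of _ _ _ _ 1]) (auto simp: w)
  then show ?thesis unfolding elem_trace_def using nt by (intro tendsto_Lim)
qed

lemma gradient_affine:
  assumes v: "\<And>x. x \<in> interior T \<Longrightarrow> v x = G \<bullet> x + c" and x: "x \<in> interior T"
  shows "(THE D. GDERIV v x :> D) = G"
proof -
  have "((\<lambda>x. G \<bullet> x + c) has_derivative (\<lambda>h. G \<bullet> h)) (at x)"
    by (auto intro!: derivative_eq_intros)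
  then have d: "(v has_derivative (\<lambda>h. G \<bullet> h)) (at x)"
    by (rule has_derivative_transform_within_open[OF _ open_interior x]) (simp add: v)
  show ?thesis
  proof (rule the_equality)
    show "GDERIV v x :> G" using d by (simp add: gderiv_def inner_commute)
    fix D assume "GDERIV v x :> D"
    then have "(v has_derivative (\<lambda>h. h \<bullet> D)) (at x)" by (simp add: gderiv_def)
    then have "(\<lambda>h. h \<bullet> D) = (\<lambda>h. G \<bullet> h)" using d by (rule has_derivative_unique)
    then have "(D - G) \<bullet> D = (D - G) \<bullet> G" by (metis inner_commute)
    then have "(D - G) \<bullet> (D - G) = 0" by (simp add: inner_diff_right)
    then show "D = G" by simp
  qed
qed

lemma frechet_derivative_affine:
  fixes w :: "'a \<Rightarrow> 'b::euclidean_space"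
  assumes A: "linear A" and w: "\<And>x. x \<in> interior T \<Longrightarrow> w x = A x + c" and x: "x \<in> interior T"
  shows "frechet_derivative w (at x) = A"
proof -
  have "bounded_linear A" using A by (simp add: linear_conv_bounded_linear)
  then have "((\<lambda>x. A x + c) has_derivative A) (at x)"
    by (auto intro!: derivative_eq_intros bounded_linear_imp_has_derivative)
  then have "(w has_derivative A) (at x)"
    by (rule has_derivative_transform_within_open[OF _ open_interior x]) (simp add: w)
  then show ?thesis by (rule frechet_derivative_at[symmetric])
qed

text \<open>The Gauss theorem for an affine function and a field with constant normal component on every
  side, in barycentric form. Let \<open>q p = p - barycentre\<close>, and use
  \<open>\<bar>S\<^sub>p\<bar> n\<^sub>p = - d \<bar>T\<bar> g p\<close>. Since \<open>\<Sum>p. g p =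
  0\<close> and \<open>\<Sum>p. q p = 0\<close> and \<open>\<Sum>p. (g p \<bullet> w) q p = w\<close>,
  the sum over the sides reduces to the right-hand side plus a multiple of \<open>\<Sum>p. (g p
  \<bullet> A (q p)) (G \<bullet> q p)\<close>. That term vanishes because constant normal components
  make \<open>g p \<bullet> A (q p)\<close> independent of \<open>p\<close>.\<close>

lemma gauss_simplex:
  fixes A :: "'a \<Rightarrow> 'a"
  assumes A: "linear A"
    and flux: "\<And>p. p \<in> C \<Longrightarrow> \<exists>c. \<forall>x\<in>F p. (A x + a) \<bullet> outer_normal T (F p) = c"
  shows "(\<Sum>p\<in>C. face_area p * ((A (face_barycentre p) + a) \<bullet> outer_normal T (F p)) * (G \<bullet> face_barycentre p + e))
    = measure lborel T * ((A barycentre + a) \<bullet> G + (\<Sum>b\<in>Basis. A b \<bullet> b) * (G \<bullet> barycentre + e))"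
proof -
  define d where "d = real DIM('a)"
  have d: "d > 0" by (simp add: d_def)
  define m where "m = measure lborel T"
  define q where "q = (\<lambda>p. p - barycentre)"
  define \<tau> where "\<tau> = (\<Sum>b\<in>Basis. A b \<bullet> b)"
  define \<beta> where "\<beta> = (\<lambda>p. g p \<bullet> A (q p))"
  have lin: "A (x + y) = A x + A y" "A (x - y) = A x - A y" "A (t *\<^sub>R x) = t *\<^sub>R A x" for x y t
    using A by (simp_all add: linear_add linear_diff linear_scale)
  have sumq: "(\<Sum>p\<in>C. q p) = 0"
    by (simp add: q_def sum_subtractf card barycentre_def sum_constant_scaleR del: of_nat_Suc)
  have sumgw: "(\<Sum>p\<in>C. g p \<bullet> w) = 0" for w
    using sum_grad by (simp flip: inner_sum_left)
  have expq: "(\<Sum>p\<in>C. (g p \<bullet> w) *\<^sub>R q p) = w" for w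
  proof -
    have "(\<Sum>p\<in>C. (g p \<bullet> w) *\<^sub>R q p) = (\<Sum>p\<in>C. (g p \<bullet> w) *\<^sub>R p) - (\<Sum>p\<in>C. g p \<bullet> w) *\<^sub>R barycentre"
      by (simp add: q_def scaleR_diff_right sum_subtractf scaleR_sum_left)
    then show ?thesis by (simp add: sumgw grad_expand)
  qed
  have trace: "(\<Sum>p\<in>C. \<beta> p) = \<tau>"
  proof -
    have "A b \<bullet> b = (\<Sum>p\<in>C. (g p \<bullet> b) * (A (q p) \<bullet> b))" for b
    proof -
      have "A b = A (\<Sum>p\<in>C. (g p \<bullet> b) *\<^sub>R q p)" by (simp add: expq)
      also have "\<dots> = (\<Sum>p\<in>C. (g p \<bullet> b) *\<^sub>R A (q p))"
        using A by (simp add: linear_sum lin(3) o_def)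
      finally show ?thesis by (simp add: inner_sum_left)
    qed
    then have "\<tau> = (\<Sum>b\<in>Basis. \<Sum>p\<in>C. (g p \<bullet> b) * (A (q p) \<bullet> b))" by (simp add: \<tau>_def)
    also have "\<dots> = (\<Sum>p\<in>C. \<Sum>b\<in>Basis. (g p \<bullet> b) * (A (q p) \<bullet> b))" by (rule sum.swap)
    also have "\<dots> = (\<Sum>p\<in>C. \<beta> p)" by (simp add: \<beta>_def euclidean_inner[symmetric])
    finally show ?thesis ..
  qed
  \<comment> \<open>Row sums of the matrix \<open>g p \<bullet> A (q r)\<close> vanish and its off-diagonal entries in a row agree.\<close>
  have offdiag: "g p \<bullet> A (q r) = - \<beta> p / d" if p: "p \<in> C" and r: "r \<in> C" "r \<noteq> p" for p r
  proof -
    have eq: "g p \<bullet> A (q s) = g p \<bullet> A (q r)" if s: "s \<in> C" "s \<noteq> p" for s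
    proof -
      obtain c where c: "\<forall>x\<in>F p. (A x + a) \<bullet> outer_normal T (F p) = c" using flux[OF p] by blast
      have "s \<in> F p" "r \<in> F p" using s r by (auto intro: hull_inc)
      then have "(A s + a) \<bullet> outer_normal T (F p) = (A r + a) \<bullet> outer_normal T (F p)" using c by metis
      then have "g p \<bullet> (A s + a) = g p \<bullet> (A r + a)"
        using grad_nonzero[OF p] by (simp add: outer_normal_F[OF p] inner_commute)
      then have "g p \<bullet> A s = g p \<bullet> A r" by (simp add: inner_add_right)
      then show ?thesis by (simp add: q_def lin inner_diff_right)
    qed
    have "0 = g p \<bullet> A (\<Sum>s\<in>C. q s)" using A by (simp add: sumq linear_0)
    also have "\<dots> = (\<Sum>s\<in>C. g p \<bullet> A (q s))" using A by (simp add: linear_sum inner_sum_right)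
    also have "\<dots> = \<beta> p + (\<Sum>s\<in>C - {p}. g p \<bullet> A (q s))" by (simp add: sum_remove[OF p] \<beta>_def)
    also have "(\<Sum>s\<in>C - {p}. g p \<bullet> A (q s)) = (\<Sum>s\<in>C - {p}. g p \<bullet> A (q r))"
      by (intro sum.cong refl eq) auto
    also have "\<dots> = d * (g p \<bullet> A (q r))" by (simp add: card_diff[OF p] d_def)
    finally show ?thesis using d by (simp add: field_simps)
  qed
  \<comment> \<open>Column sums vanish too, which makes all diagonal entries equal.\<close>
  have \<beta>: "\<beta> r = \<tau> / (d + 1)" if r: "r \<in> C" for r
  proof -
    have "0 = (\<Sum>p\<in>C. g p \<bullet> A (q r))" by (simp add: sumgw)
    also have "\<dots> = \<beta> r + (\<Sum>p\<in>C - {r}. g p \<bullet> A (q r))" by (simp add: sum_remove[OF r] \<beta>_def)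
    also have "(\<Sum>p\<in>C - {r}. g p \<bullet> A (q r)) = (\<Sum>p\<in>C - {r}. - \<beta> p / d)"
      using r by (intro sum.cong refl offdiag) auto
    also have "\<dots> = - (\<tau> - \<beta> r) / d"
    proof -
      have "sum \<beta> (C - {r}) = \<tau> - \<beta> r" using trace sum_remove[OF r, of \<beta>] by linarith
      then show ?thesis by (simp only: sum_negf sum_divide_distrib[symmetric])
    qed
    finally show ?thesis using d by (simp add: field_simps)
  qed
  define a' where "a' = A barycentre + a"
  define v' where "v' = G \<bullet> barycentre + e"
  have summand: "face_area p * ((A (face_barycentre p) + a) \<bullet> outer_normal T (F p)) * (G \<bullet> face_barycentre p + e)
      = - d * m * ((g p \<bullet> a') * v' - (g p \<bullet> a') * (G \<bullet> q p) / d - (\<tau> / (d + 1)) / d * v' + (\<tau> / (d + 1)) / d / d * (G \<bullet> q p))"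
    if p: "p \<in> C" for p
  proof -
    have fc: "face_barycentre p = barycentre - (1 / d) *\<^sub>R q p" by (simp add: face_barycentre_eq[OF p] d_def q_def)
    have "face_area p * ((A (face_barycentre p) + a) \<bullet> outer_normal T (F p)) = - d * m * (g p \<bullet> (A (face_barycentre p) + a))"
      using grad_nonzero[OF p] by (simp add: outer_normal_F[OF p] face_area_def d_def m_def inner_commute)
    also have "g p \<bullet> (A (face_barycentre p) + a) = g p \<bullet> a' - (\<tau> / (d + 1)) / d"
      using \<beta>[OF p] by (simp add: fc lin a'_def inner_add_right inner_diff_right \<beta>_def)
    finally have 1: "face_area p * ((A (face_barycentre p) + a) \<bullet> outer_normal T (F p)) = - d * m * (g p \<bullet> a' - (\<tau> / (d + 1)) / d)" .
    have 2: "G \<bullet> face_barycentre p + e = v' - (G \<bullet> q p) / d" by (simp add: fc v'_def inner_diff_right)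
    have "(X - K) * (v' - Q / d) = X * v' - X * Q / d - K * v' + K / d * Q" for X K Q
      using d by (simp add: field_simps)
    then show ?thesis unfolding 1 2 by (simp only: mult.assoc[of "- d * m"])
  qed
  have "(\<Sum>p\<in>C. face_area p * ((A (face_barycentre p) + a) \<bullet> outer_normal T (F p)) * (G \<bullet> face_barycentre p + e))
    = - d * m * ((\<Sum>p\<in>C. g p \<bullet> a') * v' - (\<Sum>p\<in>C. (g p \<bullet> a') * (G \<bullet> q p)) / d
      - real (card C) * ((\<tau> / (d + 1)) / d * v') + (\<tau> / (d + 1)) / d / d * (\<Sum>p\<in>C. G \<bullet> q p))"
    by (simp only: sum.cong[OF refl summand] sum_distrib_left[symmetric] sum.distrib sum_subtractf
        sum_distrib_right[symmetric] sum_divide_distrib[symmetric] sum_constant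
        mult.left_commute[of "real (card C)"])
  also have "(\<Sum>p\<in>C. (g p \<bullet> a') * (G \<bullet> q p)) = G \<bullet> a'"
  proof -
    have "G \<bullet> (\<Sum>p\<in>C. (g p \<bullet> a') *\<^sub>R q p) = (\<Sum>p\<in>C. (g p \<bullet> a') * (G \<bullet> q p))"
      by (simp add: inner_sum_right)
    then show ?thesis by (simp add: expq)
  qed
  also have "(\<Sum>p\<in>C. G \<bullet> q p) = 0" by (simp add: inner_sum_right[symmetric] sumq)
  also have "real (card C) = d + 1" by (simp add: card d_def)
  also have "(\<Sum>p\<in>C. g p \<bullet> a') = 0" by (rule sumgw)
  also have "- d * m * (0 * v' - G \<bullet> a' / d - (d + 1) * ((\<tau> / (d + 1)) / d * v') + (\<tau> / (d + 1)) / d / d * 0)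
      = m * (a' \<bullet> G + \<tau> * v')"
  proof -
    have "(d + 1) * ((\<tau> / (d + 1)) / d * v') = \<tau> * v' / d" using d by simp
    then show ?thesis using d by (simp add: inner_commute[of G] right_diff_distrib distrib_left)
  qed
  finally show ?thesis by (simp add: m_def a'_def \<tau>_def v'_def)
qed

end

section \<open>Degrees of freedom on a simplex\<close>

text \<open>Centroids are introduced as averages, so that they do not refer to a choice of vertices. In
  particular, the two elements at an interior side share its centroid.\<close>

definition centroid :: "'a::euclidean_space set \<Rightarrow> 'a" where
  "centroid T = (1 / measure lebesgue T) *\<^sub>R (LINT x:T|lebesgue. x)"

definition side_centroid :: "'a::euclidean_space set \<Rightarrow> 'a" where
  "side_centroid S = (\<Sum>b\<in>Basis. side_avg S (\<lambda>x. b \<bullet> x) *\<^sub>R b)"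

definition side_area :: "'a::euclidean_space set \<Rightarrow> real" where
  "side_area S = measure (side_measure S) UNIV"

text \<open>For a Raviart-Thomas field this is the constant normal component on the side
  \<open>S\<close> of \<open>T\<close>.\<close>

definition flux :: "('a::euclidean_space \<Rightarrow> 'a) \<Rightarrow> 'a set \<Rightarrow> 'a set \<Rightarrow> real" where
  "flux y T S = elem_trace T y (side_centroid S) \<bullet> outer_normal T S"

lemma simplex_frame:
  fixes T :: "'a::euclidean_space set"
  assumes "int DIM('a) simplex T"
  obtains C g where "frame C g" "T = convex hull C"
proof -
  obtain C where C: "\<not> affine_dependent C" "int (card C) = int DIM('a) + 1" "T = convex hull C"
    using assms by (auto simp: simplex_def)
  then have "card C = Suc DIM('a)" by linarith
  then show ?thesis using frame_exists[OF C(1)] C(3) that by blast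
qed

context frame
begin

lemma centroid_T: "centroid T = barycentre"
proof -
  have "(LINT x:T|lebesgue. x) = measure lborel T *\<^sub>R (id barycentre + 0)"
    by (rule lebesgue_integral_T) (auto simp: linear_iff)
  then show ?thesis using measure_T_pos by (simp add: centroid_def measure_T_lebesgue)
qed

lemma side_centroid_F: "p \<in> C \<Longrightarrow> side_centroid (F p) = face_barycentre p"
proof -
  assume p: "p \<in> C"
  have "side_avg (F p) (\<lambda>x. b \<bullet> x) = b \<bullet> face_barycentre p" for b
    using side_avg_affine[OF p, of "\<lambda>x. b \<bullet> x" b 0] by simp
  then show ?thesis by (simp add: side_centroid_def euclidean_representation inner_commute[of _ "face_barycentre p"])
qed

lemma side_area_F: "p \<in> C \<Longrightarrow> side_area (F p) = face_area p"
  using emeasure_side_measure(3)[of p] face_area_pos[of p] by (simp add: side_area_def measure_def)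

lemma facet_sum: "(\<Sum>S | S facet_of T. h S) = (\<Sum>p\<in>C. h (F p))"
proof -
  have "{S. S facet_of T} = F ` C" using facet_iff by auto
  moreover have "inj_on F C" by (rule inj_onI) (simp add: F_inj)
  ultimately show ?thesis by (simp add: sum.reindex)
qed

text \<open>A small step against the outer normal makes the vanishing coordinate positive and keeps the
  others positive.\<close>

lemma inward_of_side:
  assumes p: "p \<in> C" and x: "x \<in> rel_interior (F p)"
  shows "\<forall>\<^sub>F \<epsilon> in at_right 0. x - \<epsilon> *\<^sub>R outer_normal T (F p) \<in> interior T"
proof -
  let ?n = "outer_normal T (F p)"
  have "\<forall>q\<in>C. \<forall>\<^sub>F \<epsilon> in at_right 0. 0 < bary q (x - \<epsilon> *\<^sub>R ?n)"
  proof
    fix q assume q: "q \<in> C"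
    show "\<forall>\<^sub>F \<epsilon> in at_right 0. 0 < bary q (x - \<epsilon> *\<^sub>R ?n)"
    proof (cases "q = p")
      case True
      have "bary p (x - \<epsilon> *\<^sub>R ?n) = \<epsilon> * norm (g p)" for \<epsilon>
      proof -
        have "bary p (x - \<epsilon> *\<^sub>R ?n) - bary p x = - \<epsilon> * (g p \<bullet> ?n)" unfolding bary_diff by simp
        also have "g p \<bullet> ?n = - norm (g p)"
          using grad_nonzero[OF p] by (simp add: outer_normal_F[OF p] dot_square_norm power2_eq_square)
        finally show ?thesis using x rel_interior_F_iff[OF p] by simp
      qed
      moreover have "0 < norm (g p)" using grad_nonzero[OF p] by simp
      ultimately show ?thesis using True
        by (intro eventually_mono[OF eventually_at_right_less[of 0]]) simp
    next
      case False
      have "((\<lambda>\<epsilon>. bary q (x - \<epsilon> *\<^sub>R ?n)) \<longlongrightarrow> bary q (x - 0 *\<^sub>R ?n)) (at_right 0)"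
        unfolding bary_def by (intro tendsto_intros)
      moreover have "0 < bary q (x - 0 *\<^sub>R ?n)" using x rel_interior_F_iff[OF p] q False by auto
      ultimately show ?thesis by (rule order_tendstoD)
    qed
  qed
  then have "\<forall>\<^sub>F \<epsilon> in at_right 0. \<forall>q\<in>C. 0 < bary q (x - \<epsilon> *\<^sub>R ?n)"
    using fin by (simp add: eventually_ball_finite)
  then show ?thesis by (simp add: interior_iff)
qed

lemma outward_of_side:
  assumes p: "p \<in> C" and x: "x \<in> rel_interior (F p)" and e: "\<epsilon> > 0"
  shows "x + \<epsilon> *\<^sub>R outer_normal T (F p) \<notin> T"
proof -
  have "bary p (x + \<epsilon> *\<^sub>R outer_normal T (F p)) - bary p x = \<epsilon> * (g p \<bullet> outer_normal T (F p))"
    unfolding bary_diff by simp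
  also have "g p \<bullet> outer_normal T (F p) = - norm (g p)"
    using grad_nonzero[OF p] by (simp add: outer_normal_F[OF p] dot_square_norm power2_eq_square)
  also have "bary p x = 0" using x rel_interior_F_iff[OF p] by simp
  finally have "bary p (x + \<epsilon> *\<^sub>R outer_normal T (F p)) = - (\<epsilon> * norm (g p))" by simp
  moreover have "0 < \<epsilon> * norm (g p)" using e grad_nonzero[OF p] by simp
  ultimately show ?thesis using p by (force simp: T_iff)
qed

lemma norm_outer_normal: "p \<in> C \<Longrightarrow> norm (outer_normal T (F p)) = 1"
  using grad_nonzero by (simp add: outer_normal_F)

lemma half_ball_at_side:
  assumes p: "p \<in> C" and x: "x \<in> rel_interior (F p)"
  shows "\<exists>e>0. \<forall>y\<in>ball x e. outer_normal T (F p) \<bullet> (y - x) \<le> 0 \<longrightarrow> y \<in> T"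
proof -
  have "open {y. 0 < bary q y}" for q unfolding bary_def by (intro open_Collect_less continuous_intros)
  then have "open (\<Inter>q\<in>C - {p}. {y. 0 < bary q y})" using fin by (intro open_INT) auto
  moreover have "x \<in> (\<Inter>q\<in>C - {p}. {y. 0 < bary q y})" using x rel_interior_F_iff[OF p] by auto
  ultimately obtain e where e: "e > 0" "ball x e \<subseteq> (\<Inter>q\<in>C - {p}. {y. 0 < bary q y})"
    using open_contains_ball by metis
  have "y \<in> T" if y: "y \<in> ball x e" "outer_normal T (F p) \<bullet> (y - x) \<le> 0" for y
  proof -
    have "0 < inverse (norm (g p))" using grad_nonzero[OF p] by simp
    moreover have "0 \<le> inverse (norm (g p)) * (g p \<bullet> (y - x))" using y(2) by (simp add: outer_normal_F[OF p])
    ultimately have "0 \<le> g p \<bullet> (y - x)" by (simp add: zero_le_mult_iff)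
    then have "0 \<le> bary p y" using x rel_interior_F_iff[OF p] bary_diff[of p y x] by simp
    moreover have "0 \<le> bary q y" if "q \<in> C" "q \<noteq> p" for q
    proof -
      have "y \<in> (\<Inter>q\<in>C - {p}. {y. 0 < bary q y})" using e(2) y(1) by blast
      then show ?thesis using that by (auto intro: less_imp_le)
    qed
    ultimately show ?thesis unfolding T_iff by metis
  qed
  then show ?thesis using e(1) by blast
qed

end

lemma gauss_element:
  fixes T :: "'a::euclidean_space set" and v :: "'a \<Rightarrow> real" and y :: "'a \<Rightarrow> 'a"
  assumes T: "int DIM('a) simplex T"
    and v: "\<And>x. x \<in> interior T \<Longrightarrow> v x = G \<bullet> x + e"
    and A: "linear A" and y: "\<And>x. x \<in> interior T \<Longrightarrow> y x = A x + a"
    and const: "\<And>S. S facet_of T \<Longrightarrow> \<exists>c. \<forall>x\<in>S. elem_trace T y x \<bullet> outer_normal T S = c"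
  shows "(\<Sum>S | S facet_of T. side_area S * flux y T S * elem_trace T v (side_centroid S))
    = measure lebesgue T * (y (centroid T) \<bullet> G + (\<Sum>b\<in>Basis. A b \<bullet> b) * v (centroid T))"
proof -
  obtain C g where "frame C g" and TC: "T = convex hull C" using simplex_frame[OF T] .
  then interpret frame C g by simp
  have ty: "elem_trace T y x = A x + a" if "x \<in> T" for x
    using elem_trace_affine[OF A, of y a x] y that unfolding TC by blast
  have tv: "elem_trace T v x = G \<bullet> x + e" if "x \<in> T" for x
  proof -
    have "linear (\<lambda>x. G \<bullet> x)" by (auto intro!: linearI simp: inner_add_right)
    from elem_trace_affine[OF this, of v e x] show ?thesis using v that unfolding TC by blast
  qed
  have c: "centroid T = barycentre" "barycentre \<in> interior T" using centroid_T barycentre_interior by (simp_all add: TC)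
  have "(\<Sum>S | S facet_of T. side_area S * flux y T S * elem_trace T v (side_centroid S))
      = (\<Sum>p\<in>C. face_area p * ((A (face_barycentre p) + a) \<bullet> outer_normal T (F p)) * (G \<bullet> face_barycentre p + e))"
    unfolding TC facet_sum
  proof (intro sum.cong refl)
    fix p assume p: "p \<in> C"
    have "face_barycentre p \<in> T" using face_barycentre_rel_interior[OF p] rel_interior_F_subset F_subset_T TC by blast
    then show "side_area (F p) * flux y (convex hull C) (F p) * elem_trace (convex hull C) v (side_centroid (F p))
        = face_area p * ((A (face_barycentre p) + a) \<bullet> outer_normal (convex hull C) (F p)) * (G \<bullet> face_barycentre p + e)"
      using p by (simp add: flux_def side_centroid_F side_area_F flip: TC) (simp add: ty tv)
  qed
  also have "\<dots> = measure lborel T * ((A barycentre + a) \<bullet> G + (\<Sum>b\<in>Basis. A b \<bullet> b) * (G \<bullet> barycentre + e))"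
    unfolding TC
  proof (rule gauss_simplex[OF A])
    fix p assume p: "p \<in> C"
    have "F p facet_of T" using p facet_iff TC by auto
    then obtain c where c: "\<forall>x\<in>F p. elem_trace T y x \<bullet> outer_normal T (F p) = c" using const by blast
    then have "\<forall>x\<in>F p. (A x + a) \<bullet> outer_normal T (F p) = c" using ty F_subset_T TC by (metis subsetD)
    then show "\<exists>c. \<forall>x\<in>F p. (A x + a) \<bullet> outer_normal (convex hull C) (F p) = c" unfolding TC by blast
  qed
  finally show ?thesis using measure_T_lebesgue c v y by (simp add: TC)
qed

section \<open>Combinatorics of the triangulation\<close>

text \<open>Near a boundary point the domain is a strict subgraph, so any neighbourhood of that point
  contains an open set above the graph, which misses the closure of the domain.\<close>

lemma interior_closure_lipschitz:
  fixes \<Omega> :: "'a::euclidean_space set"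
  assumes "lipschitz_domain \<Omega>"
  shows "interior (closure \<Omega>) = \<Omega>"
proof
  have op: "open \<Omega>" using assms by (simp add: lipschitz_domain_def)
  then show "\<Omega> \<subseteq> interior (closure \<Omega>)" by (simp add: closure_subset interior_maximal)
  show "interior (closure \<Omega>) \<subseteq> \<Omega>"
  proof (rule subsetI, rule ccontr)
    fix x assume x: "x \<in> interior (closure \<Omega>)" "x \<notin> \<Omega>"
    then have "x \<in> frontier \<Omega>" using op interior_subset by (auto simp: frontier_def interior_open)
    then obtain r e L \<gamma> where r: "r > 0" "norm e = 1" "L-lipschitz_on {y. y \<bullet> e = 0} \<gamma>"
        "\<Omega> \<inter> ball x r = {y \<in> ball x r. y \<bullet> e < \<gamma> (y - (y \<bullet> e) *\<^sub>R e)}"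
      using assms unfolding lipschitz_domain_def by blast
    have ee: "e \<bullet> e = 1" using r(2) by (simp add: dot_square_norm)
    \<comment> \<open>Near \<open>x\<close> the domain is where \<open>h\<close> is negative.\<close>
    define h where "h = (\<lambda>y. y \<bullet> e - \<gamma> (y - (y \<bullet> e) *\<^sub>R e))"
    have "continuous_on UNIV (\<gamma> \<circ> (\<lambda>y. y - (y \<bullet> e) *\<^sub>R e))"
    proof (rule continuous_on_compose)
      show "continuous_on ((\<lambda>y. y - (y \<bullet> e) *\<^sub>R e) ` UNIV) \<gamma>"
        using lipschitz_on_continuous_on[OF r(3)]
        by (rule continuous_on_subset) (auto simp: inner_diff_left ee)
    qed (intro continuous_intros)
    then have hc: "continuous_on UNIV h" unfolding h_def by (intro continuous_intros) (simp add: o_def)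
    have mem: "y \<in> \<Omega> \<longleftrightarrow> h y < 0" if "y \<in> ball x r" for y
    proof -
      have "y \<in> \<Omega> \<inter> ball x r \<longleftrightarrow> y \<in> ball x r \<and> h y < 0" unfolding r(4) by (simp add: h_def)
      then show ?thesis using that by blast
    qed
    have hx: "h x \<ge> 0" using mem[of x] x(2) r(1) by simp
    have hs: "h (x + s *\<^sub>R e) = h x + s" for s
      by (simp add: h_def inner_add_left ee algebra_simps)
    define U where "U = {y. 0 < h y} \<inter> ball x r \<inter> interior (closure \<Omega>)"
    have "open {y. 0 < h y}" by (rule open_Collect_less[OF continuous_on_const hc])
    then have oU: "open U" unfolding U_def by (intro open_Int open_ball open_interior)
    have disj: "U \<inter> \<Omega> = {}" using mem by (force simp: U_def)
    have "open (ball x r \<inter> interior (closure \<Omega>))" by auto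
    moreover have "x \<in> ball x r \<inter> interior (closure \<Omega>)" using x r(1) by auto
    ultimately obtain d where d: "d > 0" "ball x d \<subseteq> ball x r \<inter> interior (closure \<Omega>)"
      using open_contains_ball by metis
    have "x + (d / 2) *\<^sub>R e \<in> ball x d" using d(1) r(2) by (simp add: dist_norm)
    then have "x + (d / 2) *\<^sub>R e \<in> U" using d hx hs[of "d / 2"] by (auto simp: U_def)
    moreover have "U \<subseteq> closure \<Omega>" using interior_subset by (auto simp: U_def)
    ultimately have "U \<inter> closure \<Omega> \<noteq> {}" by blast
    then show False using open_Int_closure_eq_empty[OF oU] disj by blast
  qed
qed

locale mesh =
  fixes \<Omega> :: "'a::euclidean_space set" and \<T> :: "'a set set"
  assumes bounded: "bounded \<Omega>" and lipschitz: "lipschitz_domain \<Omega>" and mesh: "simplicial_mesh \<Omega> \<T>"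
begin

lemma finite_T: "finite \<T>" and simplex_T: "T \<in> \<T> \<Longrightarrow> int DIM('a) simplex T"
  and Union_T: "\<Union>\<T> = closure \<Omega>"
  and face_T: "T \<in> \<T> \<Longrightarrow> T' \<in> \<T> \<Longrightarrow> (T \<inter> T') face_of T"
  using mesh by (auto simp: simplicial_mesh_def triangulation_def)

lemma open_\<Omega>: "open \<Omega>" using lipschitz by (simp add: lipschitz_domain_def)

text \<open>The intersection is a face of both elements that meets their interiors, hence equal to
  both.\<close>

lemma interiors_disjoint:
  assumes "T \<in> \<T>" "T' \<in> \<T>" "interior T \<inter> interior T' \<noteq> {}"
  shows "T = T'"
proof -
  obtain x where x: "x \<in> interior T" "x \<in> interior T'" using assms(3) by auto
  then have "x \<in> T" "x \<in> T'" using interior_subset by auto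
  then have "T \<inter> T' = T" using face_of_disjoint_interior[OF face_T[OF assms(1,2)]] x by blast
  moreover have "T' \<inter> T = T'"
    using face_of_disjoint_interior[OF face_T[OF assms(2,1)]] x \<open>x \<in> T\<close> \<open>x \<in> T'\<close> by blast
  ultimately show ?thesis by blast
qed

lemma interior_T_subset: "T \<in> \<T> \<Longrightarrow> interior T \<subseteq> \<Omega>"
  using Union_T interior_closure_lipschitz[OF lipschitz] by (metis Union_upper interior_mono)

lemma centroid_interior: "T \<in> \<T> \<Longrightarrow> centroid T \<in> interior T"
  using simplex_frame[OF simplex_T] frame.centroid_T frame.barycentre_interior by metis

lemma measure_pos: "T \<in> \<T> \<Longrightarrow> 0 < measure lebesgue T"
  using simplex_frame[OF simplex_T] frame.measure_T_pos frame.measure_T_lebesgue by metis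

lemma facet_frame:
  assumes "T \<in> \<T>" "S facet_of T"
  obtains C g p where "frame C g" "T = convex hull C" "p \<in> C" "S = convex hull (C - {p})"
proof -
  obtain C g where C: "frame C g" "T = convex hull C" using simplex_frame[OF simplex_T[OF assms(1)]] .
  then obtain p where "p \<in> C" "S = convex hull (C - {p})"
    using frame.facet_iff[OF C(1)] assms(2) by blast
  then show ?thesis using that C by blast
qed

lemma finite_facets: "T \<in> \<T> \<Longrightarrow> finite {S. S facet_of T}"
  by (rule finite_polytope_facets, rule simplex_imp_polytope) (rule simplex_T)

lemma finite_sides: "finite (sides \<T>)"
proof -
  have "sides \<T> = (\<Union>T\<in>\<T>. {S. S facet_of T})" by (auto simp: sides_def)
  then show ?thesis using finite_T finite_facets by simp
qed

lemma side_centroid_rel_interior: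
  assumes "T \<in> \<T>" "S facet_of T" shows "side_centroid S \<in> rel_interior S"
proof -
  obtain C g p where C: "frame C g" "T = convex hull C" "p \<in> C" "S = convex hull (C - {p})"
    using facet_frame[OF assms] .
  then show ?thesis using frame.side_centroid_F[OF C(1,3)] frame.face_barycentre_rel_interior[OF C(1,3)] by simp
qed

lemma side_area_pos:
  assumes "T \<in> \<T>" "S facet_of T" shows "0 < side_area S"
proof -
  obtain C g p where C: "frame C g" "T = convex hull C" "p \<in> C" "S = convex hull (C - {p})"
    using facet_frame[OF assms] .
  then show ?thesis using frame.side_area_F[OF C(1,3)] frame.face_area_pos[OF C(1,3)] by simp
qed

lemma facet_subset: "S facet_of T \<Longrightarrow> S \<subseteq> T"
  using facet_of_imp_subset by blast

text \<open>Equal normals would put both elements on the same side of \<open>S\<close>, with overlapping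
  interiors.\<close>

lemma opposite_normals:
  assumes T: "T \<in> \<T>" "T' \<in> \<T>" "T \<noteq> T'" and S: "S facet_of T" "S facet_of T'"
  shows "outer_normal T' S = - outer_normal T S"
proof -
  obtain C g p where C: "frame C g" "T = convex hull C" "p \<in> C" "S = convex hull (C - {p})"
    using facet_frame[OF T(1) S(1)] .
  obtain C' g' p' where C': "frame C' g'" "T' = convex hull C'" "p' \<in> C'" "S = convex hull (C' - {p'})"
    using facet_frame[OF T(2) S(2)] .
  interpret f: frame C g by (rule C(1))
  interpret f': frame C' g' by (rule C'(1))
  have n': "outer_normal T' S = - (g' p' /\<^sub>R norm (g' p'))" using f'.outer_normal_F[OF C'(3)] C' by simp
  have n: "outer_normal T S = - (g p /\<^sub>R norm (g p))" using f.outer_normal_F[OF C(3)] C by simp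
  have "norm (outer_normal T' S) = 1" using f'.norm_outer_normal[OF C'(3)] C' by simp
  moreover have "outer_normal T' S \<bullet> (x - y) = 0" if "x \<in> S" "y \<in> S" for x y
  proof -
    have "g' p' \<bullet> (x - y) = 0" by (rule f'.grad_orthogonal_F[OF C'(3)]) (use that C'(4) in simp_all)
    then show ?thesis by (simp only: n' inner_minus_left inner_scaleR_left mult_zero_right minus_zero)
  qed
  ultimately have "outer_normal T' S = g p /\<^sub>R norm (g p) \<or> outer_normal T' S = - (g p /\<^sub>R norm (g p))"
    using f.unit_normal_cases[OF C(3)] C(4) by blast
  moreover have "outer_normal T' S \<noteq> outer_normal T S"
  proof
    assume eq: "outer_normal T' S = outer_normal T S"
    have x: "side_centroid S \<in> rel_interior S" using side_centroid_rel_interior[OF T(1) S(1)] .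
    have "\<forall>\<^sub>F \<epsilon> in at_right 0. side_centroid S - \<epsilon> *\<^sub>R outer_normal T S \<in> interior T"
      using f.inward_of_side[OF C(3), of "side_centroid S"] x C by simp
    moreover have "\<forall>\<^sub>F \<epsilon> in at_right 0. side_centroid S - \<epsilon> *\<^sub>R outer_normal T S \<in> interior T'"
      using f'.inward_of_side[OF C'(3), of "side_centroid S"] x C' eq by simp
    ultimately have "\<forall>\<^sub>F \<epsilon> in at_right (0::real). interior T \<inter> interior T' \<noteq> {}"
      by eventually_elim blast
    then have "interior T \<inter> interior T' \<noteq> {}" by simp
    then show False using interiors_disjoint T by blast
  qed
  ultimately show ?thesis using n by auto
qed

text \<open>The normals of three elements would be pairwise opposite.\<close>

lemma at_most_two:
  assumes T: "T1 \<in> \<T>" "T2 \<in> \<T>" "T3 \<in> \<T>" and S: "S facet_of T1" "S facet_of T2" "S facet_of T3"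
    and ne: "T1 \<noteq> T2" "T1 \<noteq> T3"
  shows "T2 = T3"
proof (rule ccontr)
  assume "T2 \<noteq> T3"
  obtain C g p where C: "frame C g" "T1 = convex hull C" "p \<in> C" "S = convex hull (C - {p})"
    using facet_frame[OF T(1) S(1)] .
  then have "norm (outer_normal T1 S) = 1" using frame.norm_outer_normal by metis
  moreover have "outer_normal T2 S = - outer_normal T1 S" "outer_normal T3 S = - outer_normal T1 S"
    "outer_normal T3 S = - outer_normal T2 S"
    using opposite_normals T S ne \<open>T2 \<noteq> T3\<close> by blast+
  then have "outer_normal T1 S = - outer_normal T1 S" by simp
  then have "2 *\<^sub>R outer_normal T1 S = 0" by (metis scaleR_2 add.right_inverse)
  then have "outer_normal T1 S = 0" by simp
  ultimately show False by simp
qed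

text \<open>The two elements lie on opposite sides of \<open>S\<close> and cover a neighbourhood of its
  centroid, which thus lies in the interior of the closure of the domain.\<close>

lemma shared_side_inside:
  assumes T: "T \<in> \<T>" "T' \<in> \<T>" "T \<noteq> T'" and S: "S facet_of T" "S facet_of T'"
  shows "\<not> S \<subseteq> frontier \<Omega>"
proof -
  obtain C g p where C: "frame C g" "T = convex hull C" "p \<in> C" "S = convex hull (C - {p})"
    using facet_frame[OF T(1) S(1)] .
  obtain C' g' p' where C': "frame C' g'" "T' = convex hull C'" "p' \<in> C'" "S = convex hull (C' - {p'})"
    using facet_frame[OF T(2) S(2)] .
  have x: "side_centroid S \<in> rel_interior S" using side_centroid_rel_interior[OF T(1) S(1)] .
  obtain e where e: "e > 0" "\<forall>y\<in>ball (side_centroid S) e. outer_normal T S \<bullet> (y - side_centroid S) \<le> 0 \<longrightarrow> y \<in> T"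
    using frame.half_ball_at_side[OF C(1,3), of "side_centroid S"] x C by metis
  obtain e' where e': "e' > 0" "\<forall>y\<in>ball (side_centroid S) e'. outer_normal T' S \<bullet> (y - side_centroid S) \<le> 0 \<longrightarrow> y \<in> T'"
    using frame.half_ball_at_side[OF C'(1,3), of "side_centroid S"] x C' by metis
  have "ball (side_centroid S) (min e e') \<subseteq> \<Union>\<T>"
  proof
    fix y assume y: "y \<in> ball (side_centroid S) (min e e')"
    have "outer_normal T S \<bullet> (y - side_centroid S) \<le> 0 \<or> outer_normal T' S \<bullet> (y - side_centroid S) \<le> 0"
      unfolding opposite_normals[OF T S] by (simp add: linear)
    then have "y \<in> T \<or> y \<in> T'" using e(2) e'(2) y by auto
    then show "y \<in> \<Union>\<T>" using T by blast
  qed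
  then have "side_centroid S \<in> interior (closure \<Omega>)"
    unfolding Union_T using e(1) e'(1) by (auto simp: mem_interior intro!: exI[of _ "min e e'"])
  then have "side_centroid S \<in> \<Omega>" by (simp add: interior_closure_lipschitz[OF lipschitz])
  then have "side_centroid S \<notin> frontier \<Omega>" using open_\<Omega> by (simp add: frontier_def interior_open)
  then show ?thesis using x rel_interior_subset by blast
qed

lemma face_containing_side:
  assumes T: "T \<in> \<T>" "T' \<in> \<T>" and S: "S facet_of T" and x: "x \<in> rel_interior S" "x \<in> T'"
  shows "S \<subseteq> T \<inter> T'"
proof (rule subset_of_face_of[OF face_T[OF T]])
  show ST: "S \<subseteq> T" by (rule facet_subset[OF S])
  have "x \<in> S" using x(1) rel_interior_subset by blast
  then show "T \<inter> T' \<inter> rel_interior S \<noteq> {}" using x ST by blast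
qed

text \<open>Take a point \<open>x\<close> of the domain in the relative interior of \<open>S\<close>.
  Points just beyond \<open>S\<close> are covered by the other elements, whose union is closed; so some
  other element contains \<open>x\<close>. Conformity and a dimension count identify the intersection
  with \<open>S\<close>.\<close>

lemma inner_side_shared:
  assumes T: "T \<in> \<T>" and S: "S facet_of T" and ns: "\<not> S \<subseteq> frontier \<Omega>"
  obtains T' where "T' \<in> \<T>" "T' \<noteq> T" "S facet_of T'"
proof -
  obtain C g p where C: "frame C g" "T = convex hull C" "p \<in> C" "S = convex hull (C - {p})"
    using facet_frame[OF T S] .
  have ST: "S \<subseteq> T" by (rule facet_subset[OF S])
  have "S \<subseteq> closure \<Omega>" using ST T Union_T by blast
  then obtain x0 where "x0 \<in> S" "x0 \<in> \<Omega>" using ns open_\<Omega> by (auto simp: frontier_def interior_open)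
  have cS: "convex S" using C by simp
  have "x0 \<in> closure (rel_interior S)"
    using convex_closure_rel_interior[OF cS] \<open>x0 \<in> S\<close> closure_subset by blast
  then have "\<Omega> \<inter> rel_interior S \<noteq> {}"
    using open_Int_closure_eq_empty[OF open_\<Omega>] \<open>x0 \<in> \<Omega>\<close> by blast
  then obtain x where x: "x \<in> \<Omega>" "x \<in> rel_interior S" by blast
  define U where "U = \<Union>(\<T> - {T})"
  have cU: "closed U" unfolding U_def using finite_T simplex_T by (intro closed_Union) (auto intro: closed_simplex)
  have "x \<in> U"
  proof (rule ccontr)
    assume "x \<notin> U"
    then have "open (\<Omega> - U)" "x \<in> \<Omega> - U" using open_\<Omega> cU x by auto
    then obtain e where e: "e > 0" "ball x e \<subseteq> \<Omega> - U" using open_contains_ball by metis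
    let ?y = "x + (e / 2) *\<^sub>R outer_normal T S"
    have "norm (outer_normal T S) = 1" using frame.norm_outer_normal[OF C(1,3)] C by simp
    then have "?y \<in> ball x e" using e(1) by (simp add: dist_norm)
    then have "?y \<in> \<Omega> - U" using e by blast
    then have "?y \<in> T" using Union_T closure_subset[of \<Omega>] by (auto simp: U_def)
    moreover have "?y \<notin> T" using frame.outward_of_side[OF C(1,3), of x "e / 2"] x(2) e(1) C by simp
    ultimately show False by simp
  qed
  then obtain T' where T': "T' \<in> \<T>" "T' \<noteq> T" "x \<in> T'" by (auto simp: U_def)
  have sub: "S \<subseteq> T \<inter> T'" by (rule face_containing_side[OF T T'(1) S x(2) T'(3)])
  have ne: "T \<inter> T' \<noteq> T"
  proof
    assume "T \<inter> T' = T"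
    then have "interior T \<subseteq> interior T'" by (metis inf.absorb_iff1 interior_mono)
    then have "interior T \<inter> interior T' \<noteq> {}" using centroid_interior[OF T] by blast
    then show False using interiors_disjoint[OF T T'(1)] T'(2) by simp
  qed
  have dims: "aff_dim T = int DIM('a)" "aff_dim T' = int DIM('a)"
    using simplex_T T T'(1) aff_dim_simplex by blast+
  have "aff_dim (T \<inter> T') < aff_dim T"
    using face_of_aff_dim_lt[OF _ face_T[OF T T'(1)] ne] convex_simplex[OF simplex_T[OF T]] by simp
  moreover have Sd: "aff_dim S = aff_dim T - 1" "S face_of T" "S \<noteq> {}" using S by (auto simp: facet_of_def)
  moreover have "S face_of (T \<inter> T')" using face_of_subset[OF Sd(2) sub] by simp
  moreover have "convex (T \<inter> T')" using convex_simplex simplex_T T T'(1) by (blast intro: convex_Int)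
  ultimately have "S = T \<inter> T'" using face_of_aff_dim_lt[of "T \<inter> T'" S] by force
  then have "S face_of T'" using face_T[OF T'(1) T] by (simp add: Int_commute)
  then have "S facet_of T'" using Sd dims by (simp add: facet_of_def)
  then show ?thesis using that T' by blast
qed

text \<open>Both sides are faces of the intersection of their elements, and distinct faces have disjoint
  relative interiors.\<close>

lemma rel_interiors_disjoint:
  assumes "S \<in> sides \<T>" "S' \<in> sides \<T>" "x \<in> rel_interior S" "x \<in> rel_interior S'"
  shows "S = S'"
proof -
  obtain T T' where T: "T \<in> \<T>" "T' \<in> \<T>" "S facet_of T" "S' facet_of T'"
    using assms by (auto simp: sides_def)
  have xs: "x \<in> T" "x \<in> T'"
    using assms rel_interior_subset facet_subset T by blast+
  have 1: "S \<subseteq> T \<inter> T'" by (rule face_containing_side[OF T(1,2,3) assms(3) xs(2)])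
  have 2: "S' \<subseteq> T' \<inter> T" by (rule face_containing_side[OF T(2,1,4) assms(4) xs(1)])
  have "S face_of (T \<inter> T')" using T(3) 1 by (auto simp: facet_of_def intro: face_of_subset)
  moreover have "S' face_of (T \<inter> T')" using T(4) 2 by (auto simp: facet_of_def intro: face_of_subset)
  ultimately show ?thesis using face_of_eq assms(3,4) by blast
qed

definition bd_element :: "'a set \<Rightarrow> 'a set" where "bd_element S = (THE T. T \<in> \<T> \<and> S facet_of T)"

lemma boundary_element:
  assumes "S \<in> boundary_sides \<Omega> \<T>"
  shows "bd_element S \<in> \<T>" "S facet_of bd_element S" "\<And>T. T \<in> \<T> \<Longrightarrow> S facet_of T \<Longrightarrow> T = bd_element S"
proof -
  obtain T where T: "T \<in> \<T>" "S facet_of T" using assms by (auto simp: boundary_sides_def sides_def)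
  have u: "T' = T" if "T' \<in> \<T>" "S facet_of T'" for T'
    using shared_side_inside[OF T(1) that(1) _ T(2) that(2)] assms unfolding boundary_sides_def by blast
  have e: "bd_element S = T" unfolding bd_element_def
  proof (rule the_equality)
    show "T \<in> \<T> \<and> S facet_of T" using T by simp
    show "T' = T" if "T' \<in> \<T> \<and> S facet_of T'" for T' using that u by blast
  qed
  show "bd_element S \<in> \<T>" "S facet_of bd_element S" unfolding e by (rule T)+
  show "T' = bd_element S" if "T' \<in> \<T>" "S facet_of T'" for T' unfolding e using that by (rule u)
qed

lemma interior_side_elements:
  assumes "S \<in> interior_sides \<Omega> \<T>"
  obtains T T' where "T \<noteq> T'" "{T \<in> \<T>. S facet_of T} = {T, T'}"
proof -
  obtain T where T: "T \<in> \<T>" "S facet_of T" and n: "\<not> S \<subseteq> frontier \<Omega>"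
    using assms by (auto simp: interior_sides_def boundary_sides_def sides_def)
  obtain T' where T': "T' \<in> \<T>" "T' \<noteq> T" "S facet_of T'" using inner_side_shared[OF T n] .
  have "{T \<in> \<T>. S facet_of T} = {T, T'}" using T T' at_most_two by blast
  then show ?thesis using that T' by metis
qed

end

section \<open>Integrals of piecewise constant functions\<close>

lemma sum_single:
  assumes "finite I" "i \<in> I" "\<And>j. j \<in> I \<Longrightarrow> j \<noteq> i \<Longrightarrow> h j = 0"
  shows "sum h I = h i"
  using assms by (simp add: sum.remove[of I i] sum.neutral)

text \<open>The measurability of \<open>h\<close> comes from the completeness of the measure.\<close>

lemma integral_piecewise_constant:
  fixes h :: "'a \<Rightarrow> real"
  assumes fin: "finite I" and R: "\<And>i. i \<in> I \<Longrightarrow> R i \<in> sets (completion M)"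
    and m: "\<And>i. i \<in> I \<Longrightarrow> emeasure (completion M) (R i) = ennreal (m i)" "\<And>i. i \<in> I \<Longrightarrow> 0 \<le> m i"
    and disj: "\<And>i j x. i \<in> I \<Longrightarrow> j \<in> I \<Longrightarrow> x \<in> R i \<Longrightarrow> x \<in> R j \<Longrightarrow> i = j"
    and h: "\<And>i x. i \<in> I \<Longrightarrow> x \<in> R i \<Longrightarrow> h x = c i"
    and ae: "AE x in completion M. x \<in> (\<Union>i\<in>I. R i) \<or> h x = 0"
  shows "integral\<^sup>L (completion M) h = (\<Sum>i\<in>I. m i * c i)"
proof -
  have int: "integrable (completion M) (\<lambda>x. indicator (R i) x * c i)" if "i \<in> I" for i
    using R[OF that] m(1)[OF that] by (intro integrable_mult_left integrable_real_indicator) auto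
  have "integral\<^sup>L (completion M) h = integral\<^sup>L (completion M) (\<lambda>x. \<Sum>i\<in>I. indicator (R i) x * c i)"
  proof (rule integral_completion_cong_AE)
    show "(\<lambda>x. \<Sum>i\<in>I. indicator (R i) x * c i) \<in> borel_measurable (completion M)"
      using int by (intro borel_measurable_sum) (simp add: borel_measurable_integrable)
    show "AE x in completion M. h x = (\<Sum>i\<in>I. indicator (R i) x * c i)"
      using ae
    proof eventually_elim
      fix x assume x: "x \<in> (\<Union>i\<in>I. R i) \<or> h x = 0"
      show "h x = (\<Sum>i\<in>I. indicator (R i) x * c i)"
      proof (cases "x \<in> (\<Union>i\<in>I. R i)")
        case True
        then obtain i where i: "i \<in> I" "x \<in> R i" by blast
        have "(\<Sum>j\<in>I. indicator (R j) x * c j) = indicator (R i) x * c i"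
          using disj[OF i(1) _ i(2)] by (intro sum_single[OF fin i(1)]) (auto simp: indicator_def)
        then show ?thesis using i h by simp
      next
        case False
        then have "(\<Sum>j\<in>I. indicator (R j) x * c j) = 0"
          by (intro sum.neutral) (auto simp: indicator_def)
        then show ?thesis using x False by simp
      qed
    qed
  qed
  also have "\<dots> = (\<Sum>i\<in>I. integral\<^sup>L (completion M) (\<lambda>x. indicator (R i) x * c i))"
    using int by (rule Bochner_Integration.integral_sum)
  also have "\<dots> = (\<Sum>i\<in>I. m i * c i)"
  proof (intro sum.cong refl)
    fix i assume i: "i \<in> I"
    have "measure (completion M) (R i) = m i" using m[OF i] by (simp add: measure_def)
    then show "integral\<^sup>L (completion M) (\<lambda>x. indicator (R i) x * c i) = m i * c i"
      using R[OF i] sets.sets_into_space[OF R[OF i]] by (simp add: Int_absorb2 Int_absorb1)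
  qed
  finally show ?thesis .
qed

context mesh
begin

lemma AE_skeleton: "AE x in lebesgue. x \<in> \<Omega> \<longrightarrow> (\<exists>T\<in>\<T>. x \<in> interior T)"
proof -
  have "(\<Union>T\<in>\<T>. T - interior T) \<in> null_sets lebesgue"
  proof (rule null_sets_UN')
    show "countable \<T>" using finite_T by (rule countable_finite)
    show "T - interior T \<in> null_sets lebesgue" if "T \<in> \<T>" for T
      using simplex_frame[OF simplex_T[OF that]] frame.skeleton_null by metis
  qed
  then have "AE x in lebesgue. x \<notin> (\<Union>T\<in>\<T>. T - interior T)" by (rule AE_not_in)
  then show ?thesis
  proof eventually_elim
    fix x assume "x \<notin> (\<Union>T\<in>\<T>. T - interior T)"
    then show "x \<in> \<Omega> \<longrightarrow> (\<exists>T\<in>\<T>. x \<in> interior T)"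
      using Union_T closure_subset[of \<Omega>] by blast
  qed
qed

text \<open>A property that is constant on the interior of each element can be tested at one point per
  element; the interiors cover the domain up to a null set and have positive measure.\<close>

lemma AE_mesh:
  assumes "\<And>T x. T \<in> \<T> \<Longrightarrow> x \<in> interior T \<Longrightarrow> P x \<longleftrightarrow> Q T"
  shows "(AE x in lebesgue_on \<Omega>. P x) \<longleftrightarrow> (\<forall>T\<in>\<T>. Q T)"
proof -
  have eq: "(AE x in lebesgue_on \<Omega>. P x) \<longleftrightarrow> (AE x in lebesgue. x \<in> \<Omega> \<longrightarrow> P x)"
    using open_\<Omega> by (intro AE_restrict_space_iff) (auto intro: borel_open)
  show ?thesis unfolding eq
  proof
    assume ae: "AE x in lebesgue. x \<in> \<Omega> \<longrightarrow> P x"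
    show "\<forall>T\<in>\<T>. Q T"
    proof (rule ballI, rule ccontr)
      fix T assume T: "T \<in> \<T>" "\<not> Q T"
      have "AE x in lebesgue. x \<notin> interior T" using ae
      proof eventually_elim
        fix x assume "x \<in> \<Omega> \<longrightarrow> P x"
        then show "x \<notin> interior T" using T assms[OF T(1), of x] interior_T_subset[OF T(1)] by blast
      qed
      then have "interior T \<in> null_sets lebesgue" by (simp add: completion.null_sets_iff_AE)
      then have "negligible (interior T)" by (simp add: negligible_iff_null_sets)
      then show False using open_not_negligible[OF open_interior] centroid_interior[OF T(1)] by blast
    qed
  next
    assume Q: "\<forall>T\<in>\<T>. Q T"
    show "AE x in lebesgue. x \<in> \<Omega> \<longrightarrow> P x" using AE_skeleton
    proof eventually_elim
      fix x assume "x \<in> \<Omega> \<longrightarrow> (\<exists>T\<in>\<T>. x \<in> interior T)"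
      then show "x \<in> \<Omega> \<longrightarrow> P x" using assms Q by blast
    qed
  qed
qed

lemma emeasure_interior:
  assumes "T \<in> \<T>" shows "emeasure lebesgue (interior T) = ennreal (measure lebesgue T)"
proof -
  have T: "compact T" "convex T" using simplex_T[OF assms] compact_simplex convex_simplex by blast+
  then have "measure lebesgue (interior T) = measure lebesgue T"
    by (intro measure_interior compact_imp_bounded negligible_convex_frontier)
  moreover have "interior T \<in> lmeasurable"
    using T(1) by (intro lmeasurable_open bounded_interior compact_imp_bounded) auto
  ultimately show ?thesis by (simp add: emeasure_eq_measure2)
qed

lemma integral_mesh:
  fixes h :: "'a \<Rightarrow> real"
  assumes "\<And>T x. T \<in> \<T> \<Longrightarrow> x \<in> interior T \<Longrightarrow> h x = c T"
  shows "(LINT x:\<Omega>|lebesgue. h x) = (\<Sum>T\<in>\<T>. measure lebesgue T * c T)"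
  unfolding set_lebesgue_integral_def
proof (rule integral_piecewise_constant[where R=interior])
  show "finite \<T>" by (rule finite_T)
  show "\<And>T T' x. T \<in> \<T> \<Longrightarrow> T' \<in> \<T> \<Longrightarrow> x \<in> interior T \<Longrightarrow> x \<in> interior T' \<Longrightarrow> T = T'"
    using interiors_disjoint by blast
  show "indicator \<Omega> x *\<^sub>R h x = c T" if "T \<in> \<T>" "x \<in> interior T" for T x
    using that assms interior_T_subset[OF that(1)] by (auto simp: indicator_def)
  show "AE x in lebesgue. x \<in> (\<Union>T\<in>\<T>. interior T) \<or> indicator \<Omega> x *\<^sub>R h x = 0"
    using AE_skeleton by eventually_elim (auto simp: indicator_def)
  show "emeasure lebesgue (interior T) = ennreal (measure lebesgue T)" if "T \<in> \<T>" for T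
    using that by (rule emeasure_interior)
qed auto

lemma nn_integral_mesh:
  assumes "\<And>T x. T \<in> \<T> \<Longrightarrow> x \<in> interior T \<Longrightarrow> h x = c T"
  shows "(\<integral>\<^sup>+x\<in>\<Omega>. h x \<partial>lebesgue) = (\<Sum>T\<in>\<T>. ennreal (measure lebesgue T) * c T)"
proof -
  have "(\<integral>\<^sup>+x\<in>\<Omega>. h x \<partial>lebesgue) = (\<integral>\<^sup>+x. (\<Sum>T\<in>\<T>. c T * indicator (interior T) x) \<partial>lebesgue)"
  proof (rule nn_integral_cong_AE)
    show "AE x in lebesgue. h x * indicator \<Omega> x = (\<Sum>T\<in>\<T>. c T * indicator (interior T) x)"
      using AE_skeleton
    proof eventually_elim
      fix x assume x: "x \<in> \<Omega> \<longrightarrow> (\<exists>T\<in>\<T>. x \<in> interior T)"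
      show "h x * indicator \<Omega> x = (\<Sum>T\<in>\<T>. c T * indicator (interior T) x)"
      proof (cases "x \<in> \<Omega>")
        case True
        then obtain T where T: "T \<in> \<T>" "x \<in> interior T" using x by blast
        have "(\<Sum>T'\<in>\<T>. c T' * indicator (interior T') x) = c T * indicator (interior T) x"
          using interiors_disjoint[OF T(1)] T(2) by (intro sum_single[OF finite_T T(1)]) (auto simp: indicator_def)
        then show ?thesis using T True assms by simp
      next
        case False
        then have "(\<Sum>T\<in>\<T>. c T * indicator (interior T) x) = 0"
          using interior_T_subset by (intro sum.neutral) (auto simp: indicator_def)
        then show ?thesis using False by simp
      qed
    qed
  qed
  also have "\<dots> = (\<Sum>T\<in>\<T>. \<integral>\<^sup>+x. c T * indicator (interior T) x \<partial>lebesgue)"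
    by (rule nn_integral_sum, rule borel_measurable_times_ennreal[OF borel_measurable_const borel_measurable_indicator]) auto
  also have "\<dots> = (\<Sum>T\<in>\<T>. ennreal (measure lebesgue T) * c T)"
  proof (intro sum.cong refl)
    fix T assume T: "T \<in> \<T>"
    have "(\<integral>\<^sup>+x. c T * indicator (interior T) x \<partial>lebesgue) = c T * emeasure lebesgue (interior T)"
      by (rule nn_integral_cmult_indicator) auto
    then show "(\<integral>\<^sup>+x. c T * indicator (interior T) x \<partial>lebesgue) = ennreal (measure lebesgue T) * c T"
      by (simp only: emeasure_interior[OF T] mult.commute)
  qed
  finally show ?thesis .
qed

abbreviation "B \<equiv> boundary_sides \<Omega> \<T>"

lemma B_sides: "S \<in> B \<Longrightarrow> S \<in> sides \<T>" by (simp add: boundary_sides_def)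

lemma finite_B: "finite B" using finite_sides by (simp add: boundary_sides_def)

lemma side_measure_facts:
  assumes "S \<in> sides \<T>"
  shows "rel_interior S \<in> sets borel"
    "emeasure (side_measure S) (rel_interior S) = ennreal (side_area S)"
    "emeasure (side_measure S) (- rel_interior S) = 0" "0 < side_area S"
proof -
  obtain T where T: "T \<in> \<T>" "S facet_of T" using assms by (auto simp: sides_def)
  obtain C g p where C: "frame C g" "T = convex hull C" "p \<in> C" "S = convex hull (C - {p})"
    using facet_frame[OF T] .
  interpret frame C g by (rule C(1))
  obtain n where "face_frame C g p n" using side_cylinder_normal[OF C(3)] .
  then show "rel_interior S \<in> sets borel" unfolding C(4) by (rule face_frame.borel_rel_interior_F)
  show "emeasure (side_measure S) (rel_interior S) = ennreal (side_area S)"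
    "emeasure (side_measure S) (- rel_interior S) = 0"
    unfolding C(4) using emeasure_side_measure[OF C(3)] side_area_F[OF C(3)] by simp_all
  show "0 < side_area S" by (rule side_area_pos[OF T])
qed

text \<open>The sum of the surface measures of the boundary sides, before completion.\<close>

definition bd_borel :: "'a measure" where
  "bd_borel = measure_of UNIV (sets borel) (\<lambda>A. \<Sum>S\<in>B. emeasure (side_measure S) A)"

lemma bd_measure_eq: "bd_measure \<Omega> \<T> = completion bd_borel"
  by (simp add: bd_measure_def bd_borel_def)

lemma sets_bd_borel: "sets bd_borel = sets borel"
  unfolding bd_borel_def using sets.sigma_sets_eq[of "borel :: 'a measure"] by (simp add: sets_measure_of_conv)

lemma emeasure_bd_borel:
  assumes A: "A \<in> sets borel"
  shows "emeasure bd_borel A = (\<Sum>S\<in>B. emeasure (side_measure S) A)"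
proof (rule emeasure_measure_of[OF bd_borel_def])
  show "countably_additive (sets bd_borel) (\<lambda>A. \<Sum>S\<in>B. emeasure (side_measure S) A)"
    unfolding sets_bd_borel
  proof (rule countably_additiveI)
    fix X :: "nat \<Rightarrow> 'a set"
    assume X: "range X \<subseteq> sets borel" "disjoint_family X"
    have "(\<Sum>i. \<Sum>S\<in>B. emeasure (side_measure S) (X i)) = (\<Sum>S\<in>B. \<Sum>i. emeasure (side_measure S) (X i))"
      by (rule suminf_sum) simp
    also have "\<dots> = (\<Sum>S\<in>B. emeasure (side_measure S) (\<Union>i. X i))"
    proof (intro sum.cong refl suminf_emeasure X(2))
      fix S show "range X \<subseteq> sets (side_measure S)" using X(1) by (auto simp: side_measure_def)
    qed
    finally show "(\<Sum>i. \<Sum>S\<in>B. emeasure (side_measure S) (X i)) = (\<Sum>S\<in>B. emeasure (side_measure S) (\<Union>i. X i))" .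
  qed
qed (use A sets_bd_borel in \<open>auto simp: positive_def\<close>)

text \<open>The surface measure of another side is concentrated on that side's relative
  interior.\<close>

lemma emeasure_bd_side:
  assumes S: "S \<in> B"
  shows "emeasure (bd_measure \<Omega> \<T>) (rel_interior S) = ennreal (side_area S)"
proof -
  note f = side_measure_facts[OF B_sides[OF S]]
  have "emeasure (bd_measure \<Omega> \<T>) (rel_interior S) = (\<Sum>S'\<in>B. emeasure (side_measure S') (rel_interior S))"
    unfolding bd_measure_eq using f(1) by (simp add: emeasure_bd_borel sets_bd_borel)
  also have "\<dots> = (\<Sum>S'\<in>B. if S' = S then ennreal (side_area S) else 0)"
  proof (intro sum.cong refl)
    fix S' assume S': "S' \<in> B"
    note f' = side_measure_facts[OF B_sides[OF S']]
    show "emeasure (side_measure S') (rel_interior S) = (if S' = S then ennreal (side_area S) else 0)"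
    proof (cases "S' = S")
      case False
      then have "rel_interior S \<subseteq> - rel_interior S'"
        using rel_interiors_disjoint[OF B_sides[OF S] B_sides[OF S']] by blast
      then have "emeasure (side_measure S') (rel_interior S) \<le> emeasure (side_measure S') (- rel_interior S')"
        using f'(1) by (intro emeasure_mono) (auto simp: side_measure_def)
      then show ?thesis using f'(3) False by simp
    qed (use f(2) in simp)
  qed
  also have "\<dots> = ennreal (side_area S)" using S finite_B by simp
  finally show ?thesis .
qed

lemma AE_boundary_skeleton: "AE x in bd_measure \<Omega> \<T>. \<exists>S\<in>B. x \<in> rel_interior S"
proof -
  let ?U = "\<Union>S\<in>B. rel_interior S"
  have U: "?U \<in> sets borel" using finite_B side_measure_facts(1)[OF B_sides] by (intro sets.finite_UN) auto
  have "emeasure bd_borel (- ?U) = (\<Sum>S\<in>B. emeasure (side_measure S) (- ?U))"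
    by (rule emeasure_bd_borel[OF borel_comp[OF U]])
  also have "\<dots> = 0"
  proof (intro sum.neutral ballI)
    fix S assume S: "S \<in> B"
    have "emeasure (side_measure S) (- ?U) \<le> emeasure (side_measure S) (- rel_interior S)"
      using S borel_comp[OF side_measure_facts(1)[OF B_sides[OF S]]]
      by (intro emeasure_mono) (auto simp: side_measure_def)
    then show "emeasure (side_measure S) (- ?U) = 0" using side_measure_facts(3)[OF B_sides[OF S]] by simp
  qed
  finally have "- ?U \<in> null_sets bd_borel" using borel_comp[OF U] by (simp add: null_sets_def sets_bd_borel del: Compl_UN)
  then have "AE x in bd_borel. x \<notin> - ?U" by (rule AE_not_in)
  then show ?thesis unfolding bd_measure_eq AE_completion_iff by eventually_elim auto
qed

lemma AE_boundary:
  assumes "\<And>S x. S \<in> B \<Longrightarrow> x \<in> rel_interior S \<Longrightarrow> P x \<longleftrightarrow> Q S"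
  shows "(AE x in bd_measure \<Omega> \<T>. P x) \<longleftrightarrow> (\<forall>S\<in>B. Q S)"
proof
  assume ae: "AE x in bd_measure \<Omega> \<T>. P x"
  show "\<forall>S\<in>B. Q S"
  proof (rule ballI, rule ccontr)
    fix S assume S: "S \<in> B" "\<not> Q S"
    have "AE x in bd_measure \<Omega> \<T>. x \<notin> rel_interior S" using ae
      by eventually_elim (use assms[OF S(1)] S(2) in blast)
    then have "rel_interior S \<in> null_sets (bd_measure \<Omega> \<T>)"
      unfolding bd_measure_eq completion.null_sets_iff_AE by (simp add: bd_borel_def space_measure_of_conv)
    then show False using emeasure_bd_side[OF S(1)] side_measure_facts(4)[OF B_sides[OF S(1)]]
      by (simp add: null_sets_def)
  qed
next
  assume "\<forall>S\<in>B. Q S"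
  then show "AE x in bd_measure \<Omega> \<T>. P x"
    using AE_boundary_skeleton assms by (auto elim: eventually_mono)
qed

lemma integral_boundary:
  fixes h :: "'a \<Rightarrow> real"
  assumes "\<And>S x. S \<in> B \<Longrightarrow> x \<in> rel_interior S \<Longrightarrow> indicator \<Gamma> x * h x = c S"
  shows "(LINT x:\<Gamma>|bd_measure \<Omega> \<T>. h x) = (\<Sum>S\<in>B. side_area S * c S)"
  unfolding set_lebesgue_integral_def bd_measure_eq
proof (rule integral_piecewise_constant[where R=rel_interior])
  show "finite B" by (rule finite_B)
  fix S assume S: "S \<in> B"
  show "rel_interior S \<in> sets (completion bd_borel)"
    using side_measure_facts(1)[OF B_sides[OF S]] by (simp add: sets_bd_borel)
  show "emeasure (completion bd_borel) (rel_interior S) = ennreal (side_area S)"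
    using emeasure_bd_side[OF S] by (simp add: bd_measure_eq)
  show "0 \<le> side_area S" by (simp add: side_area_def)
  fix x assume x: "x \<in> rel_interior S"
  then show "indicator \<Gamma> x *\<^sub>R h x = c S" using assms[OF S] by simp
  fix S' assume "S' \<in> B" "x \<in> rel_interior S'"
  then show "S = S'" using rel_interiors_disjoint B_sides S x by blast
next
  show "AE x in completion bd_borel. x \<in> (\<Union>S\<in>B. rel_interior S) \<or> indicator \<Gamma> x *\<^sub>R h x = 0"
    using AE_boundary_skeleton unfolding bd_measure_eq by eventually_elim blast
qed

lemma bd_side_eq: "S \<in> B \<Longrightarrow> x \<in> rel_interior S \<Longrightarrow> bd_side \<Omega> \<T> x = S"
  unfolding bd_side_def using rel_interiors_disjoint B_sides by (intro the_equality) blast+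

lemma bd_elem_eq: "S \<in> B \<Longrightarrow> x \<in> rel_interior S \<Longrightarrow> bd_elem \<Omega> \<T> x = bd_element S"
  unfolding bd_elem_def bd_element_def by (simp add: bd_side_eq)

section \<open>Degrees of freedom of discrete functions\<close>

definition elem_grad :: "('a \<Rightarrow> real) \<Rightarrow> 'a set \<Rightarrow> 'a" where "elem_grad v T = grad_h \<T> v (centroid T)"

lemma P1_scalar:
  assumes "v \<in> broken_P1 \<T>" "T \<in> \<T>"
  obtains G and c :: real where "\<And>x. x \<in> interior T \<Longrightarrow> v x = G \<bullet> x + c"
proof -
  obtain A c where A: "linear A" "\<And>x. x \<in> interior T \<Longrightarrow> v x = A x + c"
    using assms by (auto simp: broken_P1_def)
  have "A x = adjoint A 1 \<bullet> x" for x using adjoint_works[OF A(1), of x 1] by (simp add: inner_commute)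
  then show ?thesis using A(2) that by simp
qed

text \<open>An element-wise affine function is represented by its gradient and its value at the
  centroid; this includes its trace on the closed element.\<close>

lemma P1_grad:
  assumes v: "v \<in> broken_P1 \<T>" and T: "T \<in> \<T>"
  shows "x \<in> interior T \<Longrightarrow> v x = elem_grad v T \<bullet> x + (v (centroid T) - elem_grad v T \<bullet> centroid T)"
    and "x \<in> interior T \<Longrightarrow> grad_h \<T> v x = elem_grad v T"
    and "x \<in> T \<Longrightarrow> elem_trace T v x = elem_grad v T \<bullet> x + (v (centroid T) - elem_grad v T \<bullet> centroid T)"
proof -
  obtain G and c :: real where G: "\<And>x. x \<in> interior T \<Longrightarrow> v x = G \<bullet> x + c" using P1_scalar[OF v T] by metis
  obtain C g where "frame C g" and TC: "T = convex hull C" using simplex_frame[OF simplex_T[OF T]] .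
  then interpret frame C g by simp
  have grad: "grad_h \<T> v x = G" if "x \<in> interior T" for x
    using gradient_affine[of v G c x] that G T unfolding TC by (auto simp: grad_h_def)
  have gG: "elem_grad v T = G" unfolding elem_grad_def by (rule grad[OF centroid_interior[OF T]])
  then show "x \<in> interior T \<Longrightarrow> grad_h \<T> v x = elem_grad v T" using grad by simp
  have c: "c = v (centroid T) - elem_grad v T \<bullet> centroid T"
    unfolding gG using G[OF centroid_interior[OF T]] by linarith
  show "x \<in> interior T \<Longrightarrow> v x = elem_grad v T \<bullet> x + (v (centroid T) - elem_grad v T \<bullet> centroid T)"
    unfolding c[symmetric] unfolding gG by (rule G)
  have "linear (\<lambda>x. G \<bullet> x)" by (auto intro!: linearI simp: inner_add_right)
  from elem_trace_affine[OF this, of v c x]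
  show "x \<in> T \<Longrightarrow> elem_trace T v x = elem_grad v T \<bullet> x + (v (centroid T) - elem_grad v T \<bullet> centroid T)"
    unfolding c[symmetric] unfolding gG using G unfolding TC by blast
qed

lemma P1_div:
  assumes y: "y \<in> broken_P1 \<T>" and T: "T \<in> \<T>"
  obtains A a where "linear A" "\<And>x. x \<in> interior T \<Longrightarrow> y x = A x + a"
    "\<And>x. x \<in> interior T \<Longrightarrow> div_h \<T> y x = (\<Sum>b\<in>Basis. A b \<bullet> b)"
    "\<And>x. x \<in> T \<Longrightarrow> elem_trace T y x = A x + a"
proof -
  obtain A a where A: "linear A" "\<And>x. x \<in> interior T \<Longrightarrow> y x = A x + a"
    using assms by (auto simp: broken_P1_def)
  obtain C g where "frame C g" and TC: "T = convex hull C" using simplex_frame[OF simplex_T[OF T]] .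
  then interpret frame C g by simp
  have "div_h \<T> y x = (\<Sum>b\<in>Basis. A b \<bullet> b)" if "x \<in> interior T" for x
    using frechet_derivative_affine[OF A(1), of y a x] that A(2) T unfolding TC by (auto simp: div_h_def)
  moreover have "elem_trace T y x = A x + a" if "x \<in> T" for x
    using elem_trace_affine[OF A(1), of y a x] that A(2) unfolding TC by blast
  ultimately show ?thesis using that A by blast
qed

lemma paste:
  fixes w :: "'a set \<Rightarrow> 'a \<Rightarrow> 'b::real_vector"
  assumes T: "T \<in> \<T>" and x: "x \<in> interior T"
  shows "(\<Sum>T\<in>\<T>. indicator (interior T) x *\<^sub>R w T x) = w T x"
proof -
  have "(\<Sum>T\<in>\<T>. indicator (interior T) x *\<^sub>R w T x) = indicator (interior T) x *\<^sub>R w T x"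
    using interiors_disjoint[OF T] x by (intro sum_single[OF finite_T T]) (auto simp: indicator_def)
  then show ?thesis using x by simp
qed

lemma Pi_h_eq:
  fixes w :: "'a \<Rightarrow> 'b::euclidean_space"
  assumes w: "w \<in> broken_P1 \<T>" and T: "T \<in> \<T>" and x: "x \<in> interior T"
  shows "Pi_h \<T> w x = w (centroid T)"
proof -
  obtain A c where A: "linear A" "\<And>x. x \<in> interior T \<Longrightarrow> w x = A x + c"
    using w T by (auto simp: broken_P1_def)
  obtain C g where "frame C g" and TC: "T = convex hull C" using simplex_frame[OF simplex_T[OF T]] .
  then interpret frame C g by simp
  have "Pi_h \<T> w x = (1 / measure lebesgue T) *\<^sub>R (LINT z:T|lebesgue. w z)"
    unfolding Pi_h_def by (rule paste[OF T x])
  also have "(LINT z:T|lebesgue. w z) = measure lebesgue T *\<^sub>R (A (centroid T) + c)"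
    using lebesgue_integral_T[OF A(1), of w c] A(2) centroid_T measure_T_lebesgue by (simp add: TC)
  also have "A (centroid T) + c = w (centroid T)" using A(2)[OF centroid_interior[OF T]] by simp
  finally show ?thesis using measure_pos[OF T] by simp
qed

lemma outer_normal_orthogonal:
  assumes T: "T \<in> \<T>" and S: "S facet_of T" and x: "x \<in> S" "x' \<in> S"
  shows "(x - x') \<bullet> outer_normal T S = 0"
proof -
  obtain C g p where C: "frame C g" "T = convex hull C" "p \<in> C" "S = convex hull (C - {p})"
    using facet_frame[OF T S] .
  have "g p \<bullet> (x - x') = 0" using frame.grad_orthogonal_F[OF C(1,3)] x C(4) by blast
  then show ?thesis unfolding C(2) C(4) frame.outer_normal_F[OF C(1,3)] by (simp add: inner_commute)
qed

lemma side_avg_P1: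
  assumes v: "v \<in> broken_P1 \<T>" and T: "T \<in> \<T>" and S: "S facet_of T"
  shows "side_avg S (elem_trace T v) = elem_trace T v (side_centroid S)"
proof -
  obtain C g p where C: "frame C g" "T = convex hull C" "p \<in> C" "S = convex hull (C - {p})"
    using facet_frame[OF T S] .
  interpret frame C g by (rule C(1))
  have "side_centroid S \<in> T" using side_centroid_rel_interior[OF T S] rel_interior_subset facet_subset[OF S] by blast
  moreover have "side_avg (F p) (elem_trace T v) = elem_grad v T \<bullet> face_barycentre p + (v (centroid T) - elem_grad v T \<bullet> centroid T)"
    by (rule side_avg_affine[OF C(3)]) (use P1_grad(3)[OF v T] facet_subset[OF S] C(4) in blast)
  ultimately show ?thesis using P1_grad(3)[OF v T] side_centroid_F[OF C(3)] C(4) by simp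
qed

lemma side_avg_jump:
  assumes v: "v \<in> broken_P1 \<T>" and T: "T \<in> \<T>" "T' \<in> \<T>" and S: "S facet_of T" "S facet_of T'"
  shows "side_avg S (\<lambda>x. elem_trace T v x - elem_trace T' v x) = elem_trace T v (side_centroid S) - elem_trace T' v (side_centroid S)"
proof -
  obtain C g p where C: "frame C g" "T = convex hull C" "p \<in> C" "S = convex hull (C - {p})"
    using facet_frame[OF T(1) S(1)] .
  interpret frame C g by (rule C(1))
  have s: "side_centroid S \<in> T" "side_centroid S \<in> T'"
    using side_centroid_rel_interior[OF T(1) S(1)] rel_interior_subset facet_subset[OF S(1)] facet_subset[OF S(2)] by blast+
  let ?G = "elem_grad v T - elem_grad v T'" and ?c = "(v (centroid T) - elem_grad v T \<bullet> centroid T) - (v (centroid T') - elem_grad v T' \<bullet> centroid T')"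
  have "side_avg (F p) (\<lambda>x. elem_trace T v x - elem_trace T' v x) = ?G \<bullet> face_barycentre p + ?c"
  proof (rule side_avg_affine[OF C(3)])
    fix x assume "x \<in> F p"
    then have "x \<in> T" "x \<in> T'" using facet_subset S C(4) by blast+
    then show "elem_trace T v x - elem_trace T' v x = ?G \<bullet> x + ?c"
      using P1_grad(3)[OF v T(1)] P1_grad(3)[OF v T(2)] by (simp add: inner_diff_left)
  qed
  then show ?thesis
    using P1_grad(3)[OF v T(1) s(1)] P1_grad(3)[OF v T(2) s(2)] side_centroid_F[OF C(3)] C(4)
    by (simp add: inner_diff_left)
qed

text \<open>The degree of freedom of a Crouzeix-Raviart function at a side; all adjacent elements give
  the same value.\<close>

definition side_value :: "('a \<Rightarrow> real) \<Rightarrow> 'a set \<Rightarrow> real" where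
  "side_value v S = elem_trace (SOME T. T \<in> \<T> \<and> S facet_of T) v (side_centroid S)"

lemma CR_P1: "v \<in> CR \<Omega> \<T> \<Longrightarrow> v \<in> broken_P1 \<T>" by (simp add: CR_def)

text \<open>On a boundary side the condition is void because such a side belongs to one element
  only.\<close>

lemma CR_iff:
  assumes v: "v \<in> broken_P1 \<T>"
  shows "v \<in> CR \<Omega> \<T> \<longleftrightarrow> (\<forall>T\<in>\<T>. \<forall>T'\<in>\<T>. \<forall>S. S facet_of T \<longrightarrow> S facet_of T' \<longrightarrow>
    elem_trace T v (side_centroid S) = elem_trace T' v (side_centroid S))" (is "_ \<longleftrightarrow> ?R")
proof
  assume R: ?R
  have "side_avg S (\<lambda>x. elem_trace T v x - elem_trace T' v x) = 0"
    if "T \<in> \<T>" "T' \<in> \<T>" "S facet_of T" "S facet_of T'" for T T' S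
  proof -
    have "elem_trace T v (side_centroid S) = elem_trace T' v (side_centroid S)" using R that by blast
    then show ?thesis using side_avg_jump[OF v that] by simp
  qed
  then show "v \<in> CR \<Omega> \<T>" unfolding CR_def using v by blast
next
  assume C: "v \<in> CR \<Omega> \<T>"
  show ?R
  proof (intro ballI allI impI)
    fix T T' S assume T: "T \<in> \<T>" "T' \<in> \<T>" and S: "S facet_of T" "S facet_of T'"
    show "elem_trace T v (side_centroid S) = elem_trace T' v (side_centroid S)"
    proof (cases "T = T'")
      case False
      have "S \<in> interior_sides \<Omega> \<T>" using T S shared_side_inside[OF T False S]
        by (auto simp: interior_sides_def boundary_sides_def sides_def)
      then have "side_avg S (\<lambda>x. elem_trace T v x - elem_trace T' v x) = 0"
        using C T S False by (simp add: CR_def)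
      then show ?thesis using side_avg_jump[OF v T S] by simp
    qed simp
  qed
qed

lemma side_value_eq:
  assumes v: "v \<in> CR \<Omega> \<T>" and T: "T \<in> \<T>" and S: "S facet_of T"
  shows "elem_trace T v (side_centroid S) = side_value v S"
proof -
  have "(SOME T. T \<in> \<T> \<and> S facet_of T) \<in> \<T> \<and> S facet_of (SOME T. T \<in> \<T> \<and> S facet_of T)"
    using T S by (intro someI) auto
  then show ?thesis unfolding side_value_def using CR_iff[OF CR_P1[OF v]] v T S by blast
qed

lemma pi_h_eq:
  assumes v: "v \<in> CR \<Omega> \<T>" and S: "S \<in> B" and x: "x \<in> rel_interior S"
  shows "pi_h \<Omega> \<T> v x = side_value v S"
  unfolding pi_h_def bd_side_eq[OF S x] bd_elem_eq[OF S x]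
  using side_avg_P1[OF CR_P1[OF v] boundary_element(1,2)[OF S]] side_value_eq[OF v boundary_element(1,2)[OF S]] by simp

lemma RT_P1: "y \<in> RT \<Omega> \<T> \<Longrightarrow> y \<in> broken_P1 \<T>" by (simp add: RT_def)

lemma RT_flux_const:
  assumes y: "y \<in> RT \<Omega> \<T>" and T: "T \<in> \<T>" and S: "S facet_of T" and x: "x \<in> S"
  shows "elem_trace T y x \<bullet> outer_normal T S = flux y T S"
proof -
  have "side_centroid S \<in> S" using side_centroid_rel_interior[OF T S] rel_interior_subset by blast
  moreover have ex: "\<forall>T\<in>\<T>. \<forall>S. S facet_of T \<longrightarrow> (\<exists>c. \<forall>x\<in>S. elem_trace T y x \<bullet> outer_normal T S = c)"
    using y unfolding RT_def mem_Collect_eq by (elim conjE)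
  from ex[rule_format, OF T S] obtain c where "\<forall>x\<in>S. elem_trace T y x \<bullet> outer_normal T S = c" by blast
  ultimately show ?thesis using x by (simp add: flux_def)
qed

lemma RT_flux_opposite:
  assumes y: "y \<in> RT \<Omega> \<T>" and T: "T \<in> \<T>" "T' \<in> \<T>" "T \<noteq> T'" and S: "S facet_of T" "S facet_of T'"
  shows "flux y T S + flux y T' S = 0"
proof -
  have "S \<in> interior_sides \<Omega> \<T>" using T S shared_side_inside[OF T S]
    by (auto simp: interior_sides_def boundary_sides_def sides_def)
  moreover have "side_centroid S \<in> S" using side_centroid_rel_interior[OF T(1) S(1)] rel_interior_subset by blast
  moreover have "\<forall>S\<in>interior_sides \<Omega> \<T>. \<forall>T\<in>\<T>. \<forall>T'\<in>\<T>. T \<noteq> T' \<and> S facet_of T \<and> S facet_of T' \<longrightarrow>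
       (\<forall>x\<in>S. elem_trace T y x \<bullet> outer_normal T S + elem_trace T' y x \<bullet> outer_normal T' S = 0)"
    using y unfolding RT_def mem_Collect_eq by (elim conjE)
  ultimately have "elem_trace T y (side_centroid S) \<bullet> outer_normal T S + elem_trace T' y (side_centroid S) \<bullet> outer_normal T' S = 0"
    using T S by metis
  then show ?thesis by (simp add: flux_def)
qed

lemma normal_trace_eq:
  assumes y: "y \<in> RT \<Omega> \<T>" and S: "S \<in> B" and x: "x \<in> rel_interior S"
  shows "normal_trace \<Omega> \<T> y x = flux y (bd_element S) S"
  unfolding normal_trace_def bd_normal_def bd_side_eq[OF S x] bd_elem_eq[OF S x]
  using RT_flux_const[OF y boundary_element(1,2)[OF S]] x rel_interior_subset by blast

lemma gauss_mesh_element: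
  assumes v: "v \<in> broken_P1 \<T>" and y: "y \<in> broken_P1 \<T>" and T: "T \<in> \<T>"
    and const: "\<And>S. S facet_of T \<Longrightarrow> \<exists>c. \<forall>x\<in>S. elem_trace T y x \<bullet> outer_normal T S = c"
  shows "(\<Sum>S | S facet_of T. side_area S * flux y T S * elem_trace T v (side_centroid S))
    = measure lebesgue T * (y (centroid T) \<bullet> elem_grad v T + div_h \<T> y (centroid T) * v (centroid T))"
proof -
  obtain A a where A: "linear A" "\<And>x. x \<in> interior T \<Longrightarrow> y x = A x + a"
    "\<And>x. x \<in> interior T \<Longrightarrow> div_h \<T> y x = (\<Sum>b\<in>Basis. A b \<bullet> b)"
    "\<And>x. x \<in> T \<Longrightarrow> elem_trace T y x = A x + a"
    by (rule P1_div[OF y T]) (rule that)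
  show ?thesis
    unfolding A(3)[OF centroid_interior[OF T]]
    by (rule gauss_element[OF simplex_T[OF T] P1_grad(1)[OF v T] A(1,2) const])
qed

text \<open>Sum the Gauss theorem over the elements and collect the terms by sides. At an interior side
  the fluxes from the two elements cancel, because the function has the same value there on both
  elements.\<close>

lemma integration_by_parts:
  assumes v: "v \<in> CR \<Omega> \<T>" and y: "y \<in> RT \<Omega> \<T>"
  shows "(\<Sum>T\<in>\<T>. measure lebesgue T * (y (centroid T) \<bullet> elem_grad v T + div_h \<T> y (centroid T) * v (centroid T)))
    = (\<Sum>S\<in>B. side_area S * (flux y (bd_element S) S * side_value v S))"
proof -
  have "(\<Sum>T\<in>\<T>. measure lebesgue T * (y (centroid T) \<bullet> elem_grad v T + div_h \<T> y (centroid T) * v (centroid T)))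
      = (\<Sum>T\<in>\<T>. \<Sum>S | S facet_of T. side_area S * flux y T S * side_value v S)"
  proof (intro sum.cong refl)
    fix T assume T: "T \<in> \<T>"
    have "(\<Sum>S | S facet_of T. side_area S * flux y T S * elem_trace T v (side_centroid S))
      = measure lebesgue T * (y (centroid T) \<bullet> elem_grad v T + div_h \<T> y (centroid T) * v (centroid T))"
      by (rule gauss_mesh_element[OF CR_P1[OF v] RT_P1[OF y] T]) (use RT_flux_const[OF y T] in blast)
    then show "measure lebesgue T * (y (centroid T) \<bullet> elem_grad v T + div_h \<T> y (centroid T) * v (centroid T))
      = (\<Sum>S | S facet_of T. side_area S * flux y T S * side_value v S)"
      using side_value_eq[OF v T] by simp
  qed
  also have "\<dots> = (\<Sum>T\<in>\<T>. \<Sum>S | S \<in> sides \<T> \<and> S facet_of T. side_area S * flux y T S * side_value v S)"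
    by (intro sum.cong refl) (auto simp: sides_def)
  also have "\<dots> = (\<Sum>S\<in>sides \<T>. \<Sum>T | T \<in> \<T> \<and> S facet_of T. side_area S * flux y T S * side_value v S)"
    by (rule sum.swap_restrict[OF finite_T finite_sides])
  also have "\<dots> = (\<Sum>S\<in>sides \<T>. if S \<in> B then side_area S * (flux y (bd_element S) S * side_value v S) else 0)"
  proof (intro sum.cong refl)
    fix S assume S: "S \<in> sides \<T>"
    show "(\<Sum>T | T \<in> \<T> \<and> S facet_of T. side_area S * flux y T S * side_value v S)
        = (if S \<in> B then side_area S * (flux y (bd_element S) S * side_value v S) else 0)"
    proof (cases "S \<in> B")
      case True
      have "{T. T \<in> \<T> \<and> S facet_of T} = {bd_element S}" using boundary_element[OF True] by blast
      then show ?thesis using True by simp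
    next
      case False
      then have "S \<in> interior_sides \<Omega> \<T>" using S by (simp add: interior_sides_def)
      then obtain T T' where TT: "T \<noteq> T'" "{T \<in> \<T>. S facet_of T} = {T, T'}" using interior_side_elements by metis
      then have "flux y T S + flux y T' S = 0" by (intro RT_flux_opposite[OF y]) auto
      then have "side_area S * flux y T S * side_value v S + side_area S * flux y T' S * side_value v S = 0"
        by (simp flip: distrib_left distrib_right)
      then show ?thesis using TT False by simp
    qed
  qed
  also have "\<dots> = (\<Sum>S\<in>B. side_area S * (flux y (bd_element S) S * side_value v S))"
    using finite_sides B_sides by (simp add: sum.If_cases Int_absorb1 subset_iff)
  finally show ?thesis .
qed

text \<open>Test the element-wise Gauss theorem with constant fields.\<close>

lemma elem_grad_from_sides:
  assumes v: "v \<in> broken_P1 \<T>" and T: "T \<in> \<T>"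
  shows "elem_grad v T = (1 / measure lebesgue T) *\<^sub>R
      (\<Sum>S | S facet_of T. (side_area S * elem_trace T v (side_centroid S)) *\<^sub>R outer_normal T S)"
proof -
  let ?s = "\<Sum>S | S facet_of T. (side_area S * elem_trace T v (side_centroid S)) *\<^sub>R outer_normal T S"
  have key: "a \<bullet> ?s = measure lebesgue T * (a \<bullet> elem_grad v T)" for a
  proof -
    have y: "(\<lambda>_. a) \<in> broken_P1 \<T>" unfolding broken_P1_def
      by (auto intro!: exI[of _ "\<lambda>_. 0"] simp: linear_zero)
    obtain C g where "frame C g" and TC: "T = convex hull C" using simplex_frame[OF simplex_T[OF T]] .
    then interpret frame C g by simp
    have tr: "elem_trace T (\<lambda>_. a) x = a" if "x \<in> T" for x
      using elem_trace_affine[of "\<lambda>_. 0" "\<lambda>_. a" a x] that by (simp add: TC linear_zero)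
    have div: "div_h \<T> (\<lambda>_. a) (centroid T) = 0"
      using centroid_interior[OF T] T by (auto simp: div_h_def)
    have fl: "flux (\<lambda>_. a) T S = a \<bullet> outer_normal T S" if "S facet_of T" for S
    proof -
      have "side_centroid S \<in> T" using side_centroid_rel_interior[OF T that] rel_interior_subset facet_subset[OF that] by blast
      then show ?thesis by (simp add: flux_def tr)
    qed
    have "(\<Sum>S | S facet_of T. side_area S * flux (\<lambda>_. a) T S * elem_trace T v (side_centroid S))
      = measure lebesgue T * (a \<bullet> elem_grad v T + div_h \<T> (\<lambda>_. a) (centroid T) * v (centroid T))"
      by (rule gauss_mesh_element[OF v y T]) (use tr facet_subset in \<open>metis subsetD\<close>)
    then show ?thesis
      by (simp add: fl div inner_sum_right mult.assoc mult.left_commute mult.commute)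
  qed
  have "(?s - measure lebesgue T *\<^sub>R elem_grad v T) \<bullet> (?s - measure lebesgue T *\<^sub>R elem_grad v T) = 0"
    using key[of "?s - measure lebesgue T *\<^sub>R elem_grad v T"] by (simp add: inner_diff_right)
  then have "?s = measure lebesgue T *\<^sub>R elem_grad v T" by simp
  then show ?thesis using measure_pos[OF T] by simp
qed

end

section \<open>Finite-dimensional duality\<close>

text \<open>The projection onto the ball of radius \<open>r\<close>; it is the gradient of \<open>huber
  r\<close>.\<close>

definition prox :: "real \<Rightarrow> 'a::euclidean_space \<Rightarrow> 'a" where
  "prox r s = (if norm s \<le> r then s else (r / norm s) *\<^sub>R s)"

text \<open>The conjugate of half the squared norm restricted to the ball of radius
  \<open>r\<close>.\<close>

definition huber :: "real \<Rightarrow> 'a::euclidean_space \<Rightarrow> real" where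
  "huber r s = (if norm s \<le> r then (norm s)\<^sup>2 / 2 else r * norm s - r\<^sup>2 / 2)"

lemma phi_star_huber: "phi_star \<zeta> x = huber (\<zeta> x)"
  by (simp add: phi_star_def huber_def fun_eq_iff)

context
  fixes r :: real
  assumes r: "0 < r"
begin

lemma norm_prox: "norm (prox r s) \<le> r"
  using r by (auto simp: prox_def)

lemma huber_prox: "huber r s = s \<bullet> prox r s - (norm (prox r s))\<^sup>2 / 2"
proof (cases "norm s \<le> r")
  case True
  then show ?thesis by (simp add: huber_def prox_def dot_square_norm)
next
  case False
  then have "norm s > 0" using r by linarith
  then have "norm (prox r s) = r" "s \<bullet> prox r s = r * norm s"
    using False r by (simp_all add: prox_def dot_square_norm power2_eq_square)
  then show ?thesis using False by (simp add: huber_def)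
qed

lemma prox_variational:
  assumes t: "norm t \<le> r"
  shows "(s - prox r s) \<bullet> (t - prox r s) \<le> 0"
proof (cases "norm s \<le> r")
  case False
  then have s: "norm s > 0" using r by linarith
  have "s - prox r s = (1 - r / norm s) *\<^sub>R s" using False by (simp add: prox_def algebra_simps)
  moreover have "s \<bullet> (t - prox r s) \<le> 0"
  proof -
    have "s \<bullet> t \<le> norm s * norm t" by (rule norm_cauchy_schwarz)
    also have "\<dots> \<le> norm s * r" using t by (intro mult_left_mono) auto
    finally show ?thesis using False s by (simp add: prox_def inner_diff_right dot_square_norm power2_eq_square mult.commute)
  qed
  moreover have "0 \<le> 1 - r / norm s" using False s by (simp add: field_simps)
  ultimately show ?thesis by (simp add: mult_nonneg_nonpos)
qed (simp add: prox_def)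

text \<open>The gap in the Fenchel-Young inequality differs from the left-hand side by the product in
  the variational inequality of the projection.\<close>

lemma young_gap:
  assumes t: "norm t \<le> r"
  shows "(norm (t - prox r s))\<^sup>2 / 2 \<le> (norm t)\<^sup>2 / 2 + huber r s - s \<bullet> t"
proof -
  have "(norm t)\<^sup>2 / 2 + huber r s - s \<bullet> t - (norm (t - prox r s))\<^sup>2 / 2
      = - ((s - prox r s) \<bullet> (t - prox r s))"
    unfolding huber_prox by (simp add: power2_norm_eq_inner inner_diff_left inner_diff_right inner_commute field_simps)
  then show ?thesis using prox_variational[OF t, of s] by linarith
qed

lemma huber_ge: "norm t \<le> r \<Longrightarrow> s \<bullet> t - (norm t)\<^sup>2 / 2 \<le> huber r s"
  using young_gap[of t s] zero_le_power2[of "norm (t - prox r s)"] by linarith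

lemma huber_convex: "huber r s + prox r s \<bullet> (s' - s) \<le> huber r s'"
  using huber_ge[OF norm_prox, of s' s] huber_prox[of s] by (simp add: inner_diff_right inner_commute[of "prox r s"])

text \<open>Add the variational inequalities of the two projections.\<close>

lemma prox_nonexpansive: "norm (prox r s' - prox r s) \<le> norm (s' - s)"
proof -
  let ?d = "prox r s' - prox r s"
  have "(s - prox r s) \<bullet> ?d \<le> 0" by (rule prox_variational[OF norm_prox])
  moreover have "(s' - prox r s') \<bullet> (prox r s - prox r s') \<le> 0" by (rule prox_variational[OF norm_prox])
  ultimately have "(norm ?d)\<^sup>2 \<le> (s' - s) \<bullet> ?d"
    by (simp add: power2_norm_eq_inner inner_diff_left inner_diff_right inner_commute)
  also have "\<dots> \<le> norm (s' - s) * norm ?d" by (rule norm_cauchy_schwarz)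
  finally have "norm ?d * norm ?d \<le> norm (s' - s) * norm ?d" by (simp add: power2_eq_square)
  then show ?thesis by (cases "norm ?d = 0") (simp_all add: mult_le_cancel_right)
qed

text \<open>By convexity at \<open>s'\<close> the error of the linearization is at most the change of
  the gradient times the distance.\<close>

lemma huber_upper: "huber r s' \<le> huber r s + prox r s \<bullet> (s' - s) + (norm (s' - s))\<^sup>2"
proof -
  have "huber r s' + prox r s' \<bullet> (s - s') \<le> huber r s" by (rule huber_convex)
  then have "huber r s' \<le> huber r s + prox r s \<bullet> (s' - s) + (prox r s' - prox r s) \<bullet> (s' - s)"
    by (simp add: inner_diff_left inner_diff_right)
  also have "(prox r s' - prox r s) \<bullet> (s' - s) \<le> norm (prox r s' - prox r s) * norm (s' - s)"
    by (rule norm_cauchy_schwarz)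
  also have "\<dots> \<le> norm (s' - s) * norm (s' - s)"
    by (intro mult_right_mono prox_nonexpansive) simp
  finally show ?thesis by (simp add: power2_eq_square)
qed

lemma huber_gradient: "GDERIV (huber r) s :> prox r s"
  unfolding gderiv_def has_derivative_iff_norm
proof
  show "bounded_linear (\<lambda>h. h \<bullet> prox r s)" by (rule bounded_linear_inner_left)
  show "((\<lambda>y. norm (huber r y - huber r s - (y - s) \<bullet> prox r s) / norm (y - s)) \<longlongrightarrow> 0) (at s)"
  proof (rule tendsto_sandwich[of "\<lambda>_. 0" _ _ "\<lambda>y. norm (y - s)"])
    show "\<forall>\<^sub>F y in at s. norm (huber r y - huber r s - (y - s) \<bullet> prox r s) / norm (y - s) \<le> norm (y - s)"
    proof (rule always_eventually, rule allI)
      fix y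
      have "\<bar>huber r y - huber r s - (y - s) \<bullet> prox r s\<bar> \<le> (norm (y - s))\<^sup>2"
        using huber_upper[of y s] huber_convex[of s y] zero_le_power2[of "norm (y - s)"]
        by (simp add: inner_commute[of "y - s"] abs_le_iff)
      then show "norm (huber r y - huber r s - (y - s) \<bullet> prox r s) / norm (y - s) \<le> norm (y - s)"
        by (cases "y = s") (simp_all add: divide_le_eq power2_eq_square)
    qed
    have "((\<lambda>y. norm (y - s)) \<longlongrightarrow> norm (s - s)) (at s)" by (intro tendsto_intros)
    then show "((\<lambda>y. norm (y - s)) \<longlongrightarrow> 0) (at s)" by simp
  qed auto
qed

text \<open>Completing the square.\<close>

lemma huber_coercive: "r * norm s - r\<^sup>2 / 2 \<le> huber r s"
proof (cases "norm s \<le> r")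
  case True
  have "0 \<le> (norm s - r)\<^sup>2" by simp
  then show ?thesis using True by (simp add: huber_def power2_diff mult.commute)
qed (simp add: huber_def)

lemma continuous_huber: "continuous_on UNIV (huber r)"
  using huber_gradient by (auto simp: gderiv_def continuous_on_eq_continuous_at intro: has_derivative_continuous)

end

text \<open>Element-wise constant fields are functions on a finite set \<open>\<T>\<close> of elements, with the volumes \<open>m\<close> as
  weights. Their number varies, so that these fields do not form one Euclidean type; orthogonality and
  projections refer to the inner product below.\<close>

locale weighted_sum =
  fixes \<T> :: "'b set" and m :: "'b \<Rightarrow> real"
  assumes fin: "finite \<T>" and m: "T \<in> \<T> \<Longrightarrow> 0 < m T"
begin

text \<open>The inner product of element-wise constant fields, given by their values on the
  elements.\<close>

definition weighted_inner :: "('b \<Rightarrow> 'a::euclidean_space) \<Rightarrow> ('b \<Rightarrow> 'a) \<Rightarrow> real" where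
  "weighted_inner x y = (\<Sum>T\<in>\<T>. m T * (x T \<bullet> y T))"

lemma weighted_inner_add: "weighted_inner (\<lambda>T. x T + t *\<^sub>R y T) z = weighted_inner x z + t * weighted_inner y z"
  by (simp add: weighted_inner_def inner_add_left distrib_left sum.distrib sum_distrib_left mult.left_commute)

lemma weighted_inner_diff: "weighted_inner (\<lambda>T. x T - y T) z = weighted_inner x z - weighted_inner y z"
  by (simp add: weighted_inner_def inner_diff_left right_diff_distrib sum_subtractf)

lemma weighted_inner_sum: "weighted_inner (\<lambda>T. \<Sum>i\<in>I. c i *\<^sub>R h i T) z = (\<Sum>i\<in>I. c i * weighted_inner (h i) z)"
proof -
  have "weighted_inner (\<lambda>T. \<Sum>i\<in>I. c i *\<^sub>R h i T) z = (\<Sum>T\<in>\<T>. \<Sum>i\<in>I. c i * (m T * (h i T \<bullet> z T)))"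
    by (simp add: weighted_inner_def inner_sum_left sum_distrib_left mult.left_commute)
  also have "\<dots> = (\<Sum>i\<in>I. \<Sum>T\<in>\<T>. c i * (m T * (h i T \<bullet> z T)))" by (rule sum.swap)
  finally show ?thesis by (simp add: weighted_inner_def sum_distrib_left)
qed

lemma weighted_inner_commute: "weighted_inner x y = weighted_inner y x"
  by (simp add: weighted_inner_def inner_commute)

lemma weighted_inner_cong: "(\<And>T. T \<in> \<T> \<Longrightarrow> x T = x' T) \<Longrightarrow> weighted_inner x z = weighted_inner x' z"
  by (simp add: weighted_inner_def)

lemma weighted_inner_self: "0 \<le> weighted_inner x x" "weighted_inner x x = 0 \<Longrightarrow> T \<in> \<T> \<Longrightarrow> x T = 0"
proof -
  have pos: "0 \<le> m T * (x T \<bullet> x T)" if "T \<in> \<T>" for T using m[OF that] by simp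
  then show "0 \<le> weighted_inner x x" by (simp add: weighted_inner_def sum_nonneg)
  assume "weighted_inner x x = 0" "T \<in> \<T>"
  then have "m T * (x T \<bullet> x T) = 0"
    using sum_nonneg_eq_0_iff[OF fin, of "\<lambda>T. m T * (x T \<bullet> x T)"] pos by (simp add: weighted_inner_def)
  then show "x T = 0" using m[OF \<open>T \<in> \<T>\<close>] by simp
qed

text \<open>The Gram system of a possibly dependent family \<open>h\<close> is solvable if the
  right-hand side respects all linear relations of the family. By induction on the size of the family:
  let \<open>r\<close> be the component of the new vector \<open>h k\<close> that is orthogonal to the
  others. If \<open>r\<close> vanishes then the relation determines the new entry of the right-hand
  side; otherwise a multiple of \<open>r\<close> corrects the solution.\<close>

lemma gram_solvable:
  assumes "finite I"
    and "\<And>c. (\<And>T. T \<in> \<T> \<Longrightarrow> (\<Sum>i\<in>I. c i *\<^sub>R h i T) = 0) \<Longrightarrow> (\<Sum>i\<in>I. c i * l i) = 0"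
  shows "\<exists>a. \<forall>i\<in>I. weighted_inner (\<lambda>T. \<Sum>j\<in>I. a j *\<^sub>R h j T) (h i) = (l i :: real)"
  using assms
proof (induction I arbitrary: l rule: finite_induct)
  case empty
  then show ?case by simp
next
  case (insert k I)
  have sum_upd: "(\<Sum>j\<in>I. (f(k := t)) j *\<^sub>R h j T) = (\<Sum>j\<in>I. f j *\<^sub>R h j T)" for f t T
    using insert.hyps by (intro sum.cong) auto
  have sum_upd': "(\<Sum>j\<in>I. (f(k := t)) j * l j) = (\<Sum>j\<in>I. f j * l j)" for f t
    using insert.hyps by (intro sum.cong) auto
  have "\<exists>d. \<forall>i\<in>I. weighted_inner (\<lambda>T. \<Sum>j\<in>I. d j *\<^sub>R h j T) (h i) = weighted_inner (h k) (h i)"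
  proof (rule insert.IH)
    fix c assume c: "\<And>T. T \<in> \<T> \<Longrightarrow> (\<Sum>i\<in>I. c i *\<^sub>R h i T) = 0"
    have "(\<Sum>i\<in>I. c i * weighted_inner (h k) (h i)) = weighted_inner (\<lambda>T. \<Sum>i\<in>I. c i *\<^sub>R h i T) (h k)"
      unfolding weighted_inner_sum by (simp add: weighted_inner_commute)
    also have "\<dots> = 0" by (simp add: weighted_inner_def c)
    finally show "(\<Sum>i\<in>I. c i * weighted_inner (h k) (h i)) = 0" .
  qed
  then obtain d where d: "\<And>i. i \<in> I \<Longrightarrow> weighted_inner (\<lambda>T. \<Sum>j\<in>I. d j *\<^sub>R h j T) (h i) = weighted_inner (h k) (h i)" by blast
  have "\<exists>a. \<forall>i\<in>I. weighted_inner (\<lambda>T. \<Sum>j\<in>I. a j *\<^sub>R h j T) (h i) = l i"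
  proof (rule insert.IH)
    fix c assume c: "\<And>T. T \<in> \<T> \<Longrightarrow> (\<Sum>i\<in>I. c i *\<^sub>R h i T) = 0"
    have "(\<Sum>i\<in>insert k I. (c(k := 0)) i * l i) = 0"
      by (rule insert.prems) (use insert.hyps c in \<open>simp add: sum_upd del: fun_upd_apply, simp\<close>)
    then show "(\<Sum>i\<in>I. c i * l i) = 0" using insert.hyps sum_upd'[of c 0] by simp
  qed
  then obtain a where a: "\<And>i. i \<in> I \<Longrightarrow> weighted_inner (\<lambda>T. \<Sum>j\<in>I. a j *\<^sub>R h j T) (h i) = l i" by blast
  define r where "r = (\<lambda>T. h k T - (\<Sum>j\<in>I. d j *\<^sub>R h j T))"
  define x where "x = (\<lambda>T. \<Sum>j\<in>I. a j *\<^sub>R h j T)"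
  have ri: "weighted_inner r (h i) = 0" if "i \<in> I" for i unfolding r_def weighted_inner_diff using d[OF that] by simp
  have rk: "weighted_inner r (h k) = weighted_inner r r"
  proof -
    have "weighted_inner r r = weighted_inner (h k) r - weighted_inner (\<lambda>T. \<Sum>j\<in>I. d j *\<^sub>R h j T) r" by (subst (1) r_def) (rule weighted_inner_diff)
    also have "weighted_inner (\<lambda>T. \<Sum>j\<in>I. d j *\<^sub>R h j T) r = 0" unfolding weighted_inner_sum using ri by (simp add: weighted_inner_commute[of _ r])
    finally show ?thesis by (simp add: weighted_inner_commute)
  qed
  show ?case
  proof (cases "weighted_inner r r = 0")
    case True
    then have r0: "r T = 0" if "T \<in> \<T>" for T using weighted_inner_self(2) that by blast
    have "(\<Sum>i\<in>insert k I. ((\<lambda>i. - d i)(k := 1)) i * l i) = 0"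
    proof (rule insert.prems)
      fix T assume "T \<in> \<T>"
      then have "h k T = (\<Sum>j\<in>I. d j *\<^sub>R h j T)" using r0 by (simp add: r_def)
      then show "(\<Sum>i\<in>insert k I. ((\<lambda>i. - d i)(k := 1)) i *\<^sub>R h i T) = 0"
        using insert.hyps sum_upd[of "\<lambda>i. - d i" 1 T] by (simp add: sum_negf)
    qed
    then have lk: "l k = (\<Sum>j\<in>I. d j * l j)"
      using insert.hyps sum_upd'[of "\<lambda>i. - d i" 1] by (simp add: sum_negf)
    have "weighted_inner x (h k) = weighted_inner (h k) x" by (rule weighted_inner_commute)
    also have "\<dots> = weighted_inner (\<lambda>T. \<Sum>j\<in>I. d j *\<^sub>R h j T) x" by (rule weighted_inner_cong) (use r0 in \<open>simp add: r_def\<close>)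
    also have "\<dots> = (\<Sum>j\<in>I. d j * l j)" unfolding weighted_inner_sum
      by (intro sum.cong refl) (use a in \<open>simp add: x_def weighted_inner_commute[of "h _"]\<close>)
    finally have "weighted_inner x (h k) = l k" by (simp add: lk)
    moreover have "(\<lambda>T. \<Sum>j\<in>insert k I. (a(k := 0)) j *\<^sub>R h j T) = x"
      using insert.hyps sum_upd[of a 0] by (simp add: x_def)
    ultimately have "\<forall>i\<in>insert k I. weighted_inner (\<lambda>T. \<Sum>j\<in>insert k I. (a(k := 0)) j *\<^sub>R h j T) (h i) = l i"
      using a by (simp add: x_def)
    then show ?thesis by (intro exI[of _ "a(k := 0)"])
  next
    case False
    define t where "t = (l k - weighted_inner x (h k)) / weighted_inner r r"
    define b where "b = (\<lambda>j. a j - t * d j)(k := t)"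
    have "(\<lambda>T. \<Sum>j\<in>insert k I. b j *\<^sub>R h j T) = (\<lambda>T. x T + t *\<^sub>R r T)"
    proof
      fix T
      have "(\<Sum>j\<in>insert k I. b j *\<^sub>R h j T) = t *\<^sub>R h k T + (\<Sum>j\<in>I. (a j - t * d j) *\<^sub>R h j T)"
        using insert.hyps sum_upd[of "\<lambda>j. a j - t * d j" t T] by (simp add: b_def)
      also have "\<dots> = x T + t *\<^sub>R r T"
        by (simp add: x_def r_def scaleR_diff_left sum_subtractf scaleR_diff_right scaleR_sum_right)
      finally show "(\<Sum>j\<in>insert k I. b j *\<^sub>R h j T) = x T + t *\<^sub>R r T" .
    qed
    moreover have "weighted_inner (\<lambda>T. x T + t *\<^sub>R r T) (h i) = l i" if "i \<in> insert k I" for i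
    proof (cases "i = k")
      case True
      then show ?thesis using False by (simp add: weighted_inner_add rk t_def)
    next
      case ne: False
      then have "i \<in> I" using that by simp
      then show ?thesis using a[of i] ri[of i] by (simp add: weighted_inner_add x_def)
    qed
    ultimately have "\<forall>i\<in>insert k I. weighted_inner (\<lambda>T. \<Sum>j\<in>insert k I. b j *\<^sub>R h j T) (h i) = l i" by simp
    then show ?thesis by (intro exI[of _ b])
  qed
qed

text \<open>The functional \<open>E\<close> is minus the dual energy up to a constant, \<open>q\<close>
  the gradient of a strictly admissible lift, and \<open>h\<close> the family of gradients of the free
  basis functions. As \<open>norm (q T) < \<zeta> T\<close>, sublevel sets of \<open>E\<close> are
  bounded, and a minimizer \<open>z\<close> under the linear constraints exists. Its first order
  condition says that the gradient \<open>g\<close> of \<open>E\<close> is orthogonal to every field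
  orthogonal to the family \<open>h\<close>; projecting \<open>g\<close> onto the span of
  \<open>h\<close> shows that \<open>g\<close> lies in it.\<close>

lemma strong_duality_finite:
  fixes h :: "'i \<Rightarrow> 'b \<Rightarrow> 'a::euclidean_space" and l :: "'i \<Rightarrow> real"
  assumes I: "finite I" and \<zeta>: "\<And>T. T \<in> \<T> \<Longrightarrow> 0 < \<zeta> T"
    and slater: "\<And>T. T \<in> \<T> \<Longrightarrow> norm (q T) < \<zeta> T"
    and consistent: "\<And>c. (\<And>T. T \<in> \<T> \<Longrightarrow> (\<Sum>i\<in>I. c i *\<^sub>R h i T) = 0) \<Longrightarrow> (\<Sum>i\<in>I. c i * l i) = 0"
  obtains z c where "\<And>i. i \<in> I \<Longrightarrow> weighted_inner z (h i) = l i"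
    "\<And>T. T \<in> \<T> \<Longrightarrow> prox (\<zeta> T) (z T) = q T + (\<Sum>i\<in>I. c i *\<^sub>R h i T)"
proof -
  define E where "E = (\<lambda>z. \<Sum>T\<in>\<T>. m T * (huber (\<zeta> T) (z T) - q T \<bullet> z T))"
  define feas where "feas = {z. \<forall>i\<in>I. weighted_inner z (h i) = l i}"
  \<comment> \<open>Only the values on \<open>\<T>\<close> matter; extension by zero makes the set of candidates compact.\<close>
  define cut where "cut = (\<lambda>z T. if T \<in> \<T> then z T else (0::'a))"
  have cut: "E (cut z) = E z" "weighted_inner (cut z) w = weighted_inner z w" for z w
    by (simp_all add: E_def weighted_inner_def cut_def)
  obtain a where a: "\<forall>i\<in>I. weighted_inner (\<lambda>T. \<Sum>j\<in>I. a j *\<^sub>R h j T) (h i) = l i"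
    using gram_solvable[OF I consistent] by blast
  define z0 where "z0 = cut (\<lambda>T. \<Sum>j\<in>I. a j *\<^sub>R h j T)"
  have z0: "z0 \<in> feas" using a by (simp add: feas_def z0_def cut)
  have summand: "(\<zeta> T - norm (q T)) * norm s - (\<zeta> T)\<^sup>2 / 2 \<le> huber (\<zeta> T) s - q T \<bullet> s" if "T \<in> \<T>" for T s
    using huber_coercive[OF \<zeta>[OF that], of s] norm_cauchy_schwarz[of "q T" s] by (simp add: left_diff_distrib)
  define K where "K = E z0 + (\<Sum>T\<in>\<T>. m T * ((\<zeta> T)\<^sup>2 / 2))"
  define R where "R = (\<lambda>T. K / (m T * (\<zeta> T - norm (q T))))"
  have bound: "norm (z T) \<le> R T" if z: "E z \<le> E z0" and T: "T \<in> \<T>" for z T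
  proof -
    have nn: "0 \<le> m T' * (huber (\<zeta> T') (z T') - q T' \<bullet> z T' + (\<zeta> T')\<^sup>2 / 2)" if "T' \<in> \<T>" for T'
    proof -
      have "0 \<le> (\<zeta> T' - norm (q T')) * norm (z T')" using slater[OF that] by simp
      then show ?thesis using summand[OF that, of "z T'"] m[OF that] by simp
    qed
    have "(m T * (\<zeta> T - norm (q T))) * norm (z T) \<le> m T * (huber (\<zeta> T) (z T) - q T \<bullet> z T + (\<zeta> T)\<^sup>2 / 2)"
      using summand[OF T, of "z T"] m[OF T] by (simp add: mult.assoc mult_left_mono)
    also have "\<dots> \<le> (\<Sum>T\<in>\<T>. m T * (huber (\<zeta> T) (z T) - q T \<bullet> z T + (\<zeta> T)\<^sup>2 / 2))"
      using fin T nn by (intro member_le_sum) auto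
    also have "\<dots> = E z + (\<Sum>T\<in>\<T>. m T * ((\<zeta> T)\<^sup>2 / 2))"
      by (simp add: E_def distrib_left sum.distrib)
    also have "\<dots> \<le> K" using z by (simp add: K_def)
    finally have "(m T * (\<zeta> T - norm (q T))) * norm (z T) \<le> K" .
    moreover have "0 < m T * (\<zeta> T - norm (q T))" using m[OF T] slater[OF T] by simp
    ultimately show ?thesis by (simp add: R_def pos_le_divide_eq mult.commute)
  qed
  define C where "C = PiE UNIV (\<lambda>T. if T \<in> \<T> then cball (0::'a) (R T) else {0})"
  have "compactin (product_topology (\<lambda>i::'b. euclidean) UNIV) C"
    unfolding C_def compactin_PiE by (auto simp: compactin_euclidean_iff)
  then have "compact C" by (simp add: euclidean_product_topology compactin_euclidean_iff)
  have coord: "continuous_on A (\<lambda>z::'b \<Rightarrow> 'a. z T)" for A T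
    by (rule continuous_on_subset[OF continuous_on_product_coordinates]) simp
  have "closed feas"
  proof -
    have "closed {z. weighted_inner z (h i) = l i}" for i
      unfolding weighted_inner_def by (intro closed_Collect_eq continuous_intros coord)
    moreover have "feas = (\<Inter>i\<in>I. {z. weighted_inner z (h i) = l i})" by (auto simp: feas_def)
    ultimately show ?thesis by (simp add: closed_INT)
  qed
  with \<open>compact C\<close> have "compact (C \<inter> feas)" by (rule compact_Int_closed)
  moreover have inC: "cut z \<in> C" if "E z \<le> E z0" for z
    using bound[OF that] by (auto simp: C_def cut_def)
  have "cut z0 = z0" by (auto simp: z0_def cut_def)
  then have "z0 \<in> C \<inter> feas" using inC[of z0] z0 by simp
  then have "C \<inter> feas \<noteq> {}" by blast
  moreover have "continuous_on (C \<inter> feas) E" unfolding E_def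
  proof (intro continuous_on_sum continuous_on_mult continuous_on_const continuous_on_diff continuous_on_inner coord)
    fix T assume "T \<in> \<T>"
    show "continuous_on (C \<inter> feas) (\<lambda>z. huber (\<zeta> T) (z T))"
      by (rule continuous_on_compose2[OF continuous_huber[OF \<zeta>[OF \<open>T \<in> \<T>\<close>]] coord]) simp
  qed
  ultimately obtain z where z: "z \<in> C \<inter> feas" "\<And>w. w \<in> C \<inter> feas \<Longrightarrow> E z \<le> E w"
    using continuous_attains_inf[of "C \<inter> feas" E] by blast
  have min: "E z \<le> E w" if w: "w \<in> feas" for w
  proof (cases "E w \<le> E z0")
    case True
    have "cut w \<in> C \<inter> feas" using inC[OF True] w by (simp add: feas_def cut)
    from z(2)[OF this] show ?thesis by (simp add: cut)
  next
    case False
    then show ?thesis using z(2)[OF \<open>z0 \<in> C \<inter> feas\<close>] by linarith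
  qed
  define g where "g = (\<lambda>T. prox (\<zeta> T) (z T) - q T)"
  have orth: "weighted_inner g w = 0" if w: "\<And>i. i \<in> I \<Longrightarrow> weighted_inner w (h i) = 0" for w
  proof -
    have up: "E (\<lambda>T. z T + t *\<^sub>R w T) \<le> E z + t * weighted_inner g w + t\<^sup>2 * weighted_inner w w" for t
    proof -
      have "E (\<lambda>T. z T + t *\<^sub>R w T) \<le> (\<Sum>T\<in>\<T>. m T * (huber (\<zeta> T) (z T) - q T \<bullet> z T)
          + t * (m T * (g T \<bullet> w T)) + t\<^sup>2 * (m T * (w T \<bullet> w T)))"
        unfolding E_def
      proof (rule sum_mono)
        fix T assume T: "T \<in> \<T>"
        have "huber (\<zeta> T) (z T + t *\<^sub>R w T) \<le> huber (\<zeta> T) (z T) + t * (prox (\<zeta> T) (z T) \<bullet> w T) + t\<^sup>2 * (w T \<bullet> w T)"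
          using huber_upper[OF \<zeta>[OF T], of "z T + t *\<^sub>R w T" "z T"] by (simp add: power_mult_distrib power2_norm_eq_inner)
        then have "huber (\<zeta> T) (z T + t *\<^sub>R w T) - q T \<bullet> (z T + t *\<^sub>R w T)
            \<le> (huber (\<zeta> T) (z T) - q T \<bullet> z T) + t * (g T \<bullet> w T) + t\<^sup>2 * (w T \<bullet> w T)"
          by (simp add: g_def inner_add_right inner_diff_left right_diff_distrib)
        then have "m T * (huber (\<zeta> T) (z T + t *\<^sub>R w T) - q T \<bullet> (z T + t *\<^sub>R w T))
            \<le> m T * ((huber (\<zeta> T) (z T) - q T \<bullet> z T) + t * (g T \<bullet> w T) + t\<^sup>2 * (w T \<bullet> w T))"
          using m[OF T] by (intro mult_left_mono) auto
        then show "m T * (huber (\<zeta> T) (z T + t *\<^sub>R w T) - q T \<bullet> (z T + t *\<^sub>R w T))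
            \<le> m T * (huber (\<zeta> T) (z T) - q T \<bullet> z T) + t * (m T * (g T \<bullet> w T)) + t\<^sup>2 * (m T * (w T \<bullet> w T))"
          by (simp add: distrib_left mult.left_commute)
      qed
      also have "\<dots> = E z + t * weighted_inner g w + t\<^sup>2 * weighted_inner w w"
        by (simp add: E_def weighted_inner_def sum.distrib sum_distrib_left)
      finally show ?thesis .
    qed
    have "(\<lambda>T. z T + t *\<^sub>R w T) \<in> feas" for t
      using z(1) w by (simp add: feas_def weighted_inner_add)
    then have ineq: "0 \<le> t * weighted_inner g w + t\<^sup>2 * weighted_inner w w" for t
      using order_trans[OF min up[of t]] by (simp add: add.assoc)
    \<comment> \<open>The summand 1 makes \<open>W\<close> positive; at \<open>t = - weighted_inner g w / W\<close> the parabola is negative unless its linear term vanishes.\<close>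
    define W where "W = weighted_inner w w + 1"
    have W: "W > 0" using weighted_inner_self(1)[of w] by (simp add: W_def)
    have "0 \<le> (- weighted_inner g w / W) * weighted_inner g w + (- weighted_inner g w / W)\<^sup>2 * weighted_inner w w" by (rule ineq)
    also have "\<dots> \<le> (- weighted_inner g w / W) * weighted_inner g w + (- weighted_inner g w / W)\<^sup>2 * W - (- weighted_inner g w / W)\<^sup>2"
      by (simp add: W_def distrib_left)
    also have "\<dots> = - (weighted_inner g w / W)\<^sup>2" using W by (simp add: power2_eq_square field_simps)
    finally have "(weighted_inner g w / W)\<^sup>2 \<le> 0" by simp
    then show ?thesis using W by simp
  qed
  have "\<exists>c. \<forall>i\<in>I. weighted_inner (\<lambda>T. \<Sum>j\<in>I. c j *\<^sub>R h j T) (h i) = weighted_inner g (h i)"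
  proof (rule gram_solvable[OF I])
    fix c assume c: "\<And>T. T \<in> \<T> \<Longrightarrow> (\<Sum>i\<in>I. c i *\<^sub>R h i T) = 0"
    have "(\<Sum>i\<in>I. c i * weighted_inner g (h i)) = weighted_inner (\<lambda>T. \<Sum>i\<in>I. c i *\<^sub>R h i T) g"
      unfolding weighted_inner_sum by (simp add: weighted_inner_commute)
    also have "\<dots> = 0" by (simp add: weighted_inner_def c)
    finally show "(\<Sum>i\<in>I. c i * weighted_inner g (h i)) = 0" .
  qed
  then obtain c where c: "\<And>i. i \<in> I \<Longrightarrow> weighted_inner (\<lambda>T. \<Sum>j\<in>I. c j *\<^sub>R h j T) (h i) = weighted_inner g (h i)" by blast
  define w where "w = (\<lambda>T. g T - (\<Sum>j\<in>I. c j *\<^sub>R h j T))"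
  have wi: "weighted_inner w (h i) = 0" if "i \<in> I" for i unfolding w_def weighted_inner_diff using c[OF that] by simp
  have "weighted_inner w w = weighted_inner g w - weighted_inner (\<lambda>T. \<Sum>j\<in>I. c j *\<^sub>R h j T) w" by (subst (1) w_def) (rule weighted_inner_diff)
  also have "weighted_inner g w = 0" using wi by (rule orth)
  also have "weighted_inner (\<lambda>T. \<Sum>j\<in>I. c j *\<^sub>R h j T) w = 0" unfolding weighted_inner_sum using wi by (simp add: weighted_inner_commute[of _ w])
  finally have "weighted_inner w w = 0" by simp
  then have "w T = 0" if "T \<in> \<T>" for T using weighted_inner_self(2) that by blast
  then have "prox (\<zeta> T) (z T) = q T + (\<Sum>i\<in>I. c i *\<^sub>R h i T)" if "T \<in> \<T>" for T
    using that by (simp add: w_def g_def algebra_simps)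
  moreover have "weighted_inner z (h i) = l i" if "i \<in> I" for i using z(1) that by (simp add: feas_def)
  ultimately show ?thesis using that by blast
qed

end

section \<open>Discrete functions with prescribed degrees of freedom\<close>

context mesh
begin

lemma elem_trace_eq:
  fixes w :: "'a \<Rightarrow> 'b::euclidean_space"
  assumes "T \<in> \<T>" "linear A" "\<And>x. x \<in> interior T \<Longrightarrow> w x = A x + c" "x \<in> T"
  shows "elem_trace T w x = A x + c"
proof -
  obtain C g where "frame C g" and TC: "T = convex hull C" using simplex_frame[OF simplex_T[OF assms(1)]] .
  then interpret frame C g by simp
  show ?thesis using elem_trace_affine[OF assms(2), of w c x] assms(3,4) unfolding TC by blast
qed

text \<open>The function \<open>1 - d bary p\<close> is 1 at the centroid of the side opposite to
  \<open>p\<close> and 0 at the other side centroids.\<close>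

lemma affine_with_side_values:
  assumes T: "T \<in> \<T>"
  shows "\<exists>G e. \<forall>S. S facet_of T \<longrightarrow> G \<bullet> side_centroid S + e = (s S :: real)"
proof -
  obtain C g where "frame C g" and TC: "T = convex hull C" using simplex_frame[OF simplex_T[OF T]] .
  then interpret frame C g by simp
  let ?d = "real DIM('a)"
  define G where "G = (\<Sum>p\<in>C. (- ?d * s (F p)) *\<^sub>R g p)"
  define e where "e = (\<Sum>p\<in>C. s (F p) * (1 - ?d * (1 / real (Suc DIM('a)) - g p \<bullet> barycentre)))"
  have G: "G \<bullet> x + e = (\<Sum>p\<in>C. s (F p) * (1 - ?d * bary p x))" for x
    unfolding G_def e_def inner_sum_left sum.distrib[symmetric] bary_def
    by (intro sum.cong refl) (simp add: inner_diff_right algebra_simps)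
  have "G \<bullet> side_centroid S + e = s S" if S: "S facet_of T" for S
  proof -
    obtain q where q: "q \<in> C" "S = F q" using S facet_iff unfolding TC by blast
    have "(\<Sum>p\<in>C. s (F p) * (1 - ?d * bary p (face_barycentre q))) = s (F q) * (1 - ?d * bary q (face_barycentre q))"
      using q(1) by (intro sum_single[OF fin q(1)]) (simp add: bary_face_barycentre)
    then show ?thesis using q by (simp add: G side_centroid_F bary_face_barycentre)
  qed
  then show ?thesis by blast
qed

lemma CR_exists:
  "\<exists>v\<in>CR \<Omega> \<T>. \<forall>T\<in>\<T>. \<forall>S. S facet_of T \<longrightarrow> elem_trace T v (side_centroid S) = s S"
proof -
  have "\<forall>T\<in>\<T>. \<exists>Ge. \<forall>S. S facet_of T \<longrightarrow> fst Ge \<bullet> side_centroid S + snd Ge = s S"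
    using affine_with_side_values[of _ s] by simp
  then obtain Ge where Ge: "\<forall>T\<in>\<T>. \<forall>S. S facet_of T \<longrightarrow> fst (Ge T) \<bullet> side_centroid S + snd (Ge T) = s S"
    using bchoice by metis
  define v where "v = (\<lambda>x. \<Sum>T\<in>\<T>. indicator (interior T) x *\<^sub>R (fst (Ge T) \<bullet> x + snd (Ge T)))"
  have vT: "v x = fst (Ge T) \<bullet> x + snd (Ge T)" if "T \<in> \<T>" "x \<in> interior T" for T x
    unfolding v_def using paste[OF that, of "\<lambda>T x. fst (Ge T) \<bullet> x + snd (Ge T)"] .
  have lin: "linear (\<lambda>x. G \<bullet> x)" for G :: 'a by (auto intro!: linearI simp: inner_add_right)
  have P1: "v \<in> broken_P1 \<T>" unfolding broken_P1_def using vT lin by blast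
  have tr: "elem_trace T v (side_centroid S) = s S" if T: "T \<in> \<T>" and S: "S facet_of T" for T S
  proof -
    have "side_centroid S \<in> T" using side_centroid_rel_interior[OF T S] rel_interior_subset facet_subset[OF S] by blast
    then have "elem_trace T v (side_centroid S) = fst (Ge T) \<bullet> side_centroid S + snd (Ge T)"
      by (intro elem_trace_eq[OF T lin[of "fst (Ge T)"], where w=v and c="snd (Ge T)"]) (rule vT[OF T])
    then show ?thesis using Ge T S by simp
  qed
  then have "v \<in> CR \<Omega> \<T>" using CR_iff[OF P1] by simp
  then show ?thesis using tr by blast
qed

definition cr_interpolant :: "('a set \<Rightarrow> real) \<Rightarrow> 'a \<Rightarrow> real" where
  "cr_interpolant s = (SOME v. v \<in> CR \<Omega> \<T> \<and> (\<forall>T\<in>\<T>. \<forall>S. S facet_of T \<longrightarrow> elem_trace T v (side_centroid S) = s S))"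

lemma cr_interpolant: "cr_interpolant s \<in> CR \<Omega> \<T>" "S \<in> sides \<T> \<Longrightarrow> side_value (cr_interpolant s) S = s S"
proof -
  have *: "cr_interpolant s \<in> CR \<Omega> \<T> \<and> (\<forall>T\<in>\<T>. \<forall>S. S facet_of T \<longrightarrow> elem_trace T (cr_interpolant s) (side_centroid S) = s S)"
  proof -
    have "\<exists>v. v \<in> CR \<Omega> \<T> \<and> (\<forall>T\<in>\<T>. \<forall>S. S facet_of T \<longrightarrow> elem_trace T v (side_centroid S) = s S)"
      using CR_exists[of s] by blast
    from someI_ex[OF this] show ?thesis unfolding cr_interpolant_def .
  qed
  then show 1: "cr_interpolant s \<in> CR \<Omega> \<T>" by simp
  assume "S \<in> sides \<T>"
  then obtain T where T: "T \<in> \<T>" "S facet_of T" by (auto simp: sides_def)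
  then show "side_value (cr_interpolant s) S = s S" using * side_value_eq[OF 1 T] by simp
qed

text \<open>Gradient and element average on \<open>T\<close> of the Crouzeix-Raviart hat function of
  \<open>S\<close>.\<close>

definition side_grad :: "'a set \<Rightarrow> 'a set \<Rightarrow> 'a" where
  "side_grad S T = (if S facet_of T then (side_area S / measure lebesgue T) *\<^sub>R outer_normal T S else 0)"

definition side_weight :: "'a set \<Rightarrow> 'a set \<Rightarrow> real" where
  "side_weight S T = (if S facet_of T then side_area S * flux (\<lambda>x. x - centroid T) T S / (real DIM('a) * measure lebesgue T) else 0)"

lemma facets_of_element: "T \<in> \<T> \<Longrightarrow> {S \<in> sides \<T>. S facet_of T} = {S. S facet_of T}"
  by (auto simp: sides_def)

lemma sum_facets:
  assumes "T \<in> \<T>"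
  shows "(\<Sum>S\<in>sides \<T>. if S facet_of T then F S else 0) = (\<Sum>S | S facet_of T. F S)"
  using finite_sides by (simp add: sum.inter_filter[symmetric] facets_of_element[OF assms])

lemma elem_grad_expand:
  assumes v: "v \<in> CR \<Omega> \<T>" and T: "T \<in> \<T>"
  shows "elem_grad v T = (\<Sum>S\<in>sides \<T>. side_value v S *\<^sub>R side_grad S T)"
proof -
  have "(\<Sum>S\<in>sides \<T>. side_value v S *\<^sub>R side_grad S T)
      = (\<Sum>S\<in>sides \<T>. if S facet_of T then (1 / measure lebesgue T) *\<^sub>R ((side_area S * side_value v S) *\<^sub>R outer_normal T S) else 0)"
    by (intro sum.cong refl) (simp add: side_grad_def)
  also have "\<dots> = (1 / measure lebesgue T) *\<^sub>R (\<Sum>S | S facet_of T. (side_area S * side_value v S) *\<^sub>R outer_normal T S)"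
    unfolding sum_facets[OF T] by (simp only: scaleR_sum_right)
  also have "\<dots> = elem_grad v T" unfolding elem_grad_from_sides[OF CR_P1[OF v] T]
    using side_value_eq[OF v T] by simp
  finally show ?thesis ..
qed

text \<open>Test the element-wise Gauss theorem with the field \<open>x - centroid T\<close>, whose
  divergence is \<open>d\<close> and whose average vanishes.\<close>

lemma centroid_value_expand:
  assumes v: "v \<in> CR \<Omega> \<T>" and T: "T \<in> \<T>"
  shows "v (centroid T) = (\<Sum>S\<in>sides \<T>. side_value v S * side_weight S T)"
proof -
  let ?y = "\<lambda>x. x - centroid T"
  have lin: "linear (\<lambda>x::'a. x)" by (simp add: linear_iff)
  have y: "?y x = x + - centroid T" for x by simp
  have P1: "?y \<in> broken_P1 \<T>" unfolding broken_P1_def using lin y by blast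
  have tr: "elem_trace T ?y x = x + - centroid T" if "x \<in> T" for x
    by (rule elem_trace_eq[OF T lin y that])
  have div: "div_h \<T> ?y (centroid T) = real DIM('a)"
  proof -
    have "frechet_derivative ?y (at (centroid T)) = (\<lambda>h. h)"
      by (rule frechet_derivative_at[symmetric]) (auto intro!: derivative_eq_intros)
    then show ?thesis using T centroid_interior[OF T] by (auto simp: div_h_def)
  qed
  have const: "\<exists>c. \<forall>x\<in>S. elem_trace T ?y x \<bullet> outer_normal T S = c" if S: "S facet_of T" for S
  proof -
    have s: "side_centroid S \<in> S" using side_centroid_rel_interior[OF T S] rel_interior_subset by blast
    have "elem_trace T ?y x \<bullet> outer_normal T S = elem_trace T ?y (side_centroid S) \<bullet> outer_normal T S" if x: "x \<in> S" for x
    proof -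
      have "elem_trace T ?y x - elem_trace T ?y (side_centroid S) = x - side_centroid S"
        using tr x s facet_subset[OF S] by (simp add: subset_iff)
      then show ?thesis
        using outer_normal_orthogonal[OF T S x s] by (metis inner_diff_left eq_iff_diff_eq_0)
    qed
    then show ?thesis by blast
  qed
  have "(\<Sum>S | S facet_of T. side_area S * flux ?y T S * elem_trace T v (side_centroid S))
      = measure lebesgue T * (?y (centroid T) \<bullet> elem_grad v T + div_h \<T> ?y (centroid T) * v (centroid T))"
    by (rule gauss_mesh_element[OF CR_P1[OF v] P1 T const])
  then have *: "(\<Sum>S | S facet_of T. side_area S * flux ?y T S * side_value v S) = measure lebesgue T * (real DIM('a) * v (centroid T))"
    using side_value_eq[OF v T] by (simp add: div)
  have "(\<Sum>S\<in>sides \<T>. side_value v S * side_weight S T)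
      = (\<Sum>S\<in>sides \<T>. if S facet_of T then side_area S * flux ?y T S * side_value v S / (real DIM('a) * measure lebesgue T) else 0)"
    by (intro sum.cong refl) (simp add: side_weight_def)
  also have "\<dots> = (\<Sum>S | S facet_of T. side_area S * flux ?y T S * side_value v S) / (real DIM('a) * measure lebesgue T)"
    unfolding sum_facets[OF T] by (simp only: sum_divide_distrib)
  also have "\<dots> = v (centroid T)" unfolding * using measure_pos[OF T] by simp
  finally show ?thesis ..
qed

text \<open>The nodal basis of the Crouzeix-Raviart space.\<close>

lemma hat:
  assumes S: "S \<in> sides \<T>" and v: "v = cr_interpolant (\<lambda>S'. of_bool (S' = S))"
  shows "v \<in> CR \<Omega> \<T>" and "S' \<in> sides \<T> \<Longrightarrow> side_value v S' = of_bool (S' = S)"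
    and "T \<in> \<T> \<Longrightarrow> elem_grad v T = side_grad S T" and "T \<in> \<T> \<Longrightarrow> v (centroid T) = side_weight S T"
proof -
  show 1: "v \<in> CR \<Omega> \<T>" and 2: "\<And>S'. S' \<in> sides \<T> \<Longrightarrow> side_value v S' = of_bool (S' = S)" by (simp_all add: v cr_interpolant)
  have "(\<Sum>S'\<in>sides \<T>. side_value v S' *\<^sub>R side_grad S' T) = side_value v S *\<^sub>R side_grad S T"
    by (rule sum_single[OF finite_sides S]) (simp add: 2)
  then show "elem_grad v T = side_grad S T" if "T \<in> \<T>" using that S by (simp add: elem_grad_expand[OF 1] 2)
  have "(\<Sum>S'\<in>sides \<T>. side_value v S' * side_weight S' T) = side_value v S * side_weight S T"
    by (rule sum_single[OF finite_sides S]) (simp add: 2)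
  then show "v (centroid T) = side_weight S T" if "T \<in> \<T>" using that S by (simp add: centroid_value_expand[OF 1] 2)
qed

lemma P0_eq: "w \<in> broken_P0 \<T> \<Longrightarrow> T \<in> \<T> \<Longrightarrow> x \<in> interior T \<Longrightarrow> w x = w (centroid T)"
  using centroid_interior by (fastforce simp: broken_P0_def)

lemma sides_in_B: "S \<in> sides_in \<Omega> \<T> \<Gamma> \<Longrightarrow> S \<in> B" by (simp add: sides_in_def)

lemma sides_in_interior: "S \<in> sides_in \<Omega> \<T> \<Gamma> \<Longrightarrow> x \<in> rel_interior S \<Longrightarrow> x \<in> \<Gamma>"
  by (auto simp: sides_in_def)

lemma side_centroid_B: "S \<in> B \<Longrightarrow> side_centroid S \<in> rel_interior S"
  using side_centroid_rel_interior boundary_element by blast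

lemma side_P0_eq:
  assumes "w \<in> side_P0 \<Omega> \<T> \<Gamma>" "S \<in> sides_in \<Omega> \<T> \<Gamma>" "x \<in> rel_interior S"
  shows "w x = w (side_centroid S)"
  using assms side_centroid_B[OF sides_in_B[OF assms(2)]] by (fastforce simp: side_P0_def)

end

section \<open>The discrete problems in terms of degrees of freedom\<close>

locale gradient_constrained_problem = mesh \<Omega> \<T> for \<Omega> :: "'a::euclidean_space set" and \<T> +
  fixes \<Gamma>\<^sub>D \<Gamma>\<^sub>N :: "'a set" and f g \<zeta> u\<^sub>D :: "'a \<Rightarrow> real"
  assumes boundary: "mixed_boundary \<Omega> \<T> \<Gamma>\<^sub>D \<Gamma>\<^sub>N"
    and f: "f \<in> broken_P0 \<T>" and g: "g \<in> side_P0 \<Omega> \<T> \<Gamma>\<^sub>N"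
    and zeta: "\<zeta> \<in> broken_P0 \<T>" and zeta_pos: "T \<in> \<T> \<Longrightarrow> 0 < \<zeta> (centroid T)"
    and uD: "u\<^sub>D \<in> side_P0 \<Omega> \<T> \<Gamma>\<^sub>D"
begin

abbreviation "D \<equiv> sides_in \<Omega> \<T> \<Gamma>\<^sub>D"
abbreviation "N \<equiv> sides_in \<Omega> \<T> \<Gamma>\<^sub>N"
abbreviation "m \<equiv> measure lebesgue"
abbreviation "Kcr \<equiv> K_cr \<Omega> \<T> \<Gamma>\<^sub>D \<zeta> u\<^sub>D"
abbreviation "Krt \<equiv> K_rt \<Omega> \<T> \<Gamma>\<^sub>N f g"
abbreviation "Drt \<equiv> D_rt \<Omega> \<T> \<Gamma>\<^sub>D \<Gamma>\<^sub>N f g \<zeta> u\<^sub>D"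

lemma DN: "B = D \<union> N" "D \<inter> N = {}" "finite D" "finite N"
proof -
  have "\<forall>S\<in>B. (S \<in> D) \<noteq> (S \<in> N)" using boundary by (simp add: mixed_boundary_def)
  then show "B = D \<union> N" "D \<inter> N = {}" using sides_in_B by blast+
  then show "finite D" "finite N" using finite_B by (metis finite_Un)+
qed

lemma \<Gamma>_disjoint: "\<Gamma>\<^sub>D \<inter> \<Gamma>\<^sub>N = {}" using boundary by (simp add: mixed_boundary_def)

text \<open>Almost every boundary point lies in the relative interior of a boundary side, and that side
  belongs to exactly one of the two parts of the boundary.\<close>

lemma AE_part:
  assumes \<Gamma>: "\<Gamma> = \<Gamma>\<^sub>D \<or> \<Gamma> = \<Gamma>\<^sub>N"
    and P: "\<And>S x. S \<in> sides_in \<Omega> \<T> \<Gamma> \<Longrightarrow> x \<in> rel_interior S \<Longrightarrow> P x \<longleftrightarrow> Q S"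
  shows "(AE x in bd_measure \<Omega> \<T>. x \<in> \<Gamma> \<longrightarrow> P x) \<longleftrightarrow> (\<forall>S\<in>sides_in \<Omega> \<T> \<Gamma>. Q S)"
proof -
  have "(AE x in bd_measure \<Omega> \<T>. x \<in> \<Gamma> \<longrightarrow> P x) \<longleftrightarrow> (\<forall>S\<in>B. S \<in> sides_in \<Omega> \<T> \<Gamma> \<longrightarrow> Q S)"
  proof (rule AE_boundary)
    fix S x assume S: "S \<in> B" and x: "x \<in> rel_interior S"
    show "(x \<in> \<Gamma> \<longrightarrow> P x) \<longleftrightarrow> (S \<in> sides_in \<Omega> \<T> \<Gamma> \<longrightarrow> Q S)"
    proof (cases "S \<in> sides_in \<Omega> \<T> \<Gamma>")
      case True
      then show ?thesis using P x sides_in_interior by blast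
    next
      case False
      then have "x \<notin> \<Gamma>" using S x DN(1) \<Gamma> \<Gamma>_disjoint sides_in_interior by blast
      then show ?thesis using False by simp
    qed
  qed
  then show ?thesis using sides_in_B by blast
qed

lemma integral_part:
  fixes h :: "'a \<Rightarrow> real"
  assumes \<Gamma>: "\<Gamma> = \<Gamma>\<^sub>D \<or> \<Gamma> = \<Gamma>\<^sub>N"
    and h: "\<And>S x. S \<in> sides_in \<Omega> \<T> \<Gamma> \<Longrightarrow> x \<in> rel_interior S \<Longrightarrow> h x = c S"
  shows "(LINT x:\<Gamma>|bd_measure \<Omega> \<T>. h x) = (\<Sum>S\<in>sides_in \<Omega> \<T> \<Gamma>. side_area S * c S)"
proof -
  have "(LINT x:\<Gamma>|bd_measure \<Omega> \<T>. h x) = (\<Sum>S\<in>B. side_area S * (if S \<in> sides_in \<Omega> \<T> \<Gamma> then c S else 0))"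
  proof (rule integral_boundary)
    fix S x assume S: "S \<in> B" and x: "x \<in> rel_interior S"
    show "indicator \<Gamma> x * h x = (if S \<in> sides_in \<Omega> \<T> \<Gamma> then c S else 0)"
    proof (cases "S \<in> sides_in \<Omega> \<T> \<Gamma>")
      case True
      then show ?thesis using h x sides_in_interior by simp
    next
      case False
      then have "x \<notin> \<Gamma>" using S x DN(1) \<Gamma> \<Gamma>_disjoint sides_in_interior by blast
      then show ?thesis using False by simp
    qed
  qed
  also have "\<dots> = (\<Sum>S\<in>B. if S \<in> sides_in \<Omega> \<T> \<Gamma> then side_area S * c S else 0)"
    by (intro sum.cong) auto
  also have "\<dots> = (\<Sum>S\<in>{S \<in> B. S \<in> sides_in \<Omega> \<T> \<Gamma>}. side_area S * c S)"
    using finite_B by (simp add: sum.inter_filter)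
  also have "{S \<in> B. S \<in> sides_in \<Omega> \<T> \<Gamma>} = sides_in \<Omega> \<T> \<Gamma>" using sides_in_B by blast
  finally show ?thesis .
qed

definition load :: "('a \<Rightarrow> real) \<Rightarrow> real" where
  "load v = (\<Sum>T\<in>\<T>. m T * (f (centroid T) * v (centroid T))) + (\<Sum>S\<in>N. side_area S * (g (side_centroid S) * side_value v S))"

text \<open>The load of the hat function of \<open>S\<close>.\<close>

definition side_load :: "'a set \<Rightarrow> real" where
  "side_load S = (\<Sum>T\<in>\<T>. m T * (f (centroid T) * side_weight S T)) + (if S \<in> N then side_area S * g (side_centroid S) else 0)"

text \<open>The two functionals on their admissible sets, written in the degrees of freedom.\<close>

definition energy :: "('a \<Rightarrow> real) \<Rightarrow> real" where
  "energy v = (\<Sum>T\<in>\<T>. m T * ((norm (elem_grad v T))\<^sup>2 / 2)) - load v"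

definition dual_energy :: "('a \<Rightarrow> 'a) \<Rightarrow> real" where
  "dual_energy y = - (\<Sum>T\<in>\<T>. m T * huber (\<zeta> (centroid T)) (y (centroid T))) + (\<Sum>S\<in>D. side_area S * (flux y (bd_element S) S * u\<^sub>D (side_centroid S)))"

lemma load_expand:
  assumes v: "v \<in> CR \<Omega> \<T>"
  shows "load v = (\<Sum>S\<in>sides \<T>. side_value v S * side_load S)"
proof -
  have "(\<Sum>T\<in>\<T>. m T * (f (centroid T) * v (centroid T))) = (\<Sum>T\<in>\<T>. \<Sum>S\<in>sides \<T>. side_value v S * (m T * (f (centroid T) * side_weight S T)))"
    by (intro sum.cong refl) (simp add: centroid_value_expand[OF v] sum_distrib_left mult.left_commute)
  also have "\<dots> = (\<Sum>S\<in>sides \<T>. \<Sum>T\<in>\<T>. side_value v S * (m T * (f (centroid T) * side_weight S T)))" by (rule sum.swap)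
  also have "\<dots> = (\<Sum>S\<in>sides \<T>. side_value v S * (\<Sum>T\<in>\<T>. m T * (f (centroid T) * side_weight S T)))" by (simp only: sum_distrib_left)
  finally have 1: "(\<Sum>T\<in>\<T>. m T * (f (centroid T) * v (centroid T))) = (\<Sum>S\<in>sides \<T>. side_value v S * (\<Sum>T\<in>\<T>. m T * (f (centroid T) * side_weight S T)))" .
  have "{S \<in> sides \<T>. S \<in> N} = N" using sides_in_B B_sides by blast
  then have "(\<Sum>S\<in>N. side_area S * (g (side_centroid S) * side_value v S)) = (\<Sum>S\<in>sides \<T>. if S \<in> N then side_area S * (g (side_centroid S) * side_value v S) else 0)"
    using finite_sides by (simp add: sum.inter_filter[symmetric])
  also have "\<dots> = (\<Sum>S\<in>sides \<T>. side_value v S * (if S \<in> N then side_area S * g (side_centroid S) else 0))"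
    by (intro sum.cong) auto
  finally show ?thesis unfolding load_def 1 side_load_def by (simp add: distrib_left sum.distrib)
qed

lemma ip_loads:
  assumes v: "v \<in> CR \<Omega> \<T>"
  shows "ip lebesgue \<Omega> f (Pi_h \<T> v) + ip (bd_measure \<Omega> \<T>) \<Gamma>\<^sub>N g (pi_h \<Omega> \<T> v) = load v"
proof -
  have "ip lebesgue \<Omega> f (Pi_h \<T> v) = (\<Sum>T\<in>\<T>. m T * (f (centroid T) * v (centroid T)))"
    unfolding ip_def by (rule integral_mesh) (simp add: P0_eq[OF f] Pi_h_eq[OF CR_P1[OF v]])
  moreover have "ip (bd_measure \<Omega> \<T>) \<Gamma>\<^sub>N g (pi_h \<Omega> \<T> v) = (\<Sum>S\<in>N. side_area S * (g (side_centroid S) * side_value v S))"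
    unfolding ip_def
    by (rule integral_part) (simp_all add: side_P0_eq[OF g] pi_h_eq[OF v sides_in_B])
  ultimately show ?thesis by (simp add: load_def)
qed

lemma dirichlet_iff:
  assumes v: "v \<in> CR \<Omega> \<T>"
  shows "dirichlet_data \<Omega> \<T> \<Gamma>\<^sub>D u\<^sub>D v \<longleftrightarrow> (\<forall>S\<in>D. side_value v S = u\<^sub>D (side_centroid S))"
  unfolding dirichlet_data_def
  by (rule AE_part) (simp_all add: side_P0_eq[OF uD] pi_h_eq[OF v sides_in_B])

lemma K_cr_iff:
  "v \<in> Kcr \<longleftrightarrow> v \<in> CR \<Omega> \<T> \<and> (\<forall>T\<in>\<T>. norm (elem_grad v T) \<le> \<zeta> (centroid T)) \<and> (\<forall>S\<in>D. side_value v S = u\<^sub>D (side_centroid S))"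
proof (cases "v \<in> CR \<Omega> \<T>")
  case True
  have "(AE x in lebesgue_on \<Omega>. norm (grad_h \<T> v x) \<le> \<zeta> x) \<longleftrightarrow> (\<forall>T\<in>\<T>. norm (elem_grad v T) \<le> \<zeta> (centroid T))"
    by (rule AE_mesh) (simp add: P0_eq[OF zeta] P1_grad(2)[OF CR_P1[OF True]])
  then show ?thesis using True dirichlet_iff[OF True] by (simp add: K_cr_def)
qed (simp add: K_cr_def)

lemma I_cr_eq:
  "I_cr \<Omega> \<T> \<Gamma>\<^sub>D \<Gamma>\<^sub>N f g \<zeta> u\<^sub>D v = (if v \<in> Kcr then ereal (energy v) else \<infinity>)"
proof (cases "v \<in> Kcr")
  case True
  then have v: "v \<in> CR \<Omega> \<T>" by (simp add: K_cr_def)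
  have "(LINT x:\<Omega>|lebesgue. (norm (grad_h \<T> v x))\<^sup>2) = (\<Sum>T\<in>\<T>. m T * (norm (elem_grad v T))\<^sup>2)"
    by (rule integral_mesh) (simp add: P1_grad(2)[OF CR_P1[OF v]])
  then show ?thesis using True ip_loads[OF v]
    by (simp add: I_cr_def energy_def sum_divide_distrib)
qed (simp add: I_cr_def)

lemma K_rt_iff:
  "y \<in> Krt \<longleftrightarrow> y \<in> RT \<Omega> \<T> \<and> (\<forall>T\<in>\<T>. div_h \<T> y (centroid T) = - f (centroid T)) \<and> (\<forall>S\<in>N. flux y (bd_element S) S = g (side_centroid S))"
proof (cases "y \<in> RT \<Omega> \<T>")
  case True
  have "(AE x in lebesgue_on \<Omega>. div_h \<T> y x = - f x) \<longleftrightarrow> (\<forall>T\<in>\<T>. div_h \<T> y (centroid T) = - f (centroid T))"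
  proof (rule AE_mesh)
    fix T x assume T: "T \<in> \<T>" and x: "x \<in> interior T"
    obtain A a where A: "linear A" "\<And>x. x \<in> interior T \<Longrightarrow> y x = A x + a"
      "\<And>x. x \<in> interior T \<Longrightarrow> div_h \<T> y x = (\<Sum>b\<in>Basis. A b \<bullet> b)"
      "\<And>x. x \<in> T \<Longrightarrow> elem_trace T y x = A x + a"
      by (rule P1_div[OF RT_P1[OF True] T]) (rule that)
    have "div_h \<T> y x = div_h \<T> y (centroid T)"
      by (simp only: A(3)[OF x] A(3)[OF centroid_interior[OF T]])
    then show "(div_h \<T> y x = - f x) \<longleftrightarrow> (div_h \<T> y (centroid T) = - f (centroid T))"
      by (simp only: P0_eq[OF f T x])
  qed
  moreover have "(AE x in bd_measure \<Omega> \<T>. x \<in> \<Gamma>\<^sub>N \<longrightarrow> normal_trace \<Omega> \<T> y x = g x) \<longleftrightarrow> (\<forall>S\<in>N. flux y (bd_element S) S = g (side_centroid S))"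
    by (rule AE_part) (simp_all add: side_P0_eq[OF g] normal_trace_eq[OF True sides_in_B])
  ultimately show ?thesis using True by (simp add: K_rt_def)
qed (simp add: K_rt_def)

lemma D_rt_eq:
  "Drt y = (if y \<in> Krt then ereal (dual_energy y) else - \<infinity>)"
proof (cases "y \<in> Krt")
  case True
  then have y: "y \<in> RT \<Omega> \<T>" by (simp add: K_rt_def)
  have "(LINT x:\<Omega>|lebesgue. phi_star \<zeta> x (Pi_h \<T> y x)) = (\<Sum>T\<in>\<T>. m T * huber (\<zeta> (centroid T)) (y (centroid T)))"
    by (rule integral_mesh) (simp add: phi_star_huber P0_eq[OF zeta] Pi_h_eq[OF RT_P1[OF y]])
  moreover have "ip (bd_measure \<Omega> \<T>) \<Gamma>\<^sub>D (normal_trace \<Omega> \<T> y) u\<^sub>D = (\<Sum>S\<in>D. side_area S * (flux y (bd_element S) S * u\<^sub>D (side_centroid S)))"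
    unfolding ip_def
    by (rule integral_part) (simp_all add: side_P0_eq[OF uD] normal_trace_eq[OF y sides_in_B])
  ultimately show ?thesis using True by (simp add: D_rt_def dual_energy_def)
qed (simp add: D_rt_def)

text \<open>Integration by parts for an admissible field, whose divergence and Neumann flux are the
  data.\<close>

lemma pairing:
  assumes v: "v \<in> CR \<Omega> \<T>" and y: "y \<in> Krt"
  shows "(\<Sum>T\<in>\<T>. m T * (y (centroid T) \<bullet> elem_grad v T)) = load v + (\<Sum>S\<in>D. side_area S * (flux y (bd_element S) S * side_value v S))"
proof -
  have y': "y \<in> RT \<Omega> \<T>" "\<And>T. T \<in> \<T> \<Longrightarrow> div_h \<T> y (centroid T) = - f (centroid T)" "\<And>S. S \<in> N \<Longrightarrow> flux y (bd_element S) S = g (side_centroid S)"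
    using y by (auto simp: K_rt_iff)
  have "(\<Sum>T\<in>\<T>. m T * (y (centroid T) \<bullet> elem_grad v T + div_h \<T> y (centroid T) * v (centroid T)))
      = (\<Sum>T\<in>\<T>. m T * (y (centroid T) \<bullet> elem_grad v T)) - (\<Sum>T\<in>\<T>. m T * (f (centroid T) * v (centroid T)))"
    unfolding sum_subtractf[symmetric] by (intro sum.cong refl) (simp add: y'(2) algebra_simps)
  moreover have "(\<Sum>S\<in>B. side_area S * (flux y (bd_element S) S * side_value v S))
      = (\<Sum>S\<in>D. side_area S * (flux y (bd_element S) S * side_value v S)) + (\<Sum>S\<in>N. side_area S * (g (side_centroid S) * side_value v S))"
  proof -
    have "(\<Sum>S\<in>N. side_area S * (flux y (bd_element S) S * side_value v S)) = (\<Sum>S\<in>N. side_area S * (g (side_centroid S) * side_value v S))"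
      by (intro sum.cong refl) (simp add: y'(3))
    then show ?thesis unfolding DN(1) using DN(2,3,4) by (simp add: sum.union_disjoint)
  qed
  ultimately show ?thesis using integration_by_parts[OF v y'(1)] by (simp add: load_def)
qed

lemma duality_gap:
  assumes v: "v \<in> Kcr" and y: "y \<in> Krt"
  shows "energy v - dual_energy y
    = (\<Sum>T\<in>\<T>. m T * ((norm (elem_grad v T))\<^sup>2 / 2 + huber (\<zeta> (centroid T)) (y (centroid T)) - y (centroid T) \<bullet> elem_grad v T))"
proof -
  have v': "v \<in> CR \<Omega> \<T>" "\<And>S. S \<in> D \<Longrightarrow> side_value v S = u\<^sub>D (side_centroid S)" using v by (auto simp: K_cr_iff)
  have "(\<Sum>S\<in>D. side_area S * (flux y (bd_element S) S * side_value v S)) = (\<Sum>S\<in>D. side_area S * (flux y (bd_element S) S * u\<^sub>D (side_centroid S)))"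
    by (intro sum.cong refl) (simp add: v'(2))
  moreover have "(\<Sum>T\<in>\<T>. m T * ((norm (elem_grad v T))\<^sup>2 / 2 + huber (\<zeta> (centroid T)) (y (centroid T)) - y (centroid T) \<bullet> elem_grad v T))
    = (\<Sum>T\<in>\<T>. m T * ((norm (elem_grad v T))\<^sup>2 / 2)) + (\<Sum>T\<in>\<T>. m T * huber (\<zeta> (centroid T)) (y (centroid T)))
      - (\<Sum>T\<in>\<T>. m T * (y (centroid T) \<bullet> elem_grad v T))"
    by (simp add: distrib_left right_diff_distrib sum.distrib sum_subtractf)
  ultimately show ?thesis using pairing[OF v'(1) y] by (simp add: energy_def dual_energy_def)
qed

lemma gap_terms:
  assumes v: "v \<in> Kcr" and T: "T \<in> \<T>"
  shows "(norm (elem_grad v T - prox (\<zeta> (centroid T)) s))\<^sup>2 / 2 \<le> (norm (elem_grad v T))\<^sup>2 / 2 + huber (\<zeta> (centroid T)) s - s \<bullet> elem_grad v T"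
  by (rule young_gap[OF zeta_pos[OF T]]) (use v T in \<open>simp add: K_cr_iff\<close>)

lemma weak_duality:
  assumes v: "v \<in> Kcr" and y: "y \<in> Krt"
  shows "dual_energy y \<le> energy v"
proof -
  have "0 \<le> m T * ((norm (elem_grad v T))\<^sup>2 / 2 + huber (\<zeta> (centroid T)) (y (centroid T)) - y (centroid T) \<bullet> elem_grad v T)" if "T \<in> \<T>" for T
    using order_trans[OF _ gap_terms[OF v that, of "y (centroid T)"], of 0] by simp
  then have "0 \<le> energy v - dual_energy y" unfolding duality_gap[OF v y] by (rule sum_nonneg)
  then show ?thesis by simp
qed

lemma optimality_from_duality:
  assumes v: "v \<in> Kcr" and y: "y \<in> Krt"
    and eq: "energy v = dual_energy y" and T: "T \<in> \<T>"
  shows "elem_grad v T = prox (\<zeta> (centroid T)) (y (centroid T))"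
proof -
  let ?t = "\<lambda>T. m T * ((norm (elem_grad v T))\<^sup>2 / 2 + huber (\<zeta> (centroid T)) (y (centroid T)) - y (centroid T) \<bullet> elem_grad v T)"
  have nn: "0 \<le> ?t T" if "T \<in> \<T>" for T
    using order_trans[OF _ gap_terms[OF v that, of "y (centroid T)"], of 0] by simp
  have "(\<Sum>T\<in>\<T>. ?t T) = 0" using duality_gap[OF v y] eq by simp
  then have "?t T = 0" using sum_nonneg_eq_0_iff[OF finite_T, of ?t] nn T by simp
  then have "(norm (elem_grad v T))\<^sup>2 / 2 + huber (\<zeta> (centroid T)) (y (centroid T)) - y (centroid T) \<bullet> elem_grad v T = 0"
    using measure_pos[OF T] by simp
  then have "(norm (elem_grad v T - prox (\<zeta> (centroid T)) (y (centroid T))))\<^sup>2 / 2 \<le> 0" using gap_terms[OF v T, of "y (centroid T)"] by simp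
  then show ?thesis by simp
qed

text \<open>On each element the field with average \<open>z T\<close> and divergence \<open>- f\<close>
  is affine of the form \<open>\<kappa> x + a\<close>, and so it has a constant normal component on
  every side. The element-wise Gauss theorem with the hat function of \<open>S\<close> turns the
  equilibrium condition at \<open>S\<close> into a statement about the sum of the fluxes through
  \<open>S\<close>: it vanishes at an interior side and equals the datum at a Neumann side.\<close>

lemma flux_reconstruction:
  assumes z: "\<And>S. S \<in> sides \<T> - D \<Longrightarrow> (\<Sum>T\<in>\<T>. m T * (z T \<bullet> side_grad S T)) = side_load S"
  obtains y where "y \<in> Krt" "\<And>T. T \<in> \<T> \<Longrightarrow> y (centroid T) = z T"
proof -
  let ?d = "real DIM('a)"
  \<comment> \<open>The divergence of \<open>\<kappa> x + a\<close> is \<open>d \<kappa>\<close>.\<close>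
  define \<kappa> where "\<kappa> = (\<lambda>T. - f (centroid T) / ?d)"
  define y where "y = (\<lambda>x. \<Sum>T\<in>\<T>. indicator (interior T) x *\<^sub>R (\<kappa> T *\<^sub>R x + (z T - \<kappa> T *\<^sub>R centroid T)))"
  have yT: "y x = \<kappa> T *\<^sub>R x + (z T - \<kappa> T *\<^sub>R centroid T)" if "T \<in> \<T>" "x \<in> interior T" for T x
    unfolding y_def using paste[OF that, of "\<lambda>T x. \<kappa> T *\<^sub>R x + (z T - \<kappa> T *\<^sub>R centroid T)"] .
  have lin: "linear (\<lambda>x::'a. c *\<^sub>R x)" for c by (auto intro!: linearI simp: scaleR_add_right)
  have P1: "y \<in> broken_P1 \<T>" unfolding broken_P1_def using yT lin by blast
  have yc: "y (centroid T) = z T" if "T \<in> \<T>" for T using yT[OF that centroid_interior[OF that]] by simp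
  have tr: "elem_trace T y x = \<kappa> T *\<^sub>R x + (z T - \<kappa> T *\<^sub>R centroid T)" if "T \<in> \<T>" "x \<in> T" for T x
    by (rule elem_trace_eq[OF that(1) lin yT[OF that(1)] that(2)])
  have div: "div_h \<T> y (centroid T) = - f (centroid T)" if T: "T \<in> \<T>" for T
  proof -
    obtain C g where "frame C g" and TC: "T = convex hull C" using simplex_frame[OF simplex_T[OF T]] .
    then interpret frame C g by simp
    have "frechet_derivative y (at (centroid T)) = (\<lambda>x. \<kappa> T *\<^sub>R x)"
      by (rule frechet_derivative_affine[OF lin]) (use yT[OF T] centroid_interior[OF T] TC in auto)
    then show ?thesis using T centroid_interior[OF T] by (auto simp: div_h_def \<kappa>_def)
  qed
  have const: "elem_trace T y x \<bullet> outer_normal T S = flux y T S" if T: "T \<in> \<T>" and S: "S facet_of T" and x: "x \<in> S" for T S x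
  proof -
    have s: "side_centroid S \<in> S" using side_centroid_rel_interior[OF T S] rel_interior_subset by blast
    have "(x - side_centroid S) \<bullet> outer_normal T S = 0" by (rule outer_normal_orthogonal[OF T S x s])
    moreover have "elem_trace T y x - elem_trace T y (side_centroid S) = \<kappa> T *\<^sub>R (x - side_centroid S)"
      using tr[OF T] x s facet_subset[OF S] by (simp add: subset_iff scaleR_diff_right)
    ultimately have "(elem_trace T y x - elem_trace T y (side_centroid S)) \<bullet> outer_normal T S = 0" by simp
    then show ?thesis by (simp add: flux_def inner_diff_left)
  qed
  have test: "(\<Sum>T | T \<in> \<T> \<and> S facet_of T. side_area S * flux y T S) = (\<Sum>T\<in>\<T>. m T * (z T \<bullet> side_grad S T)) - (\<Sum>T\<in>\<T>. m T * (f (centroid T) * side_weight S T))"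
    if S: "S \<in> sides \<T>" for S
  proof -
    define v where "v = cr_interpolant (\<lambda>S'. of_bool (S' = S))"
    note hat = hat[OF S v_def]
    have local: "m T * (z T \<bullet> side_grad S T) - m T * (f (centroid T) * side_weight S T) = (if S facet_of T then side_area S * flux y T S else 0)"
      if T: "T \<in> \<T>" for T
    proof -
      have "(\<Sum>S' | S' facet_of T. side_area S' * flux y T S' * elem_trace T v (side_centroid S'))
          = m T * (y (centroid T) \<bullet> elem_grad v T + div_h \<T> y (centroid T) * v (centroid T))"
        by (rule gauss_mesh_element[OF CR_P1[OF hat(1)] P1 T]) (use const[OF T] in blast)
      moreover have tr: "elem_trace T v (side_centroid S') = of_bool (S' = S)" if "S' facet_of T" for S'
      proof -
        have "S' \<in> sides \<T>" using that T by (auto simp: sides_def)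
        then show ?thesis using side_value_eq[OF hat(1) T that] hat(2)[of S'] by simp
      qed
      have "(\<Sum>S' | S' facet_of T. side_area S' * flux y T S' * elem_trace T v (side_centroid S')) = (if S facet_of T then side_area S * flux y T S else 0)"
      proof (cases "S facet_of T")
        case True
        then have "(\<Sum>S' | S' facet_of T. side_area S' * flux y T S' * elem_trace T v (side_centroid S')) = side_area S * flux y T S * elem_trace T v (side_centroid S)"
          by (intro sum_single[OF finite_facets[OF T]]) (auto simp: tr)
        then show ?thesis using True by (simp add: tr)
      next
        case False
        then show ?thesis by (auto simp: tr intro!: sum.neutral)
      qed
      ultimately show ?thesis by (simp add: yc[OF T] hat(3,4)[OF T] div[OF T] algebra_simps)
    qed
    have "(\<Sum>T | T \<in> \<T> \<and> S facet_of T. side_area S * flux y T S) = (\<Sum>T\<in>\<T>. if S facet_of T then side_area S * flux y T S else 0)"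
      using finite_T by (rule sum.inter_filter)
    also have "\<dots> = (\<Sum>T\<in>\<T>. m T * (z T \<bullet> side_grad S T) - m T * (f (centroid T) * side_weight S T))"
      by (intro sum.cong refl) (simp add: local)
    finally show ?thesis by (simp add: sum_subtractf)
  qed
  have sumflux: "(\<Sum>T | T \<in> \<T> \<and> S facet_of T. side_area S * flux y T S) = (if S \<in> N then side_area S * g (side_centroid S) else 0)"
    if "S \<in> sides \<T> - D" for S
    using test[of S] z[OF that] that by (simp add: side_load_def)
  have RT: "y \<in> RT \<Omega> \<T>"
  proof -
    have opp: "elem_trace T y x \<bullet> outer_normal T S + elem_trace T' y x \<bullet> outer_normal T' S = 0"
      if S: "S \<in> interior_sides \<Omega> \<T>" and T: "T \<in> \<T>" "T' \<in> \<T>" "T \<noteq> T'" "S facet_of T" "S facet_of T'" and x: "x \<in> S"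
      for S T T' x
    proof -
      have nB: "S \<in> sides \<T> - D" "S \<notin> N" using S sides_in_B by (auto simp: interior_sides_def)
      have "{T. T \<in> \<T> \<and> S facet_of T} = {T, T'}" using T at_most_two by blast
      then have "side_area S * flux y T S + side_area S * flux y T' S = 0" using sumflux[OF nB(1)] nB(2) T(3) by simp
      then have "flux y T S + flux y T' S = 0" using side_area_pos[OF T(1,4)] by (simp flip: distrib_left)
      then show ?thesis using const[OF T(1,4) x] const[OF T(2,5) x] by simp
    qed
    show ?thesis unfolding RT_def mem_Collect_eq
    proof (intro conjI ballI allI impI P1)
      fix T S assume T: "T \<in> \<T>" and S: "S facet_of T"
      show "\<exists>c. \<forall>x\<in>S. elem_trace T y x \<bullet> outer_normal T S = c"
        using const[OF T S] by (intro exI[of _ "flux y T S"] ballI)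
    qed (intro opp; simp)
  qed
  have "flux y (bd_element S) S = g (side_centroid S)" if S: "S \<in> N" for S
  proof -
    have B: "S \<in> B" using S sides_in_B by blast
    have "{T. T \<in> \<T> \<and> S facet_of T} = {bd_element S}" using boundary_element[OF B] by blast
    moreover have "S \<in> sides \<T> - D" using S B B_sides DN(2) by blast
    ultimately have "side_area S * flux y (bd_element S) S = side_area S * g (side_centroid S)" using sumflux[of S] S by simp
    then show ?thesis using side_measure_facts(4)[OF B_sides[OF B]] by simp
  qed
  then have "y \<in> Krt" using RT div by (simp add: K_rt_iff)
  then show ?thesis using that yc by blast
qed

text \<open>The converse: the averages of an admissible field are in equilibrium at all sides without
  Dirichlet condition.\<close>

lemma reconstruction_condition:
  assumes y: "y \<in> Krt" and S: "S \<in> sides \<T> - D"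
  shows "(\<Sum>T\<in>\<T>. m T * (y (centroid T) \<bullet> side_grad S T)) = side_load S"
proof -
  define v where "v = cr_interpolant (\<lambda>S'. of_bool (S' = S))"
  have S': "S \<in> sides \<T>" using S by simp
  note hat = hat[OF S' v_def]
  have "(\<Sum>S'\<in>sides \<T>. side_value v S' * side_load S') = side_value v S * side_load S"
    by (rule sum_single[OF finite_sides S']) (simp add: hat(2))
  then have l: "load v = side_load S" using S' by (simp add: load_expand[OF hat(1)] hat(2))
  have "(\<Sum>S'\<in>D. side_area S' * (flux y (bd_element S') S' * side_value v S')) = 0"
  proof (intro sum.neutral ballI)
    fix S' assume "S' \<in> D"
    then have "S' \<in> sides \<T>" "S' \<noteq> S" using S sides_in_B B_sides by blast+
    then show "side_area S' * (flux y (bd_element S') S' * side_value v S') = 0" by (simp add: hat(2))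
  qed
  then show ?thesis using pairing[OF hat(1) y] hat(3) l by simp
qed

text \<open>Gradient and load depend linearly on the side values.\<close>

lemma perturb:
  fixes c :: "'a set \<Rightarrow> real"
  assumes v: "v \<in> CR \<Omega> \<T>" and J: "J \<subseteq> sides \<T>"
  obtains w where "w \<in> CR \<Omega> \<T>" "\<And>S. S \<in> sides \<T> - J \<Longrightarrow> side_value w S = side_value v S"
    "\<And>T. T \<in> \<T> \<Longrightarrow> elem_grad w T = elem_grad v T + (\<Sum>S\<in>J. c S *\<^sub>R side_grad S T)"
    "load w = load v + (\<Sum>S\<in>J. c S * side_load S)"
proof -
  define w where "w = cr_interpolant (\<lambda>S. side_value v S + (if S \<in> J then c S else 0))"
  have w: "w \<in> CR \<Omega> \<T>" "\<And>S. S \<in> sides \<T> \<Longrightarrow> side_value w S = side_value v S + (if S \<in> J then c S else 0)"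
    by (simp_all add: w_def cr_interpolant)
  have restrict: "(\<Sum>S\<in>sides \<T>. if S \<in> J then F S else 0) = (\<Sum>S\<in>J. F S)" for F :: "'a set \<Rightarrow> 'c::comm_monoid_add"
    using finite_sides J by (simp add: sum.inter_restrict[symmetric] Int_absorb1)
  have "elem_grad w T = elem_grad v T + (\<Sum>S\<in>J. c S *\<^sub>R side_grad S T)" if T: "T \<in> \<T>" for T
  proof -
    have "elem_grad w T = (\<Sum>S\<in>sides \<T>. side_value v S *\<^sub>R side_grad S T + (if S \<in> J then c S *\<^sub>R side_grad S T else 0))"
      unfolding elem_grad_expand[OF w(1) T] by (intro sum.cong refl) (simp add: w(2) scaleR_add_left)
    then show ?thesis by (simp add: sum.distrib restrict elem_grad_expand[OF v T])
  qed
  moreover have "load w = load v + (\<Sum>S\<in>J. c S * side_load S)"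
  proof -
    have "load w = (\<Sum>S\<in>sides \<T>. side_value v S * side_load S + (if S \<in> J then c S * side_load S else 0))"
      unfolding load_expand[OF w(1)] by (intro sum.cong refl) (simp add: w(2) distrib_right)
    then show ?thesis by (simp add: sum.distrib restrict load_expand[OF v])
  qed
  ultimately show ?thesis using that w by simp
qed

lemma D_subset_sides: "D \<subseteq> sides \<T>" using sides_in_B B_sides by blast

text \<open>The equilibrium conditions are consistent: a combination of free basis functions with zero
  gradient can be added to \<open>u\<close> with either sign, so that it carries no load. The
  finite-dimensional duality then provides element averages \<open>z\<close> in equilibrium and a
  combination of basis functions which, added to the lift \<open>w\<close>, gives \<open>v\<close> with
  \<open>\<nabla>v\<^sub>T\<close> equal to the gradient of the conjugate at \<open>z\<^sub>T\<close>.
  For this pair all Fenchel-Young gaps vanish, and weak duality transfers this to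
  \<open>u\<close>.\<close>

lemma strong_duality:
  assumes w: "w \<in> CR \<Omega> \<T>" "\<And>S. S \<in> D \<Longrightarrow> side_value w S = u\<^sub>D (side_centroid S)" "\<And>T. T \<in> \<T> \<Longrightarrow> norm (elem_grad w T) < \<zeta> (centroid T)"
    and u: "u \<in> Kcr"
    and min: "\<And>v. v \<in> Kcr \<Longrightarrow> energy u \<le> energy v"
  obtains z where "z \<in> Krt" "energy u = dual_energy z"
proof -
  let ?J = "sides \<T> - D"
  have J: "finite ?J" "?J \<subseteq> sides \<T>" using finite_sides by auto
  interpret W: weighted_sum \<T> m using finite_T measure_pos by unfold_locales
  have u': "u \<in> CR \<Omega> \<T>" "\<And>T. T \<in> \<T> \<Longrightarrow> norm (elem_grad u T) \<le> \<zeta> (centroid T)" "\<And>S. S \<in> D \<Longrightarrow> side_value u S = u\<^sub>D (side_centroid S)"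
    using u by (auto simp: K_cr_iff)
  have le: "(\<Sum>S\<in>?J. c S * side_load S) \<le> 0" if c: "\<And>T. T \<in> \<T> \<Longrightarrow> (\<Sum>S\<in>?J. c S *\<^sub>R side_grad S T) = 0" for c
  proof -
    obtain v where v: "v \<in> CR \<Omega> \<T>" "\<And>S. S \<in> sides \<T> - ?J \<Longrightarrow> side_value v S = side_value u S"
      "\<And>T. T \<in> \<T> \<Longrightarrow> elem_grad v T = elem_grad u T + (\<Sum>S\<in>?J. c S *\<^sub>R side_grad S T)" "load v = load u + (\<Sum>S\<in>?J. c S * side_load S)"
      using perturb[OF u'(1) J(2)] by blast
    have gv: "elem_grad v T = elem_grad u T" if "T \<in> \<T>" for T using v(3) c that by simp
    have "v \<in> Kcr" unfolding K_cr_iff using v(1,2) gv u' D_subset_sides by auto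
    then have "energy u \<le> energy v" by (rule min)
    then show ?thesis using v(4) gv by (simp add: energy_def)
  qed
  have consistent: "(\<Sum>S\<in>?J. c S * side_load S) = 0" if c: "\<And>T. T \<in> \<T> \<Longrightarrow> (\<Sum>S\<in>?J. c S *\<^sub>R side_grad S T) = 0" for c
  proof -
    have "(\<Sum>S\<in>?J. - c S * side_load S) \<le> 0" by (rule le) (simp add: sum_negf c)
    then show ?thesis using le[OF c] by (simp add: sum_negf)
  qed
  obtain z c where z: "\<And>S. S \<in> ?J \<Longrightarrow> W.weighted_inner z (side_grad S) = side_load S"
    "\<And>T. T \<in> \<T> \<Longrightarrow> prox (\<zeta> (centroid T)) (z T) = elem_grad w T + (\<Sum>S\<in>?J. c S *\<^sub>R side_grad S T)"
    using W.strong_duality_finite[where \<zeta>="\<lambda>T. \<zeta> (centroid T)" and q="elem_grad w" and h=side_grad and l=side_load, OF J(1) zeta_pos w(3) consistent]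
    by blast
  obtain y where y: "y \<in> Krt" "\<And>T. T \<in> \<T> \<Longrightarrow> y (centroid T) = z T"
    using flux_reconstruction[of z] z(1) unfolding W.weighted_inner_def by blast
  obtain v where v: "v \<in> CR \<Omega> \<T>" "\<And>S. S \<in> sides \<T> - ?J \<Longrightarrow> side_value v S = side_value w S"
    "\<And>T. T \<in> \<T> \<Longrightarrow> elem_grad v T = elem_grad w T + (\<Sum>S\<in>?J. c S *\<^sub>R side_grad S T)"
    using perturb[OF w(1) J(2)] by blast
  have gv: "elem_grad v T = prox (\<zeta> (centroid T)) (y (centroid T))" if "T \<in> \<T>" for T using v(3) z(2) y(2) that by simp
  have vK: "v \<in> Kcr"
    unfolding K_cr_iff using v(1,2) w(2) gv norm_prox[OF zeta_pos] D_subset_sides by auto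
  have "energy v - dual_energy y = 0"
    unfolding duality_gap[OF vK y(1)]
    by (intro sum.neutral ballI) (simp add: gv huber_prox[OF zeta_pos])
  then have "energy u \<le> dual_energy y" using min[OF vK] by simp
  then have "energy u = dual_energy y" using weak_duality[OF u y(1)] by simp
  then show ?thesis using that y(1) by blast
qed

section \<open>The Fenchel dual problem\<close>

lemma P0_prox: "y \<in> broken_P0 \<T> \<Longrightarrow> (\<lambda>x. prox (\<zeta> x) (y x)) \<in> broken_P0 \<T>"
proof -
  assume y: "y \<in> broken_P0 \<T>"
  have "prox (\<zeta> x) (y x) = prox (\<zeta> (centroid T)) (y (centroid T))" if "T \<in> \<T>" "x \<in> interior T" for T x
    by (simp only: P0_eq[OF zeta that] P0_eq[OF y that])
  then show ?thesis unfolding broken_P0_def by blast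
qed

lemma riesz_eq:
  assumes "y \<in> broken_P0 \<T>" "w \<in> broken_P0 \<T>"
  shows "riesz_h \<Omega> y w = (\<Sum>T\<in>\<T>. m T * (y (centroid T) \<bullet> w (centroid T)))"
  unfolding riesz_h_def ip_def by (rule integral_mesh) (simp add: P0_eq[OF assms(1)] P0_eq[OF assms(2)])

lemma G_h_eq:
  assumes w: "w \<in> broken_P0 \<T>"
  shows "G_h \<Omega> \<zeta> w = (if \<forall>T\<in>\<T>. norm (w (centroid T)) \<le> \<zeta> (centroid T)
    then ereal (\<Sum>T\<in>\<T>. m T * ((norm (w (centroid T)))\<^sup>2 / 2)) else \<infinity>)"
proof -
  have nn: "(\<integral>\<^sup>+x\<in>\<Omega>. e2ennreal (phi \<zeta> x (w x)) \<partial>lebesgue) = (\<Sum>T\<in>\<T>. ennreal (m T) * e2ennreal (phi \<zeta> (centroid T) (w (centroid T))))"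
    by (rule nn_integral_mesh) (simp add: phi_def P0_eq[OF w] P0_eq[OF zeta])
  show ?thesis
  proof (cases "\<forall>T\<in>\<T>. norm (w (centroid T)) \<le> \<zeta> (centroid T)")
    case True
    have "(\<Sum>T\<in>\<T>. ennreal (m T) * e2ennreal (phi \<zeta> (centroid T) (w (centroid T)))) = (\<Sum>T\<in>\<T>. ennreal (m T * ((norm (w (centroid T)))\<^sup>2 / 2)))"
    proof (intro sum.cong refl)
      fix T assume "T \<in> \<T>"
      then have "phi \<zeta> (centroid T) (w (centroid T)) = ereal ((norm (w (centroid T)))\<^sup>2 / 2)"
        using True by (simp add: phi_def)
      then have "e2ennreal (phi \<zeta> (centroid T) (w (centroid T))) = ennreal ((norm (w (centroid T)))\<^sup>2 / 2)"
        by (simp only: e2ennreal_ereal)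
      then show "ennreal (m T) * e2ennreal (phi \<zeta> (centroid T) (w (centroid T))) = ennreal (m T * ((norm (w (centroid T)))\<^sup>2 / 2))"
        by (simp only:) (rule ennreal_mult[symmetric]; simp)
    qed
    also have "\<dots> = ennreal (\<Sum>T\<in>\<T>. m T * ((norm (w (centroid T)))\<^sup>2 / 2))" by (rule sum_ennreal) simp
    finally show ?thesis using True nn by (simp add: G_h_def sum_nonneg)
  next
    case False
    then obtain T where T: "T \<in> \<T>" "\<not> norm (w (centroid T)) \<le> \<zeta> (centroid T)" by blast
    have "ennreal (m T) * e2ennreal (phi \<zeta> (centroid T) (w (centroid T))) = \<infinity>"
      using T measure_pos[OF T(1)] by (simp add: phi_def ennreal_mult_top)
    then have "(\<Sum>T\<in>\<T>. ennreal (m T) * e2ennreal (phi \<zeta> (centroid T) (w (centroid T)))) = \<infinity>"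
      using member_le_sum[OF T(1) _ finite_T, of "\<lambda>T. ennreal (m T) * e2ennreal (phi \<zeta> (centroid T) (w (centroid T)))"]
      by (simp add: top_unique)
    then have "G_h \<Omega> \<zeta> w = \<infinity>" unfolding G_h_def nn by simp
    then show ?thesis using False by simp
  qed
qed

text \<open>The conjugate of an integral of functions of the gradient is computed element by element; it
  is attained at the projection of \<open>y\<close>.\<close>

lemma conj_G:
  assumes y: "y \<in> broken_P0 \<T>"
  shows "fenchel_conj (broken_P0 \<T>) (G_h \<Omega> \<zeta>) (riesz_h \<Omega> y) = ereal (\<Sum>T\<in>\<T>. m T * huber (\<zeta> (centroid T)) (y (centroid T)))"
  unfolding fenchel_conj_def
proof (rule antisym)
  show "(SUP w\<in>broken_P0 \<T>. ereal (riesz_h \<Omega> y w) - G_h \<Omega> \<zeta> w) \<le> ereal (\<Sum>T\<in>\<T>. m T * huber (\<zeta> (centroid T)) (y (centroid T)))"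
  proof (rule SUP_least)
    fix w :: "'a \<Rightarrow> 'a" assume w: "w \<in> broken_P0 \<T>"
    show "ereal (riesz_h \<Omega> y w) - G_h \<Omega> \<zeta> w \<le> ereal (\<Sum>T\<in>\<T>. m T * huber (\<zeta> (centroid T)) (y (centroid T)))"
    proof (cases "\<forall>T\<in>\<T>. norm (w (centroid T)) \<le> \<zeta> (centroid T)")
      case True
      have "(\<Sum>T\<in>\<T>. m T * (y (centroid T) \<bullet> w (centroid T))) - (\<Sum>T\<in>\<T>. m T * ((norm (w (centroid T)))\<^sup>2 / 2))
          \<le> (\<Sum>T\<in>\<T>. m T * huber (\<zeta> (centroid T)) (y (centroid T)))"
        unfolding sum_subtractf[symmetric]
      proof (rule sum_mono)
        fix T assume T: "T \<in> \<T>"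
        have "m T * (y (centroid T) \<bullet> w (centroid T) - (norm (w (centroid T)))\<^sup>2 / 2) \<le> m T * huber (\<zeta> (centroid T)) (y (centroid T))"
          using huber_ge[OF zeta_pos[OF T], of "w (centroid T)" "y (centroid T)"] True T by (intro mult_left_mono) auto
        then show "m T * (y (centroid T) \<bullet> w (centroid T)) - m T * ((norm (w (centroid T)))\<^sup>2 / 2) \<le> m T * huber (\<zeta> (centroid T)) (y (centroid T))"
          by (simp only: right_diff_distrib)
      qed
      then show ?thesis using True by (simp add: G_h_eq[OF w] riesz_eq[OF y w])
    next
      case False
      then have "G_h \<Omega> \<zeta> w = \<infinity>" unfolding G_h_eq[OF w] by (rule if_not_P)
      then show ?thesis by simp
    qed
  qed
  define w where "w = (\<lambda>x. prox (\<zeta> x) (y x))"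
  have w: "w \<in> broken_P0 \<T>" unfolding w_def by (rule P0_prox[OF y])
  have "G_h \<Omega> \<zeta> w = ereal (\<Sum>T\<in>\<T>. m T * ((norm (w (centroid T)))\<^sup>2 / 2))"
    unfolding G_h_eq[OF w] by (rule if_P) (simp add: w_def norm_prox[OF zeta_pos])
  then have "ereal (riesz_h \<Omega> y w) - G_h \<Omega> \<zeta> w
      = ereal ((\<Sum>T\<in>\<T>. m T * (y (centroid T) \<bullet> w (centroid T))) - (\<Sum>T\<in>\<T>. m T * ((norm (w (centroid T)))\<^sup>2 / 2)))"
    by (simp add: riesz_eq[OF y w])
  also have "(\<Sum>T\<in>\<T>. m T * (y (centroid T) \<bullet> w (centroid T))) - (\<Sum>T\<in>\<T>. m T * ((norm (w (centroid T)))\<^sup>2 / 2))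
      = (\<Sum>T\<in>\<T>. m T * huber (\<zeta> (centroid T)) (y (centroid T)))"
    unfolding sum_subtractf[symmetric]
    by (intro sum.cong refl) (simp add: w_def huber_prox[OF zeta_pos] right_diff_distrib)
  finally have "ereal (riesz_h \<Omega> y w) - G_h \<Omega> \<zeta> w = ereal (\<Sum>T\<in>\<T>. m T * huber (\<zeta> (centroid T)) (y (centroid T)))" .
  then show "ereal (\<Sum>T\<in>\<T>. m T * huber (\<zeta> (centroid T)) (y (centroid T))) \<le> (SUP w\<in>broken_P0 \<T>. ereal (riesz_h \<Omega> y w) - G_h \<Omega> \<zeta> w)"
    by (intro SUP_upper2[OF w]) simp
qed

text \<open>The load minus the pairing of \<open>y\<close> with the gradient. On functions with the
  Dirichlet data it is the quantity whose supremum is the conjugate of \<open>F\<close>.\<close>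

definition residual :: "('a \<Rightarrow> 'a) \<Rightarrow> ('a \<Rightarrow> real) \<Rightarrow> real" where
  "residual y v = load v - (\<Sum>T\<in>\<T>. m T * (y (centroid T) \<bullet> elem_grad v T))"

lemma conj_F_summand:
  assumes y: "y \<in> broken_P0 \<T>" and v: "v \<in> CR \<Omega> \<T>"
  shows "ereal (- grad_adj \<Omega> \<T> y v) - F_h \<Omega> \<T> \<Gamma>\<^sub>D \<Gamma>\<^sub>N f g u\<^sub>D v
    = (if \<forall>S\<in>D. side_value v S = u\<^sub>D (side_centroid S) then ereal (residual y v) else - \<infinity>)"
proof -
  have "grad_adj \<Omega> \<T> y v = (\<Sum>T\<in>\<T>. m T * (y (centroid T) \<bullet> elem_grad v T))"
    unfolding grad_adj_def riesz_h_def ip_def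
    by (rule integral_mesh) (simp add: P0_eq[OF y] P1_grad(2)[OF CR_P1[OF v]])
  then show ?thesis using ip_loads[OF v] by (simp add: F_h_def dirichlet_iff[OF v] residual_def)
qed

text \<open>If \<open>y\<close> is in equilibrium then it has an admissible reconstruction, the residual
  is constant on the functions with the Dirichlet data, and this constant is minus the Dirichlet term of
  the dual energy. Otherwise, moving along the hat function of a side where equilibrium fails makes the
  residual arbitrarily large, and no admissible field has the averages \<open>y\<close>.\<close>

lemma fenchel_dual_eq:
  assumes w: "w \<in> CR \<Omega> \<T>" "\<And>S. S \<in> D \<Longrightarrow> side_value w S = u\<^sub>D (side_centroid S)"
    and y: "y \<in> broken_P0 \<T>"
  shows "fenchel_dual \<Omega> \<T> \<Gamma>\<^sub>D \<Gamma>\<^sub>N f g \<zeta> u\<^sub>D y =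
    (SUP z\<in>{z\<in>RT \<Omega> \<T>. AE x in lebesgue_on \<Omega>. Pi_h \<T> z x = y x}. Drt z)"
proof -
  let ?H = "\<Sum>T\<in>\<T>. m T * huber (\<zeta> (centroid T)) (y (centroid T))"
  let ?Z = "{z\<in>RT \<Omega> \<T>. AE x in lebesgue_on \<Omega>. Pi_h \<T> z x = y x}"
  let ?F = "fenchel_conj (CR \<Omega> \<T>) (F_h \<Omega> \<T> \<Gamma>\<^sub>D \<Gamma>\<^sub>N f g u\<^sub>D) (\<lambda>v. - grad_adj \<Omega> \<T> y v)"
  have Z: "z \<in> ?Z \<longleftrightarrow> z \<in> RT \<Omega> \<T> \<and> (\<forall>T\<in>\<T>. z (centroid T) = y (centroid T))" for z
  proof (cases "z \<in> RT \<Omega> \<T>")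
    case True
    have "(AE x in lebesgue_on \<Omega>. Pi_h \<T> z x = y x) \<longleftrightarrow> (\<forall>T\<in>\<T>. z (centroid T) = y (centroid T))"
      by (rule AE_mesh) (simp add: P0_eq[OF y] Pi_h_eq[OF RT_P1[OF True]])
    then show ?thesis using True by simp
  qed simp
  have dual: "fenchel_dual \<Omega> \<T> \<Gamma>\<^sub>D \<Gamma>\<^sub>N f g \<zeta> u\<^sub>D y = - ereal ?H - ?F"
    unfolding fenchel_dual_def conj_G[OF y] ..
  have F: "?F = (SUP v\<in>CR \<Omega> \<T>. if \<forall>S\<in>D. side_value v S = u\<^sub>D (side_centroid S) then ereal (residual y v) else - \<infinity>)"
    unfolding fenchel_conj_def by (rule SUP_cong[OF refl]) (rule conj_F_summand[OF y])
  have upper: "Drt z = ereal (- ?H - residual y v)"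
    if z: "z \<in> Krt" "\<And>T. T \<in> \<T> \<Longrightarrow> z (centroid T) = y (centroid T)"
      and v: "v \<in> CR \<Omega> \<T>" "\<And>S. S \<in> D \<Longrightarrow> side_value v S = u\<^sub>D (side_centroid S)" for z v
    using pairing[OF v(1) z(1)] z v(2) by (simp add: D_rt_eq dual_energy_def residual_def)
  show ?thesis
  proof (cases "\<forall>S\<in>sides \<T> - D. (\<Sum>T\<in>\<T>. m T * (y (centroid T) \<bullet> side_grad S T)) = side_load S")
    case True
    obtain z where z: "z \<in> Krt" "\<And>T. T \<in> \<T> \<Longrightarrow> z (centroid T) = y (centroid T)"
      using flux_reconstruction[of "\<lambda>T. y (centroid T)"] True by blast
    have res: "residual y v = residual y w" if "v \<in> CR \<Omega> \<T>" "\<forall>S\<in>D. side_value v S = u\<^sub>D (side_centroid S)" for v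
      using upper[OF z w] upper[OF z that(1)] that(2) by simp
    have "?F = ereal (residual y w)" unfolding F
    proof (rule antisym)
      show "(SUP v\<in>CR \<Omega> \<T>. if \<forall>S\<in>D. side_value v S = u\<^sub>D (side_centroid S) then ereal (residual y v) else - \<infinity>) \<le> ereal (residual y w)"
        by (rule SUP_least) (use res in auto)
      show "ereal (residual y w) \<le> (SUP v\<in>CR \<Omega> \<T>. if \<forall>S\<in>D. side_value v S = u\<^sub>D (side_centroid S) then ereal (residual y v) else - \<infinity>)"
        by (rule SUP_upper2[OF w(1)]) (use w(2) in simp)
    qed
    then have lhs: "fenchel_dual \<Omega> \<T> \<Gamma>\<^sub>D \<Gamma>\<^sub>N f g \<zeta> u\<^sub>D y = ereal (- ?H - residual y w)" by (simp add: dual)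
    also have "\<dots> = (SUP z\<in>?Z. Drt z)"
    proof (rule antisym)
      have "z \<in> ?Z" using z Z by (simp add: K_rt_iff)
      then show "ereal (- ?H - residual y w) \<le> (SUP z\<in>?Z. Drt z)"
        by (rule SUP_upper2) (simp add: upper[OF z w])
      show "(SUP z\<in>?Z. Drt z) \<le> ereal (- ?H - residual y w)"
      proof (rule SUP_least)
        fix z' assume z': "z' \<in> ?Z"
        show "Drt z' \<le> ereal (- ?H - residual y w)"
        proof (cases "z' \<in> Krt")
          case True
          then show ?thesis using upper[OF True _ w] z' Z[of z'] by simp
        qed (simp add: D_rt_eq)
      qed
    qed
    finally show ?thesis .
  next
    case False
    then obtain S where S: "S \<in> sides \<T> - D" "(\<Sum>T\<in>\<T>. m T * (y (centroid T) \<bullet> side_grad S T)) \<noteq> side_load S" by blast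
    define r where "r = side_load S - (\<Sum>T\<in>\<T>. m T * (y (centroid T) \<bullet> side_grad S T))"
    have r: "r \<noteq> 0" using S by (simp add: r_def)
    have "?F = \<infinity>"
    proof (rule ereal_top)
      fix b :: real
      \<comment> \<open>The step along the hat function for which the residual equals \<open>b\<close>.\<close>
      define t where "t = (b - residual y w) / r"
      obtain v where v: "v \<in> CR \<Omega> \<T>" "\<And>S'. S' \<in> sides \<T> - {S} \<Longrightarrow> side_value v S' = side_value w S'"
        "\<And>T. T \<in> \<T> \<Longrightarrow> elem_grad v T = elem_grad w T + (\<Sum>S\<in>{S}. t *\<^sub>R side_grad S T)" "load v = load w + (\<Sum>S\<in>{S}. t * side_load S)"
        using perturb[OF w(1), of "{S}" "\<lambda>_. t"] S by blast
      have "(\<Sum>T\<in>\<T>. m T * (y (centroid T) \<bullet> elem_grad v T)) = (\<Sum>T\<in>\<T>. m T * (y (centroid T) \<bullet> elem_grad w T)) + t * (\<Sum>T\<in>\<T>. m T * (y (centroid T) \<bullet> side_grad S T))"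
        by (simp add: v(3) inner_add_right distrib_left sum.distrib sum_distrib_left mult.left_commute)
      then have "residual y v = residual y w + t * r"
        using v(4) by (simp add: residual_def r_def right_diff_distrib)
      then have "residual y v = b" using r by (simp add: t_def)
      moreover have "\<forall>S\<in>D. side_value v S = u\<^sub>D (side_centroid S)"
      proof
        fix S' assume S': "S' \<in> D"
        then have "S' \<in> sides \<T> - {S}" using S(1) D_subset_sides by blast
        then show "side_value v S' = u\<^sub>D (side_centroid S')" using v(2) w(2)[OF S'] by simp
      qed
      ultimately have "ereal b \<le> (if \<forall>S\<in>D. side_value v S = u\<^sub>D (side_centroid S) then ereal (residual y v) else - \<infinity>)" by simp
      then show "ereal b \<le> ?F" unfolding F by (rule SUP_upper2[OF v(1)])
    qed
    then have "fenchel_dual \<Omega> \<T> \<Gamma>\<^sub>D \<Gamma>\<^sub>N f g \<zeta> u\<^sub>D y = - \<infinity>" by (simp add: dual)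
    moreover have "(SUP z\<in>?Z. Drt z) \<le> - \<infinity>"
    proof (rule SUP_least)
      fix z assume z: "z \<in> ?Z"
      have "z \<notin> Krt"
      proof
        assume "z \<in> Krt"
        then have "(\<Sum>T\<in>\<T>. m T * (z (centroid T) \<bullet> side_grad S T)) = side_load S" using S(1) by (rule reconstruction_condition)
        then show False using S(2) z Z[of z] by simp
      qed
      then show "Drt z \<le> - \<infinity>" by (simp add: D_rt_eq)
    qed
    ultimately show ?thesis by simp
  qed
qed

end

section \<open>Discrete duality\<close>

theorem theorem5p2:
  fixes \<Omega> \<Gamma>\<^sub>D \<Gamma>\<^sub>N :: "'a::euclidean_space set" and \<T> :: "'a set set" and \<omega>\<^sub>0 :: real
    and f g \<zeta> u\<^sub>D u :: "'a \<Rightarrow> real"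
  assumes domain: "bounded \<Omega>" "lipschitz_domain \<Omega>"
    and mesh: "simplicial_mesh \<Omega> \<T>" "shape_regular \<omega>\<^sub>0 \<T>"
    and boundary: "mixed_boundary \<Omega> \<T> \<Gamma>\<^sub>D \<Gamma>\<^sub>N"
    and f: "f \<in> broken_P0 \<T>"
    and g: "g \<in> side_P0 \<Omega> \<T> \<Gamma>\<^sub>N"
    and zeta: "\<zeta> \<in> broken_P0 \<T>" "essinf (lebesgue_on \<Omega>) (\<lambda>x. ereal (\<zeta> x)) > 0"
    and uD: "u\<^sub>D \<in> side_P0 \<Omega> \<T> \<Gamma>\<^sub>D"
      "\<exists>w\<in>CR \<Omega> \<T>. dirichlet_data \<Omega> \<T> \<Gamma>\<^sub>D u\<^sub>D w \<and>
         esssup (lebesgue_on \<Omega>) (\<lambda>x. ereal (norm (grad_h \<T> w x /\<^sub>R \<zeta> x))) < 1"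
    and minimizer: "u \<in> K_cr \<Omega> \<T> \<Gamma>\<^sub>D \<zeta> u\<^sub>D"
      "\<forall>v\<in>CR \<Omega> \<T>. I_cr \<Omega> \<T> \<Gamma>\<^sub>D \<Gamma>\<^sub>N f g \<zeta> u\<^sub>D u \<le> I_cr \<Omega> \<T> \<Gamma>\<^sub>D \<Gamma>\<^sub>N f g \<zeta> u\<^sub>D v"
  shows "(\<forall>y\<in>broken_P0 \<T>.
            fenchel_dual \<Omega> \<T> \<Gamma>\<^sub>D \<Gamma>\<^sub>N f g \<zeta> u\<^sub>D y =
            (SUP z\<in>{z\<in>RT \<Omega> \<T>. AE x in lebesgue_on \<Omega>. Pi_h \<T> z x = y x}.
               D_rt \<Omega> \<T> \<Gamma>\<^sub>D \<Gamma>\<^sub>N f g \<zeta> u\<^sub>D z))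
       \<and> (\<exists>z\<in>RT \<Omega> \<T>.
            (\<forall>y\<in>RT \<Omega> \<T>. D_rt \<Omega> \<T> \<Gamma>\<^sub>D \<Gamma>\<^sub>N f g \<zeta> u\<^sub>D y \<le> D_rt \<Omega> \<T> \<Gamma>\<^sub>D \<Gamma>\<^sub>N f g \<zeta> u\<^sub>D z) \<and>
            (AE x in lebesgue_on \<Omega>. div_h \<T> z x = - f x) \<and>
            (AE x in bd_measure \<Omega> \<T>. x \<in> \<Gamma>\<^sub>N \<longrightarrow> normal_trace \<Omega> \<T> z x = g x) \<and>
            I_cr \<Omega> \<T> \<Gamma>\<^sub>D \<Gamma>\<^sub>N f g \<zeta> u\<^sub>D u = D_rt \<Omega> \<T> \<Gamma>\<^sub>D \<Gamma>\<^sub>N f g \<zeta> u\<^sub>D z)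
       \<and> (\<forall>z\<in>RT \<Omega> \<T>.
            I_cr \<Omega> \<T> \<Gamma>\<^sub>D \<Gamma>\<^sub>N f g \<zeta> u\<^sub>D u = D_rt \<Omega> \<T> \<Gamma>\<^sub>D \<Gamma>\<^sub>N f g \<zeta> u\<^sub>D z \<longrightarrow>
            (AE x in lebesgue_on \<Omega>.
               GDERIV (phi_star \<zeta> x) (Pi_h \<T> z x) :> grad_h \<T> u x \<and>
               grad_h \<T> u x =
                 (if norm (Pi_h \<T> z x) \<le> \<zeta> x then Pi_h \<T> z x
                  else (\<zeta> x / norm (Pi_h \<T> z x)) *\<^sub>R Pi_h \<T> z x)))"
proof -
  interpret mesh \<Omega> \<T> using domain mesh(1) by unfold_locales
  have zpos: "0 < \<zeta> (centroid T)" if T: "T \<in> \<T>" for T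
  proof -
    have neg: "esssup (lebesgue_on \<Omega>) (\<lambda>x. - ereal (\<zeta> x)) < 0"
      using zeta(2) unfolding essinf_def by (simp add: ereal_less_uminus_reorder)
    have "AE x in lebesgue_on \<Omega>. 0 < \<zeta> x"
      using esssup_AE[of "\<lambda>x. - ereal (\<zeta> x)" "lebesgue_on \<Omega>"]
    proof (eventually_elim)
      fix x assume "- ereal (\<zeta> x) \<le> esssup (lebesgue_on \<Omega>) (\<lambda>x. - ereal (\<zeta> x))"
      then have "- ereal (\<zeta> x) < 0" using neg by (rule le_less_trans)
      then show "0 < \<zeta> x" by simp
    qed
    moreover have "(AE x in lebesgue_on \<Omega>. 0 < \<zeta> x) \<longleftrightarrow> (\<forall>T\<in>\<T>. 0 < \<zeta> (centroid T))"
      by (rule AE_mesh) (simp add: P0_eq[OF zeta(1)])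
    ultimately show ?thesis using T by blast
  qed
  obtain w where w: "w \<in> CR \<Omega> \<T>" "dirichlet_data \<Omega> \<T> \<Gamma>\<^sub>D u\<^sub>D w"
    "esssup (lebesgue_on \<Omega>) (\<lambda>x. ereal (norm (grad_h \<T> w x /\<^sub>R \<zeta> x))) < 1" using uD(2) by blast
  interpret gradient_constrained_problem \<Omega> \<T> \<Gamma>\<^sub>D \<Gamma>\<^sub>N f g \<zeta> u\<^sub>D
    using boundary f g zeta(1) zpos uD(1) by unfold_locales
  have wD: "side_value w S = u\<^sub>D (side_centroid S)" if "S \<in> D" for S using w(2) that dirichlet_iff[OF w(1)] by blast
  have slater: "norm (elem_grad w T) < \<zeta> (centroid T)" if T: "T \<in> \<T>" for T
  proof -
    have "AE x in lebesgue_on \<Omega>. norm (grad_h \<T> w x /\<^sub>R \<zeta> x) < 1"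
      using esssup_AE[of "\<lambda>x. ereal (norm (grad_h \<T> w x /\<^sub>R \<zeta> x))" "lebesgue_on \<Omega>"]
    proof eventually_elim
      fix x assume "ereal (norm (grad_h \<T> w x /\<^sub>R \<zeta> x)) \<le> esssup (lebesgue_on \<Omega>) (\<lambda>x. ereal (norm (grad_h \<T> w x /\<^sub>R \<zeta> x)))"
      then have "ereal (norm (grad_h \<T> w x /\<^sub>R \<zeta> x)) < 1" using w(3) by (rule le_less_trans)
      then show "norm (grad_h \<T> w x /\<^sub>R \<zeta> x) < 1" by simp
    qed
    moreover have "(AE x in lebesgue_on \<Omega>. norm (grad_h \<T> w x /\<^sub>R \<zeta> x) < 1) \<longleftrightarrow> (\<forall>T\<in>\<T>. norm (elem_grad w T /\<^sub>R \<zeta> (centroid T)) < 1)"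
      by (rule AE_mesh) (simp add: P0_eq[OF zeta(1)] P1_grad(2)[OF CR_P1[OF w(1)]])
    ultimately have "norm (elem_grad w T /\<^sub>R \<zeta> (centroid T)) < 1" using T by blast
    then show ?thesis using zpos[OF T] by (simp add: divide_simps)
  qed
  have Iu: "I_cr \<Omega> \<T> \<Gamma>\<^sub>D \<Gamma>\<^sub>N f g \<zeta> u\<^sub>D u = ereal (energy u)" using minimizer(1) by (simp add: I_cr_eq)
  have min: "energy u \<le> energy v" if v: "v \<in> K_cr \<Omega> \<T> \<Gamma>\<^sub>D \<zeta> u\<^sub>D" for v
  proof -
    have "v \<in> CR \<Omega> \<T>" using v by (simp add: K_cr_def)
    then have "I_cr \<Omega> \<T> \<Gamma>\<^sub>D \<Gamma>\<^sub>N f g \<zeta> u\<^sub>D u \<le> I_cr \<Omega> \<T> \<Gamma>\<^sub>D \<Gamma>\<^sub>N f g \<zeta> u\<^sub>D v"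
      using minimizer(2) by blast
    then show ?thesis using v by (simp add: Iu) (simp add: I_cr_eq)
  qed
  have part1: "\<forall>y\<in>broken_P0 \<T>. fenchel_dual \<Omega> \<T> \<Gamma>\<^sub>D \<Gamma>\<^sub>N f g \<zeta> u\<^sub>D y =
      (SUP z\<in>{z\<in>RT \<Omega> \<T>. AE x in lebesgue_on \<Omega>. Pi_h \<T> z x = y x}. D_rt \<Omega> \<T> \<Gamma>\<^sub>D \<Gamma>\<^sub>N f g \<zeta> u\<^sub>D z)"
    using fenchel_dual_eq[OF w(1) wD] by blast
  obtain z where z: "z \<in> K_rt \<Omega> \<T> \<Gamma>\<^sub>N f g" "energy u = dual_energy z"
    using strong_duality[OF w(1) wD slater minimizer(1) min] by blast
  have max: "D_rt \<Omega> \<T> \<Gamma>\<^sub>D \<Gamma>\<^sub>N f g \<zeta> u\<^sub>D y \<le> D_rt \<Omega> \<T> \<Gamma>\<^sub>D \<Gamma>\<^sub>N f g \<zeta> u\<^sub>D z" for y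
    using z weak_duality[OF minimizer(1), of y] by (simp add: D_rt_eq)
  have part2: "\<exists>z\<in>RT \<Omega> \<T>.
      (\<forall>y\<in>RT \<Omega> \<T>. D_rt \<Omega> \<T> \<Gamma>\<^sub>D \<Gamma>\<^sub>N f g \<zeta> u\<^sub>D y \<le> D_rt \<Omega> \<T> \<Gamma>\<^sub>D \<Gamma>\<^sub>N f g \<zeta> u\<^sub>D z) \<and>
      (AE x in lebesgue_on \<Omega>. div_h \<T> z x = - f x) \<and>
      (AE x in bd_measure \<Omega> \<T>. x \<in> \<Gamma>\<^sub>N \<longrightarrow> normal_trace \<Omega> \<T> z x = g x) \<and>
      I_cr \<Omega> \<T> \<Gamma>\<^sub>D \<Gamma>\<^sub>N f g \<zeta> u\<^sub>D u = D_rt \<Omega> \<T> \<Gamma>\<^sub>D \<Gamma>\<^sub>N f g \<zeta> u\<^sub>D z"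
  proof (intro bexI[of _ z] conjI ballI max)
    show "I_cr \<Omega> \<T> \<Gamma>\<^sub>D \<Gamma>\<^sub>N f g \<zeta> u\<^sub>D u = D_rt \<Omega> \<T> \<Gamma>\<^sub>D \<Gamma>\<^sub>N f g \<zeta> u\<^sub>D z" using z by (simp add: Iu D_rt_eq)
  qed (use z(1) in \<open>auto simp: K_rt_def\<close>)
  have part3: "AE x in lebesgue_on \<Omega>. GDERIV (phi_star \<zeta> x) (Pi_h \<T> z x) :> grad_h \<T> u x \<and>
      grad_h \<T> u x = (if norm (Pi_h \<T> z x) \<le> \<zeta> x then Pi_h \<T> z x else (\<zeta> x / norm (Pi_h \<T> z x)) *\<^sub>R Pi_h \<T> z x)"
    if zR: "z \<in> RT \<Omega> \<T>" and eq: "I_cr \<Omega> \<T> \<Gamma>\<^sub>D \<Gamma>\<^sub>N f g \<zeta> u\<^sub>D u = D_rt \<Omega> \<T> \<Gamma>\<^sub>D \<Gamma>\<^sub>N f g \<zeta> u\<^sub>D z" for z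
  proof -
    have zK: "z \<in> K_rt \<Omega> \<T> \<Gamma>\<^sub>N f g" and e: "energy u = dual_energy z"
      using eq by (auto simp: Iu D_rt_eq split: if_splits)
    have "(AE x in lebesgue_on \<Omega>. GDERIV (phi_star \<zeta> x) (Pi_h \<T> z x) :> grad_h \<T> u x \<and>
        grad_h \<T> u x = prox (\<zeta> x) (Pi_h \<T> z x)) \<longleftrightarrow>
      (\<forall>T\<in>\<T>. GDERIV (huber (\<zeta> (centroid T))) (z (centroid T)) :> elem_grad u T \<and> elem_grad u T = prox (\<zeta> (centroid T)) (z (centroid T)))"
      using minimizer(1) by (intro AE_mesh)
        (simp add: K_cr_def phi_star_huber P0_eq[OF zeta(1)] Pi_h_eq[OF RT_P1[OF zR]] P1_grad(2)[OF CR_P1])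
    moreover have "\<forall>T\<in>\<T>. GDERIV (huber (\<zeta> (centroid T))) (z (centroid T)) :> elem_grad u T \<and> elem_grad u T = prox (\<zeta> (centroid T)) (z (centroid T))"
    proof (intro ballI conjI)
      fix T assume T: "T \<in> \<T>"
      show opt: "elem_grad u T = prox (\<zeta> (centroid T)) (z (centroid T))"
        by (rule optimality_from_duality[OF minimizer(1) zK e T])
      show "GDERIV (huber (\<zeta> (centroid T))) (z (centroid T)) :> elem_grad u T"
        unfolding opt by (rule huber_gradient[OF zpos[OF T]])
    qed
    ultimately show ?thesis unfolding prox_def by blast
  qed
  show ?thesis using part1 part2 part3 by blast
qed

end
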